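(* Let $\mathcal{A}$ be an involutive Hopf algebra. Then the following data define a braided tensor category $(\mathcal{C}_*(\mathcal{A}),\Psi)$. Objects: quadruples $(V,\alpha_V,\gamma_V,*_V)$ consisting of a complex vector space $V$ with a conjugation $*_V$, a left action $\alpha_V:\mathcal{A}\otimes V\to V$ and a left coaction $\gamma_V:V\to\mathcal{A}\otimes V$ of $\mathcal{A}$, such that (a) $(m\otimes\alpha_V)\circ(\mathrm{id}\otimes\tau\otimes\mathrm{id})\circ(\Delta\otimes\gamma_V)=(m\otimes\mathrm{id})\circ(\mathrm{id}\otimes\tau)\circ(\gamma_V\otimes\mathrm{id})\circ(\alpha_V\otimes\mathrm{id})\circ(\mathrm{id}\otimes\tau)\circ(\Delta\otimes\mathrm{id})$, (b) $*_V\circ\alpha_V=\alpha_V\circ( *\otimes*_V)\circ(S\otimes\mathrm{id})$, (c) $\gamma_V\circ*_V=( *\otimes*_V)\circ\gamma_V$. Morphisms: the linear maps $f:V\to W$ that are module maps and comodule maps. Tensor product of objects: $V\otimes W$ with $\alpha_{V\otimes W}=(\alpha_V\otimes\alpha_W)\circ(\mathrm{id}\otimes\tau\otimes\mathrm{id})\circ(\Delta\otimes\mathrm{id}\otimes\mathrm{id})$, $\gamma_{V\otimes W}=(m\otimes\mathrm{id}\otimes\mathrm{id})\circ(\mathrm{id}\otimes\tau\otimes\mathrm{id})\circ(\gamma_V\otimes\gamma_W)$, and involution $*_{V\otimes W}=\Psi_{W,V}\circ( *_W\otimes*_V)\circ\tau_{V,W}$; the tensor product of morphisms is the usual tensor product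 of linear maps. Braiding: $\Psi_{V,W}=(\alpha_W\otimes\mathrm{id}_V)\circ(\mathrm{id}_{\mathcal{A}}\otimes\tau_{V,W})\circ(\gamma_V\otimes\mathrm{id}_W):V\otimes W\to W\otimes V$.
   Context: An involutive Hopf algebra $\mathcal{A}$ is a complex Hopf algebra (product $m$, coproduct $\Delta$, counit, antipode $S$) that is a $*$-algebra such that $\Delta$ and the counit are $*$-homomorphisms; then $S\circ*\circ S\circ*=\mathrm{id}$, so $S$ is invertible. $\tau$ denotes flips $u\otimes v\mapsto v\otimes u$. A conjugation is an anti-linear involution, and tensor products of anti-linear maps are anti-linear, $( *\otimes * )(u\otimes v)=u^*\otimes v^*$. In Sweedler notation ($\gamma_V(v)=v_{(-1)}\otimes v_{(0)}$, $\alpha_V(a\otimes v)=a\cdot v$) the conditions read: (a) $a_{(1)}v_{(-1)}\otimes a_{(2)}\cdot v_{(0)}=(a_{(1)}\cdot v)_{(-1)}a_{(2)}\otimes(a_{(1)}\cdot v)_{(0)}$; (b) $(a\cdot v)^*=S(a)^*\cdot v^*$; (c) $\gamma_V(v^* )=(v_{(-1)})^*\otimes(v_{(0)})^*$. The associativity and unit constraints are the trivial ones, the unit object being $\mathbb{C}$ with trivial action and coaction and complex conjugation. A braiding is a natural isomorphism $\Psi_{V,W}:V\otimes W\to W\otimes V$ satisfying the hexagon axioms. *)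

theory Defs
  imports "HOL-Algebra.Algebraic_Closure_Type" "HOL.Complex"
begin

no_notation var (\<open>X\<index>\<close>)

section \<open>Braided tensor categories\<close>

record ('o, 'm) category_data =
  obj :: "'o set"
  hom_set :: "'o \<Rightarrow> 'o \<Rightarrow> 'm set"
  ident :: "'o \<Rightarrow> 'm"
  comp_arr :: "'m \<Rightarrow> 'm \<Rightarrow> 'm" (infixr \<open>\<bullet>\<index>\<close> 55)

record ('o, 'm) tensor_category_data = "('o, 'm) category_data" +
  tensor_obj :: "'o \<Rightarrow> 'o \<Rightarrow> 'o" (infixl \<open>\<boxtimes>\<index>\<close> 70)
  tensor_arr :: "'m \<Rightarrow> 'm \<Rightarrow> 'm" (infixl \<open>\<boxdot>\<index>\<close> 70)
  unit_obj :: "'o"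
  associator :: "'o \<Rightarrow> 'o \<Rightarrow> 'o \<Rightarrow> 'm"
  left_unitor :: "'o \<Rightarrow> 'm"
  right_unitor :: "'o \<Rightarrow> 'm"

record ('o, 'm) braided_category_data = "('o, 'm) tensor_category_data" +
  braiding :: "'o \<Rightarrow> 'o \<Rightarrow> 'm"

definition inverse_arrows ::
  "('o, 'm, 'z) category_data_scheme \<Rightarrow> 'o \<Rightarrow> 'o \<Rightarrow> 'm \<Rightarrow> 'm \<Rightarrow> bool" where
  "inverse_arrows C X Y f g \<longleftrightarrow> f \<in> hom_set C X Y \<and> g \<in> hom_set C Y X
     \<and> g \<bullet>\<^bsub>C\<^esub> f = ident C X \<and> f \<bullet>\<^bsub>C\<^esub> g = ident C Y"

definition iso_arrow ::
  "('o, 'm, 'z) category_data_scheme \<Rightarrow> 'o \<Rightarrow> 'o \<Rightarrow> 'm \<Rightarrow> bool" where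
  "iso_arrow C X Y f \<longleftrightarrow> (\<exists>g. inverse_arrows C X Y f g)"

definition inv_arrow ::
  "('o, 'm, 'z) category_data_scheme \<Rightarrow> 'o \<Rightarrow> 'o \<Rightarrow> 'm \<Rightarrow> 'm" where
  "inv_arrow C X Y f = (THE g. inverse_arrows C X Y f g)"

locale category =
  fixes C :: "('o, 'm, 'z) category_data_scheme" (structure)
  assumes hom_disjoint:
      "\<lbrakk>X \<in> obj C; Y \<in> obj C; X' \<in> obj C; Y' \<in> obj C;
        f \<in> hom_set C X Y; f \<in> hom_set C X' Y'\<rbrakk> \<Longrightarrow> X = X' \<and> Y = Y'"
    and ident_in_hom: "X \<in> obj C \<Longrightarrow> ident C X \<in> hom_set C X X"
    and comp_in_hom:
      "\<lbrakk>X \<in> obj C; Y \<in> obj C; Z \<in> obj C; f \<in> hom_set C X Y; g \<in> hom_set C Y Z\<rbrakk>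
        \<Longrightarrow> g \<bullet> f \<in> hom_set C X Z"
    and comp_ident_left:
      "\<lbrakk>X \<in> obj C; Y \<in> obj C; f \<in> hom_set C X Y\<rbrakk> \<Longrightarrow> ident C Y \<bullet> f = f"
    and comp_ident_right:
      "\<lbrakk>X \<in> obj C; Y \<in> obj C; f \<in> hom_set C X Y\<rbrakk> \<Longrightarrow> f \<bullet> ident C X = f"
    and comp_assoc:
      "\<lbrakk>W \<in> obj C; X \<in> obj C; Y \<in> obj C; Z \<in> obj C;
        f \<in> hom_set C W X; g \<in> hom_set C X Y; h \<in> hom_set C Y Z\<rbrakk>
        \<Longrightarrow> (h \<bullet> g) \<bullet> f = h \<bullet> (g \<bullet> f)"

locale tensor_category = category C
  for C :: "('o, 'm, 'z) tensor_category_data_scheme" (structure) +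
  assumes tensor_obj_closed: "\<lbrakk>X \<in> obj C; Y \<in> obj C\<rbrakk> \<Longrightarrow> X \<boxtimes> Y \<in> obj C"
    and tensor_arr_in_hom:
      "\<lbrakk>X \<in> obj C; X' \<in> obj C; Y \<in> obj C; Y' \<in> obj C;
        f \<in> hom_set C X X'; g \<in> hom_set C Y Y'\<rbrakk>
        \<Longrightarrow> f \<boxdot> g \<in> hom_set C (X \<boxtimes> Y) (X' \<boxtimes> Y')"
    and tensor_ident:
      "\<lbrakk>X \<in> obj C; Y \<in> obj C\<rbrakk> \<Longrightarrow> ident C X \<boxdot> ident C Y = ident C (X \<boxtimes> Y)"
    and tensor_comp:
      "\<lbrakk>X \<in> obj C; X' \<in> obj C; X'' \<in> obj C; Y \<in> obj C; Y' \<in> obj C; Y'' \<in> obj C;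
        f \<in> hom_set C X X'; f' \<in> hom_set C X' X'';
        g \<in> hom_set C Y Y'; g' \<in> hom_set C Y' Y''\<rbrakk>
        \<Longrightarrow> (f' \<bullet> f) \<boxdot> (g' \<bullet> g) = (f' \<boxdot> g') \<bullet> (f \<boxdot> g)"
    and unit_closed: "unit_obj C \<in> obj C"
    and associator_iso:
      "\<lbrakk>X \<in> obj C; Y \<in> obj C; Z \<in> obj C\<rbrakk>
        \<Longrightarrow> iso_arrow C ((X \<boxtimes> Y) \<boxtimes> Z) (X \<boxtimes> (Y \<boxtimes> Z)) (associator C X Y Z)"
    and associator_natural:
      "\<lbrakk>X \<in> obj C; X' \<in> obj C; Y \<in> obj C; Y' \<in> obj C; Z \<in> obj C; Z' \<in> obj C;
        f \<in> hom_set C X X'; g \<in> hom_set C Y Y'; h \<in> hom_set C Z Z'\<rbrakk>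
        \<Longrightarrow> associator C X' Y' Z' \<bullet> ((f \<boxdot> g) \<boxdot> h) = (f \<boxdot> (g \<boxdot> h)) \<bullet> associator C X Y Z"
    and left_unitor_iso:
      "X \<in> obj C \<Longrightarrow> iso_arrow C (unit_obj C \<boxtimes> X) X (left_unitor C X)"
    and left_unitor_natural:
      "\<lbrakk>X \<in> obj C; Y \<in> obj C; f \<in> hom_set C X Y\<rbrakk>
        \<Longrightarrow> left_unitor C Y \<bullet> (ident C (unit_obj C) \<boxdot> f) = f \<bullet> left_unitor C X"
    and right_unitor_iso:
      "X \<in> obj C \<Longrightarrow> iso_arrow C (X \<boxtimes> unit_obj C) X (right_unitor C X)"
    and right_unitor_natural:
      "\<lbrakk>X \<in> obj C; Y \<in> obj C; f \<in> hom_set C X Y\<rbrakk>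
        \<Longrightarrow> right_unitor C Y \<bullet> (f \<boxdot> ident C (unit_obj C)) = f \<bullet> right_unitor C X"
    and pentagon:
      "\<lbrakk>W \<in> obj C; X \<in> obj C; Y \<in> obj C; Z \<in> obj C\<rbrakk>
        \<Longrightarrow> (ident C W \<boxdot> associator C X Y Z) \<bullet> associator C W (X \<boxtimes> Y) Z
              \<bullet> (associator C W X Y \<boxdot> ident C Z)
          = associator C W X (Y \<boxtimes> Z) \<bullet> associator C (W \<boxtimes> X) Y Z"
    and triangle:
      "\<lbrakk>X \<in> obj C; Y \<in> obj C\<rbrakk>
        \<Longrightarrow> (ident C X \<boxdot> left_unitor C Y) \<bullet> associator C X (unit_obj C) Y
          = right_unitor C X \<boxdot> ident C Y"

locale braided_tensor_category = tensor_category C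
  for C :: "('o, 'm, 'z) braided_category_data_scheme" (structure) +
  assumes braiding_iso:
      "\<lbrakk>X \<in> obj C; Y \<in> obj C\<rbrakk> \<Longrightarrow> iso_arrow C (X \<boxtimes> Y) (Y \<boxtimes> X) (braiding C X Y)"
    and braiding_natural:
      "\<lbrakk>X \<in> obj C; X' \<in> obj C; Y \<in> obj C; Y' \<in> obj C;
        f \<in> hom_set C X X'; g \<in> hom_set C Y Y'\<rbrakk>
        \<Longrightarrow> braiding C X' Y' \<bullet> (f \<boxdot> g) = (g \<boxdot> f) \<bullet> braiding C X Y"
    and hexagon_1:
      "\<lbrakk>X \<in> obj C; Y \<in> obj C; Z \<in> obj C\<rbrakk>
        \<Longrightarrow> associator C Y Z X \<bullet> braiding C X (Y \<boxtimes> Z) \<bullet> associator C X Y Z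
          = (ident C Y \<boxdot> braiding C X Z) \<bullet> associator C Y X Z
              \<bullet> (braiding C X Y \<boxdot> ident C Z)"
    and hexagon_2:
      "\<lbrakk>X \<in> obj C; Y \<in> obj C; Z \<in> obj C\<rbrakk>
        \<Longrightarrow> inv_arrow C ((Z \<boxtimes> X) \<boxtimes> Y) (Z \<boxtimes> (X \<boxtimes> Y)) (associator C Z X Y)
              \<bullet> braiding C (X \<boxtimes> Y) Z
              \<bullet> inv_arrow C ((X \<boxtimes> Y) \<boxtimes> Z) (X \<boxtimes> (Y \<boxtimes> Z)) (associator C X Y Z)
          = (braiding C X Z \<boxdot> ident C Y)
              \<bullet> inv_arrow C ((X \<boxtimes> Z) \<boxtimes> Y) (X \<boxtimes> (Z \<boxtimes> Y)) (associator C X Z Y)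
              \<bullet> (ident C X \<boxdot> braiding C Y Z)"


section \<open>Complex vector spaces and their tensor products\<close>

text \<open>
  All vector spaces have their carrier in one type \<open>'a univ\<close>, which plays the role of a
  universe: it contains a copy of the arbitrary type \<open>'a\<close> and of the complex numbers, and
  it is closed under finite formal sums of pairs, so that the tensor product of two such vector
  spaces is again one. Since \<open>'a\<close> is arbitrary, any given vector spaces can be put in this
  form. The list \<open>[(v\<^sub>1,w\<^sub>1),\<dots>,(v\<^sub>n,w\<^sub>n)]\<close> stands for
  \<open>v\<^sub>1 \<otimes> w\<^sub>1 + \<dots> + v\<^sub>n \<otimes> w\<^sub>n\<close>.
\<close>

datatype 'a univ =
    Atom 'a
  | Scalar (scalar_of: complex)
  | Formal_Sum (summands: "('a univ \<times> 'a univ) list")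

abbreviation vector_space_C :: "(complex, 'u, 'x) module_scheme \<Rightarrow> bool" where
  "vector_space_C V \<equiv> module (ring_of_type_algebra :: complex ring) V"

definition linear_map ::
  "(complex, 'u, 'x) module_scheme \<Rightarrow> (complex, 'w, 'y) module_scheme \<Rightarrow> ('u \<Rightarrow> 'w) \<Rightarrow> bool" where
  "linear_map V W f \<longleftrightarrow> f \<in> carrier V \<rightarrow> carrier W
     \<and> (\<forall>x \<in> carrier V. \<forall>y \<in> carrier V. f (x \<oplus>\<^bsub>V\<^esub> y) = f x \<oplus>\<^bsub>W\<^esub> f y)
     \<and> (\<forall>c. \<forall>x \<in> carrier V. f (c \<odot>\<^bsub>V\<^esub> x) = c \<odot>\<^bsub>W\<^esub> f x)"

definition conjugation :: "(complex, 'u, 'x) module_scheme \<Rightarrow> ('u \<Rightarrow> 'u) \<Rightarrow> bool" where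
  "conjugation V f \<longleftrightarrow> f \<in> carrier V \<rightarrow> carrier V
     \<and> (\<forall>x \<in> carrier V. \<forall>y \<in> carrier V. f (x \<oplus>\<^bsub>V\<^esub> y) = f x \<oplus>\<^bsub>V\<^esub> f y)
     \<and> (\<forall>c. \<forall>x \<in> carrier V. f (c \<odot>\<^bsub>V\<^esub> x) = cnj c \<odot>\<^bsub>V\<^esub> f x)
     \<and> (\<forall>x \<in> carrier V. f (f x) = x)"

text \<open>
  The congruence on formal sums, with concatenation as addition, generated by commutativity and
  the bilinearity relations; its classes are the elements of the algebraic tensor product.
\<close>

inductive tensor_rel ::
  "(complex, 'u, 'x) module_scheme \<Rightarrow> (complex, 'u, 'y) module_scheme
    \<Rightarrow> ('u \<times> 'u) list \<Rightarrow> ('u \<times> 'u) list \<Rightarrow> bool"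
  for V :: "(complex, 'u, 'x) module_scheme" and W :: "(complex, 'u, 'y) module_scheme"
where
  refl: "tensor_rel V W k k"
| sym: "tensor_rel V W k l \<Longrightarrow> tensor_rel V W l k"
| trans: "tensor_rel V W k l \<Longrightarrow> tensor_rel V W l m \<Longrightarrow> tensor_rel V W k m"
| append: "tensor_rel V W k k' \<Longrightarrow> tensor_rel V W l l' \<Longrightarrow> tensor_rel V W (k @ l) (k' @ l')"
| commute: "tensor_rel V W (k @ l) (l @ k)"
| zero: "w \<in> carrier W \<Longrightarrow> tensor_rel V W [(\<zero>\<^bsub>V\<^esub>, w)] []"
| add_left: "\<lbrakk>v \<in> carrier V; v' \<in> carrier V; w \<in> carrier W\<rbrakk>
    \<Longrightarrow> tensor_rel V W [(v \<oplus>\<^bsub>V\<^esub> v', w)] [(v, w), (v', w)]"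
| add_right: "\<lbrakk>v \<in> carrier V; w \<in> carrier W; w' \<in> carrier W\<rbrakk>
    \<Longrightarrow> tensor_rel V W [(v, w \<oplus>\<^bsub>W\<^esub> w')] [(v, w), (v, w')]"
| smult: "\<lbrakk>v \<in> carrier V; w \<in> carrier W\<rbrakk>
    \<Longrightarrow> tensor_rel V W [(c \<odot>\<^bsub>V\<^esub> v, w)] [(v, c \<odot>\<^bsub>W\<^esub> w)]"

text \<open>
  A class is represented by one chosen member of it, because the set of all its members is not an
  element of the universe.
\<close>

definition tensor_class ::
  "(complex, 'a univ, 'x) module_scheme \<Rightarrow> (complex, 'a univ, 'y) module_scheme
    \<Rightarrow> ('a univ \<times> 'a univ) list \<Rightarrow> 'a univ" where
  "tensor_class V W l = Formal_Sum (SOME k. tensor_rel V W l k)"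

definition pure ::
  "(complex, 'a univ, 'x) module_scheme \<Rightarrow> (complex, 'a univ, 'y) module_scheme
    \<Rightarrow> 'a univ \<Rightarrow> 'a univ \<Rightarrow> 'a univ" where
  "pure V W v w = tensor_class V W [(v, w)]"

text \<open>
  The fields \<open>mult\<close> and \<open>one\<close>, which the record type of modules inherits from rings, have no
  meaning for vector spaces.
\<close>

definition tensor ::
  "(complex, 'a univ, 'x) module_scheme \<Rightarrow> (complex, 'a univ, 'y) module_scheme
    \<Rightarrow> (complex, 'a univ) module" where
  "tensor V W = \<lparr>
     carrier = {tensor_class V W l | l. set l \<subseteq> carrier V \<times> carrier W},
     monoid.mult = undefined, one = undefined,
     zero = tensor_class V W [],
     add = (\<lambda>s t. tensor_class V W (summands s @ summands t)),
     module.smult = (\<lambda>c t. tensor_class V W (map (\<lambda>(v, w). (c \<odot>\<^bsub>V\<^esub> v, w)) (summands t)))\<rparr>"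

text \<open>
  The map \<open>V \<otimes> W \<rightarrow> X\<close>, \<open>\<Sum> v\<^sub>i \<otimes> w\<^sub>i \<mapsto> \<Sum> B v\<^sub>i w\<^sub>i\<close>. It is well defined, that is,
  independent of the chosen representatives, for biadditive \<open>B\<close> with \<open>B (c v) w = B v (c w)\<close>;
  this covers linear as well as anti-linear maps on tensor products.
\<close>

definition lift ::
  "(complex, 'u, 'x) module_scheme \<Rightarrow> ('a univ \<Rightarrow> 'a univ \<Rightarrow> 'u) \<Rightarrow> 'a univ \<Rightarrow> 'u" where
  "lift X B t = foldr (\<lambda>(v, w) s. B v w \<oplus>\<^bsub>X\<^esub> s) (summands t) \<zero>\<^bsub>X\<^esub>"

text \<open>\<open>f \<otimes> g\<close>, where \<open>V\<close> and \<open>W\<close> are the codomains of \<open>f\<close> and \<open>g\<close>.\<close>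

definition tensor_map ::
  "(complex, 'a univ, 'x) module_scheme \<Rightarrow> (complex, 'a univ, 'y) module_scheme
    \<Rightarrow> ('a univ \<Rightarrow> 'a univ) \<Rightarrow> ('a univ \<Rightarrow> 'a univ) \<Rightarrow> 'a univ \<Rightarrow> 'a univ" where
  "tensor_map V W f g = lift (tensor V W) (\<lambda>v w. pure V W (f v) (g w))"

definition flip ::
  "(complex, 'a univ, 'x) module_scheme \<Rightarrow> (complex, 'a univ, 'y) module_scheme
    \<Rightarrow> 'a univ \<Rightarrow> 'a univ" where
  "flip V W = lift (tensor W V) (\<lambda>v w. pure W V w v)"

definition assoc ::
  "(complex, 'a univ, 'x) module_scheme \<Rightarrow> (complex, 'a univ, 'y) module_scheme
    \<Rightarrow> (complex, 'a univ, 'z) module_scheme \<Rightarrow> 'a univ \<Rightarrow> 'a univ" where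
  "assoc U V W = lift (tensor U (tensor V W))
     (\<lambda>s w. lift (tensor U (tensor V W)) (\<lambda>u v. pure U (tensor V W) u (pure V W v w)) s)"

definition assoc_inv ::
  "(complex, 'a univ, 'x) module_scheme \<Rightarrow> (complex, 'a univ, 'y) module_scheme
    \<Rightarrow> (complex, 'a univ, 'z) module_scheme \<Rightarrow> 'a univ \<Rightarrow> 'a univ" where
  "assoc_inv U V W = lift (tensor (tensor U V) W)
     (\<lambda>u s. lift (tensor (tensor U V) W) (\<lambda>v w. pure (tensor U V) W (pure U V u v) w) s)"

text \<open>\<open>id \<otimes> \<tau> : (U \<otimes> V) \<otimes> W \<rightarrow> (U \<otimes> W) \<otimes> V\<close>\<close>

definition swap_last ::
  "(complex, 'a univ, 'x) module_scheme \<Rightarrow> (complex, 'a univ, 'y) module_scheme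
    \<Rightarrow> (complex, 'a univ, 'z) module_scheme \<Rightarrow> 'a univ \<Rightarrow> 'a univ" where
  "swap_last U V W =
     assoc_inv U W V \<circ> tensor_map U (tensor W V) id (flip V W) \<circ> assoc U V W"

text \<open>\<open>id \<otimes> \<tau> \<otimes> id : (U \<otimes> V) \<otimes> (W \<otimes> X) \<rightarrow> (U \<otimes> W) \<otimes> (V \<otimes> X)\<close>\<close>

definition swap_mid ::
  "(complex, 'a univ, 'x) module_scheme \<Rightarrow> (complex, 'a univ, 'y) module_scheme
    \<Rightarrow> (complex, 'a univ, 'z) module_scheme \<Rightarrow> (complex, 'a univ, 't) module_scheme
    \<Rightarrow> 'a univ \<Rightarrow> 'a univ" where
  "swap_mid U V W X =
     assoc (tensor U W) V X \<circ> tensor_map (tensor (tensor U W) V) X (swap_last U V W) id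
       \<circ> assoc_inv (tensor U V) W X"


section \<open>Involutive Hopf algebras\<close>

record 'u hopf = "(complex, 'u) module" +
  coprod :: "'u \<Rightarrow> 'u"
  counit :: "'u \<Rightarrow> complex"
  antipode :: "'u \<Rightarrow> 'u"
  star :: "'u \<Rightarrow> 'u"

definition mult_map :: "('a univ, 'x) hopf_scheme \<Rightarrow> 'a univ \<Rightarrow> 'a univ" where
  "mult_map A = lift A (\<lambda>a b. a \<otimes>\<^bsub>A\<^esub> b)"

text \<open>The library locale \<open>algebra\<close> is restricted to commutative algebras.\<close>

locale hopf_algebra = ring A + module "ring_of_type_algebra :: complex ring" A
  for A :: "('a univ, 'x) hopf_scheme" (structure) +
  assumes mult_smult_left:
      "\<lbrakk>a \<in> carrier A; b \<in> carrier A\<rbrakk> \<Longrightarrow> (c \<odot> a) \<otimes> b = c \<odot> (a \<otimes> b)"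
    and mult_smult_right:
      "\<lbrakk>a \<in> carrier A; b \<in> carrier A\<rbrakk> \<Longrightarrow> a \<otimes> (c \<odot> b) = c \<odot> (a \<otimes> b)"
    and coprod_linear: "linear_map A (tensor A A) (coprod A)"
    and coassociative:
      "a \<in> carrier A \<Longrightarrow>
        assoc A A A (tensor_map (tensor A A) A (coprod A) id (coprod A a))
          = tensor_map A (tensor A A) id (coprod A) (coprod A a)"
    and counit_add:
      "\<lbrakk>a \<in> carrier A; b \<in> carrier A\<rbrakk> \<Longrightarrow> counit A (a \<oplus> b) = counit A a + counit A b"
    and counit_smult: "a \<in> carrier A \<Longrightarrow> counit A (c \<odot> a) = c * counit A a"
    and counit_left: "a \<in> carrier A \<Longrightarrow> lift A (\<lambda>x y. counit A x \<odot> y) (coprod A a) = a"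
    and counit_right: "a \<in> carrier A \<Longrightarrow> lift A (\<lambda>x y. counit A y \<odot> x) (coprod A a) = a"
    and coprod_mult:
      "\<lbrakk>a \<in> carrier A; b \<in> carrier A\<rbrakk> \<Longrightarrow>
        coprod A (a \<otimes> b) =
          tensor_map A A (mult_map A) (mult_map A)
            (swap_mid A A A A (pure (tensor A A) (tensor A A) (coprod A a) (coprod A b)))"
    and coprod_one: "coprod A \<one> = pure A A \<one> \<one>"
    and counit_mult:
      "\<lbrakk>a \<in> carrier A; b \<in> carrier A\<rbrakk> \<Longrightarrow> counit A (a \<otimes> b) = counit A a * counit A b"
    and counit_one: "counit A \<one> = 1"
    and antipode_linear: "linear_map A A (antipode A)"
    and antipode_left:
      "a \<in> carrier A \<Longrightarrow>
        mult_map A (tensor_map A A (antipode A) id (coprod A a)) = counit A a \<odot> \<one>"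
    and antipode_right:
      "a \<in> carrier A \<Longrightarrow>
        mult_map A (tensor_map A A id (antipode A) (coprod A a)) = counit A a \<odot> \<one>"

locale involutive_hopf_algebra = hopf_algebra A
  for A :: "('a univ, 'x) hopf_scheme" (structure) +
  assumes star_conjugation: "conjugation A (star A)"
    and star_mult:
      "\<lbrakk>a \<in> carrier A; b \<in> carrier A\<rbrakk> \<Longrightarrow> star A (a \<otimes> b) = star A b \<otimes> star A a"
    and coprod_star:
      "a \<in> carrier A \<Longrightarrow>
        coprod A (star A a) = tensor_map A A (star A) (star A) (coprod A a)"
    and counit_star: "a \<in> carrier A \<Longrightarrow> counit A (star A a) = cnj (counit A a)"


section \<open>The braided category of Yetter--Drinfeld modules with involution\<close>

record 'u star_bimodule = "(complex, 'u) module" +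
  action :: "'u \<Rightarrow> 'u"
  coaction :: "'u \<Rightarrow> 'u"
  involution :: "'u \<Rightarrow> 'u"

definition left_action ::
  "('a univ, 'x) hopf_scheme \<Rightarrow> (complex, 'a univ, 'y) module_scheme \<Rightarrow> ('a univ \<Rightarrow> 'a univ) \<Rightarrow> bool"
where
  "left_action A V \<alpha> \<longleftrightarrow> linear_map (tensor A V) V \<alpha>
     \<and> (\<forall>x \<in> carrier (tensor (tensor A A) V).
          \<alpha> (tensor_map A V (mult_map A) id x) = \<alpha> (tensor_map A V id \<alpha> (assoc A A V x)))
     \<and> (\<forall>v \<in> carrier V. \<alpha> (pure A V \<one>\<^bsub>A\<^esub> v) = v)"

definition left_coaction ::
  "('a univ, 'x) hopf_scheme \<Rightarrow> (complex, 'a univ, 'y) module_scheme \<Rightarrow> ('a univ \<Rightarrow> 'a univ) \<Rightarrow> bool"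
where
  "left_coaction A V \<gamma> \<longleftrightarrow> linear_map V (tensor A V) \<gamma>
     \<and> (\<forall>v \<in> carrier V.
          assoc A A V (tensor_map (tensor A A) V (coprod A) id (\<gamma> v))
            = tensor_map A (tensor A V) id \<gamma> (\<gamma> v))
     \<and> (\<forall>v \<in> carrier V. lift V (\<lambda>a u. counit A a \<odot>\<^bsub>V\<^esub> u) (\<gamma> v) = v)"

definition yd_obj :: "('a univ, 'x) hopf_scheme \<Rightarrow> 'a univ star_bimodule set" where
  "yd_obj A = {V. vector_space_C V
     \<and> conjugation V (involution V)
     \<and> left_action A V (action V)
     \<and> left_coaction A V (coaction V)
     \<and> (\<forall>x \<in> carrier (tensor A V).
          (tensor_map A V (mult_map A) (action V)
             \<circ> swap_mid A A A V
             \<circ> tensor_map (tensor A A) (tensor A V) (coprod A) (coaction V)) x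
          = (tensor_map A V (mult_map A) id
             \<circ> swap_last A V A
             \<circ> tensor_map (tensor A V) A (coaction V) id
             \<circ> tensor_map V A (action V) id
             \<circ> swap_last A A V
             \<circ> tensor_map (tensor A A) V (coprod A) id) x)
     \<and> (\<forall>x \<in> carrier (tensor A V).
          (involution V \<circ> action V) x
          = (action V
             \<circ> tensor_map A V (star A) (involution V)
             \<circ> tensor_map A V (antipode A) id) x)
     \<and> (\<forall>v \<in> carrier V.
          (coaction V \<circ> involution V) v
          = (tensor_map A V (star A) (involution V) \<circ> coaction V) v)}"

definition yd_braid ::
  "('a univ, 'x) hopf_scheme \<Rightarrow> 'a univ star_bimodule \<Rightarrow> 'a univ star_bimodule
    \<Rightarrow> 'a univ \<Rightarrow> 'a univ" where
  "yd_braid A V W =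
     tensor_map W V (action W) id
       \<circ> swap_last A V W
       \<circ> tensor_map (tensor A V) W (coaction V) id"

definition yd_tensor ::
  "('a univ, 'x) hopf_scheme \<Rightarrow> 'a univ star_bimodule \<Rightarrow> 'a univ star_bimodule
    \<Rightarrow> 'a univ star_bimodule" where
  "yd_tensor A V W = module.extend (tensor V W) (star_bimodule.fields
     (tensor_map V W (action V) (action W)
        \<circ> swap_mid A A V W
        \<circ> tensor_map (tensor A A) (tensor V W) (coprod A) id)
     (tensor_map A (tensor V W) (mult_map A) id
        \<circ> swap_mid A V A W
        \<circ> tensor_map (tensor A V) (tensor A W) (coaction V) (coaction W))
     (yd_braid A W V
        \<circ> tensor_map W V (involution W) (involution V)
        \<circ> flip V W))"

definition complex_space :: "(complex, 'a univ) module" where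
  "complex_space = \<lparr>
     carrier = range Scalar,
     monoid.mult = undefined, one = undefined,
     zero = Scalar 0,
     add = (\<lambda>x y. Scalar (scalar_of x + scalar_of y)),
     module.smult = (\<lambda>c x. Scalar (c * scalar_of x))\<rparr>"

definition yd_unit :: "('a univ, 'x) hopf_scheme \<Rightarrow> 'a univ star_bimodule" where
  "yd_unit A = module.extend complex_space (star_bimodule.fields
     (lift complex_space (\<lambda>a z. counit A a \<odot>\<^bsub>complex_space\<^esub> z))
     (\<lambda>z. pure A complex_space \<one>\<^bsub>A\<^esub> z)
     (\<lambda>z. Scalar (cnj (scalar_of z))))"

record ('o, 'u) arrow =
  source :: 'o
  target :: 'o
  map_of_arrow :: "'u \<Rightarrow> 'u"

text \<open>
  Morphisms are functions on the carrier of their source, represented as extensional functions,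
  so that equality of morphisms is equality on the carrier.
\<close>

definition mk_arrow ::
  "'u star_bimodule \<Rightarrow> 'u star_bimodule \<Rightarrow> ('u \<Rightarrow> 'u) \<Rightarrow> ('u star_bimodule, 'u) arrow" where
  "mk_arrow V W f =
     \<lparr>source = V, target = W, map_of_arrow = restrict f (carrier V)\<rparr>"

definition yd_hom ::
  "('a univ, 'x) hopf_scheme \<Rightarrow> 'a univ star_bimodule \<Rightarrow> 'a univ star_bimodule
    \<Rightarrow> ('a univ star_bimodule, 'a univ) arrow set" where
  "yd_hom A V W = {mk_arrow V W f | f. linear_map V W f
     \<and> (\<forall>x \<in> carrier (tensor A V). f (action V x) = action W (tensor_map A W id f x))
     \<and> (\<forall>v \<in> carrier V. coaction W (f v) = tensor_map A W id f (coaction V v))}"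

definition yd_category ::
  "('a univ, 'x) hopf_scheme
    \<Rightarrow> ('a univ star_bimodule, ('a univ star_bimodule, 'a univ) arrow) braided_category_data" where
  "yd_category A = \<lparr>
     obj = yd_obj A,
     hom_set = yd_hom A,
     ident = (\<lambda>V. mk_arrow V V id),
     comp_arr = (\<lambda>g f. mk_arrow (source f) (target g) (map_of_arrow g \<circ> map_of_arrow f)),
     tensor_obj = yd_tensor A,
     tensor_arr = (\<lambda>f g. mk_arrow (yd_tensor A (source f) (source g))
       (yd_tensor A (target f) (target g))
       (tensor_map (target f) (target g) (map_of_arrow f) (map_of_arrow g))),
     unit_obj = yd_unit A,
     associator = (\<lambda>U V W. mk_arrow (yd_tensor A (yd_tensor A U V) W)
       (yd_tensor A U (yd_tensor A V W)) (assoc U V W)),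
     left_unitor = (\<lambda>V. mk_arrow (yd_tensor A (yd_unit A) V) V
       (lift V (\<lambda>z v. scalar_of z \<odot>\<^bsub>V\<^esub> v))),
     right_unitor = (\<lambda>V. mk_arrow (yd_tensor A V (yd_unit A)) V
       (lift V (\<lambda>v z. scalar_of z \<odot>\<^bsub>V\<^esub> v))),
     braiding = (\<lambda>V W. mk_arrow (yd_tensor A V W) (yd_tensor A W V) (yd_braid A V W))\<rparr>"

end

theory Submission
  imports Defs
begin

text \<open>
  Every identity is checked in Sweedler notation on pure tensors. The inverse of the antipode
  enters only as the map \<open>T = * \<circ> S \<circ> *\<close>: applying \<open>*\<close> to
  \<open>S(b\<^sub>1) b\<^sub>2 = \<epsilon>(b)\<close> with \<open>b = a\<^sup>*\<close> gives \<open>a\<^sub>2 T(a\<^sub>1) = \<epsilon>(a)\<close>,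
  which makes the involution of \<open>V \<otimes> W\<close> square to the identity. Since that involution is the
  braiding composed with an invertible anti-linear map, the braiding is then invertible as well.
  That the involution of \<open>V \<otimes> W\<close> satisfies (b) and (c) follows from the braiding being a module and
  comodule map, which is condition (a). For (b) one needs neither that \<open>S\<close> is anti-multiplicative nor
  that it reverses the coproduct: both sides, as functions \<open>L\<close> of \<open>a\<close>, solve the equation
  \<open>(a\<^sub>2)\<^sup>* \<cdot> L(a\<^sub>1) = cnj (\<epsilon>(a)) L(1)\<close>, whose solution is unique.
\<close>


section \<open>Vector spaces and semilinear maps\<close>

text \<open>The obstacle is bookkeeping: elements of tensor products are chosen representatives,
  coproducts and coactions are arbitrary tensors, and linear and anti-linear maps occur side by
  side. So every structure map is turned into a nested sum of pure tensors over coproducts and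
  coactions. Simplification produces this form; what is left to do by hand is the mathematical
  content: exchange of sums, coassociativity, condition (a). Computations in V \<otimes> W start
  before V \<otimes> W is known to be an object, so linearity of the structure maps is kept apart
  from the axioms. Condition (b) is delicate because of the flip: the conjugate of a \<cdot> (v
  \<otimes> w) involves S(a2) and S(a1) in exchanged order, whereas S(a) acts through its own
  coproduct. Uniqueness replaces the comparison of the two: given star(a2) \<cdot> L(a1) =
  cnj(\<epsilon>(a)) L(1), acting with star(S(a3)) and using a2 S(a3) = \<epsilon>(a) turns the left
  side into L(a) and the right side into star(S(a)) \<cdot> L(1).\<close>

lemma type_algebra_simps [simp]:
  "carrier (ring_of_type_algebra :: complex ring) = UNIV"
  "x \<oplus>\<^bsub>(ring_of_type_algebra :: complex ring)\<^esub> y = x + y"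
  "x \<otimes>\<^bsub>(ring_of_type_algebra :: complex ring)\<^esub> y = x * y"
  "\<one>\<^bsub>(ring_of_type_algebra :: complex ring)\<^esub> = 1"
  "\<zero>\<^bsub>(ring_of_type_algebra :: complex ring)\<^esub> = 0"
  by (auto simp: ring_of_type_algebra_def)

lemma
  assumes "vector_space_C V"
  shows vs_zero_closed [simp]: "\<zero>\<^bsub>V\<^esub> \<in> carrier V"
    and vs_add_closed [simp]: "x \<in> carrier V \<Longrightarrow> y \<in> carrier V \<Longrightarrow> x \<oplus>\<^bsub>V\<^esub> y \<in> carrier V"
    and vs_smult_closed [simp]: "x \<in> carrier V \<Longrightarrow> c \<odot>\<^bsub>V\<^esub> x \<in> carrier V"
    and vs_zero_left [simp]: "x \<in> carrier V \<Longrightarrow> \<zero>\<^bsub>V\<^esub> \<oplus>\<^bsub>V\<^esub> x = x"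
    and vs_zero_right [simp]: "x \<in> carrier V \<Longrightarrow> x \<oplus>\<^bsub>V\<^esub> \<zero>\<^bsub>V\<^esub> = x"
    and vs_add_assoc: "x \<in> carrier V \<Longrightarrow> y \<in> carrier V \<Longrightarrow> z \<in> carrier V
      \<Longrightarrow> (x \<oplus>\<^bsub>V\<^esub> y) \<oplus>\<^bsub>V\<^esub> z = x \<oplus>\<^bsub>V\<^esub> (y \<oplus>\<^bsub>V\<^esub> z)"
    and vs_add_commute: "x \<in> carrier V \<Longrightarrow> y \<in> carrier V \<Longrightarrow> x \<oplus>\<^bsub>V\<^esub> y = y \<oplus>\<^bsub>V\<^esub> x"
    and vs_add_left_commute: "x \<in> carrier V \<Longrightarrow> y \<in> carrier V \<Longrightarrow> z \<in> carrier V
      \<Longrightarrow> x \<oplus>\<^bsub>V\<^esub> (y \<oplus>\<^bsub>V\<^esub> z) = y \<oplus>\<^bsub>V\<^esub> (x \<oplus>\<^bsub>V\<^esub> z)"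
    and vs_smult_zero [simp]: "c \<odot>\<^bsub>V\<^esub> \<zero>\<^bsub>V\<^esub> = \<zero>\<^bsub>V\<^esub>"
    and vs_zero_smult [simp]: "x \<in> carrier V \<Longrightarrow> 0 \<odot>\<^bsub>V\<^esub> x = \<zero>\<^bsub>V\<^esub>"
    and vs_smult_one [simp]: "x \<in> carrier V \<Longrightarrow> 1 \<odot>\<^bsub>V\<^esub> x = x"
    and vs_smult_smult: "x \<in> carrier V \<Longrightarrow> c \<odot>\<^bsub>V\<^esub> (d \<odot>\<^bsub>V\<^esub> x) = (c * d) \<odot>\<^bsub>V\<^esub> x"
    and vs_smult_add_right: "x \<in> carrier V \<Longrightarrow> y \<in> carrier V
      \<Longrightarrow> c \<odot>\<^bsub>V\<^esub> (x \<oplus>\<^bsub>V\<^esub> y) = c \<odot>\<^bsub>V\<^esub> x \<oplus>\<^bsub>V\<^esub> c \<odot>\<^bsub>V\<^esub> y"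
    and vs_smult_add_left: "x \<in> carrier V
      \<Longrightarrow> (c + d) \<odot>\<^bsub>V\<^esub> x = c \<odot>\<^bsub>V\<^esub> x \<oplus>\<^bsub>V\<^esub> d \<odot>\<^bsub>V\<^esub> x"
    and vs_add_cancel: "x \<in> carrier V \<Longrightarrow> y \<in> carrier V \<Longrightarrow> x \<oplus>\<^bsub>V\<^esub> y = x \<Longrightarrow> y = \<zero>\<^bsub>V\<^esub>"
proof -
  interpret module "ring_of_type_algebra :: complex ring" V by fact
  show "\<zero>\<^bsub>V\<^esub> \<in> carrier V" "x \<in> carrier V \<Longrightarrow> y \<in> carrier V \<Longrightarrow> x \<oplus>\<^bsub>V\<^esub> y \<in> carrier V"
    "x \<in> carrier V \<Longrightarrow> c \<odot>\<^bsub>V\<^esub> x \<in> carrier V"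
    "x \<in> carrier V \<Longrightarrow> \<zero>\<^bsub>V\<^esub> \<oplus>\<^bsub>V\<^esub> x = x" "x \<in> carrier V \<Longrightarrow> x \<oplus>\<^bsub>V\<^esub> \<zero>\<^bsub>V\<^esub> = x"
    "x \<in> carrier V \<Longrightarrow> y \<in> carrier V \<Longrightarrow> z \<in> carrier V
      \<Longrightarrow> (x \<oplus>\<^bsub>V\<^esub> y) \<oplus>\<^bsub>V\<^esub> z = x \<oplus>\<^bsub>V\<^esub> (y \<oplus>\<^bsub>V\<^esub> z)"
    "x \<in> carrier V \<Longrightarrow> y \<in> carrier V \<Longrightarrow> x \<oplus>\<^bsub>V\<^esub> y = y \<oplus>\<^bsub>V\<^esub> x"
    "x \<in> carrier V \<Longrightarrow> y \<in> carrier V \<Longrightarrow> z \<in> carrier V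
      \<Longrightarrow> x \<oplus>\<^bsub>V\<^esub> (y \<oplus>\<^bsub>V\<^esub> z) = y \<oplus>\<^bsub>V\<^esub> (x \<oplus>\<^bsub>V\<^esub> z)"
    "c \<odot>\<^bsub>V\<^esub> \<zero>\<^bsub>V\<^esub> = \<zero>\<^bsub>V\<^esub>" "x \<in> carrier V \<Longrightarrow> 0 \<odot>\<^bsub>V\<^esub> x = \<zero>\<^bsub>V\<^esub>"
    "x \<in> carrier V \<Longrightarrow> 1 \<odot>\<^bsub>V\<^esub> x = x"
    "x \<in> carrier V \<Longrightarrow> c \<odot>\<^bsub>V\<^esub> (d \<odot>\<^bsub>V\<^esub> x) = (c * d) \<odot>\<^bsub>V\<^esub> x"
    "x \<in> carrier V \<Longrightarrow> y \<in> carrier V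
      \<Longrightarrow> c \<odot>\<^bsub>V\<^esub> (x \<oplus>\<^bsub>V\<^esub> y) = c \<odot>\<^bsub>V\<^esub> x \<oplus>\<^bsub>V\<^esub> c \<odot>\<^bsub>V\<^esub> y"
    "x \<in> carrier V \<Longrightarrow> (c + d) \<odot>\<^bsub>V\<^esub> x = c \<odot>\<^bsub>V\<^esub> x \<oplus>\<^bsub>V\<^esub> d \<odot>\<^bsub>V\<^esub> x"
    using smult_l_null[of x] smult_r_null[of c] smult_one[of x] smult_assoc1[of c d x]
      smult_l_distr[of c d x] smult_r_distr[of c x y]
    by (auto simp: M.add.m_ac)
  show "x \<in> carrier V \<Longrightarrow> y \<in> carrier V \<Longrightarrow> x \<oplus>\<^bsub>V\<^esub> y = x \<Longrightarrow> y = \<zero>\<^bsub>V\<^esub>"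
    using M.add.l_cancel_one by blast
qed

text \<open>Additive inverses come from the scalars: -1 times x is one, by distributivity over
  scalars and 0 x = 0.\<close>

lemma vector_spaceI:
  assumes "\<zero>\<^bsub>V\<^esub> \<in> carrier V"
    and "\<And>x y. x \<in> carrier V \<Longrightarrow> y \<in> carrier V \<Longrightarrow> x \<oplus>\<^bsub>V\<^esub> y \<in> carrier V"
    and "\<And>c x. x \<in> carrier V \<Longrightarrow> c \<odot>\<^bsub>V\<^esub> x \<in> carrier V"
    and "\<And>x. x \<in> carrier V \<Longrightarrow> \<zero>\<^bsub>V\<^esub> \<oplus>\<^bsub>V\<^esub> x = x"
    and "\<And>x y z. x \<in> carrier V \<Longrightarrow> y \<in> carrier V \<Longrightarrow> z \<in> carrier V
      \<Longrightarrow> (x \<oplus>\<^bsub>V\<^esub> y) \<oplus>\<^bsub>V\<^esub> z = x \<oplus>\<^bsub>V\<^esub> (y \<oplus>\<^bsub>V\<^esub> z)"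
    and "\<And>x y. x \<in> carrier V \<Longrightarrow> y \<in> carrier V \<Longrightarrow> x \<oplus>\<^bsub>V\<^esub> y = y \<oplus>\<^bsub>V\<^esub> x"
    and "\<And>x. x \<in> carrier V \<Longrightarrow> 0 \<odot>\<^bsub>V\<^esub> x = \<zero>\<^bsub>V\<^esub>"
    and "\<And>x. x \<in> carrier V \<Longrightarrow> 1 \<odot>\<^bsub>V\<^esub> x = x"
    and "\<And>c d x. x \<in> carrier V \<Longrightarrow> c \<odot>\<^bsub>V\<^esub> (d \<odot>\<^bsub>V\<^esub> x) = (c * d) \<odot>\<^bsub>V\<^esub> x"
    and "\<And>c x y. x \<in> carrier V \<Longrightarrow> y \<in> carrier V
      \<Longrightarrow> c \<odot>\<^bsub>V\<^esub> (x \<oplus>\<^bsub>V\<^esub> y) = c \<odot>\<^bsub>V\<^esub> x \<oplus>\<^bsub>V\<^esub> c \<odot>\<^bsub>V\<^esub> y"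
    and "\<And>c d x. x \<in> carrier V
      \<Longrightarrow> (c + d) \<odot>\<^bsub>V\<^esub> x = c \<odot>\<^bsub>V\<^esub> x \<oplus>\<^bsub>V\<^esub> d \<odot>\<^bsub>V\<^esub> x"
  shows "vector_space_C V"
proof (rule moduleI)
  show "cring (ring_of_type_algebra :: complex ring)" by (rule cring_from_type_algebra)
  show "abelian_group V"
  proof (rule abelian_groupI)
    fix x assume x: "x \<in> carrier V"
    have "(-1 + 1) \<odot>\<^bsub>V\<^esub> x = (-1) \<odot>\<^bsub>V\<^esub> x \<oplus>\<^bsub>V\<^esub> 1 \<odot>\<^bsub>V\<^esub> x"
      using x assms(11) by blast
    with x assms(7,8) have "(-1) \<odot>\<^bsub>V\<^esub> x \<oplus>\<^bsub>V\<^esub> x = \<zero>\<^bsub>V\<^esub>" by simp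
    with x assms(3) show "\<exists>y \<in> carrier V. y \<oplus>\<^bsub>V\<^esub> x = \<zero>\<^bsub>V\<^esub>" by blast
  qed (use assms in auto)
qed (use assms in auto)

text \<open>The flag \<open>b\<close> selects anti-linear (\<open>True\<close>) or linear
  (\<open>False\<close>), so that the calculus of sums is developed once and then serves actions,
  coactions and involutions alike.\<close>

definition semilinear ::
  "bool \<Rightarrow> (complex, 'u, 'x) module_scheme \<Rightarrow> (complex, 'w, 'y) module_scheme \<Rightarrow> ('u \<Rightarrow> 'w) \<Rightarrow> bool"
where
  "semilinear b V W f \<longleftrightarrow> (\<forall>x \<in> carrier V. f x \<in> carrier W)
     \<and> (\<forall>x \<in> carrier V. \<forall>y \<in> carrier V. f (x \<oplus>\<^bsub>V\<^esub> y) = f x \<oplus>\<^bsub>W\<^esub> f y)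
     \<and> (\<forall>c. \<forall>x \<in> carrier V. f (c \<odot>\<^bsub>V\<^esub> x) = (if b then cnj c else c) \<odot>\<^bsub>W\<^esub> f x)"

lemma linear_map_iff_semilinear: "linear_map V W f \<longleftrightarrow> semilinear False V W f"
  by (auto simp: linear_map_def semilinear_def)

lemma conjugation_iff_semilinear:
  "conjugation V f \<longleftrightarrow> semilinear True V V f \<and> (\<forall>x \<in> carrier V. f (f x) = x)"
  by (auto simp: conjugation_def semilinear_def)

lemma
  assumes "semilinear b V W f"
  shows semilinear_closed: "x \<in> carrier V \<Longrightarrow> f x \<in> carrier W"
    and semilinear_add: "x \<in> carrier V \<Longrightarrow> y \<in> carrier V \<Longrightarrow> f (x \<oplus>\<^bsub>V\<^esub> y) = f x \<oplus>\<^bsub>W\<^esub> f y"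
    and semilinear_smult:
      "x \<in> carrier V \<Longrightarrow> f (c \<odot>\<^bsub>V\<^esub> x) = (if b then cnj c else c) \<odot>\<^bsub>W\<^esub> f x"
  using assms by (auto simp: semilinear_def)

lemma semilinear_zero:
  assumes "vector_space_C V" "vector_space_C W" "semilinear b V W f"
  shows "f \<zero>\<^bsub>V\<^esub> = \<zero>\<^bsub>W\<^esub>"
proof -
  have "f \<zero>\<^bsub>V\<^esub> \<oplus>\<^bsub>W\<^esub> f \<zero>\<^bsub>V\<^esub> = f \<zero>\<^bsub>V\<^esub>"
    using assms semilinear_add[OF assms(3), of "\<zero>\<^bsub>V\<^esub>" "\<zero>\<^bsub>V\<^esub>"] by simp
  with assms show ?thesis
    by (metis vs_add_cancel semilinear_closed vs_zero_closed)
qed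

lemma semilinear_ident [simp]: "\<not> b \<Longrightarrow> semilinear b V V (\<lambda>x. x)"
  by (simp add: semilinear_def)

lemma semilinear_id [simp]: "\<not> b \<Longrightarrow> semilinear b V V id"
  by (simp add: semilinear_def)

lemma semilinear_cong:
  assumes "\<And>x. x \<in> carrier V \<Longrightarrow> f x = g x" "vector_space_C V"
  shows "semilinear b V W f \<longleftrightarrow> semilinear b V W g"
  using assms by (simp add: semilinear_def)

text \<open>Parities add modulo 2, hence the exclusive or \<open>b \<noteq> b'\<close>: two
  anti-linear maps compose to a linear one.\<close>

lemma semilinear_comp:
  assumes "semilinear b V W f" "semilinear b' W X g"
  shows "semilinear (b \<noteq> b') V X (\<lambda>x. g (f x))"
  using assms by (auto simp: semilinear_def)

text \<open>Both arguments carry the same parity; this gives B (c v) w = B v (c w), the balancing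
  condition under which a map descends to the tensor product, also for anti-linear B.\<close>

definition bisemilinear ::
  "bool \<Rightarrow> (complex, 'u, 'x) module_scheme \<Rightarrow> (complex, 'v, 'y) module_scheme
    \<Rightarrow> (complex, 'w, 'z) module_scheme \<Rightarrow> ('u \<Rightarrow> 'v \<Rightarrow> 'w) \<Rightarrow> bool"
where
  "bisemilinear b V W X B \<longleftrightarrow> (\<forall>w \<in> carrier W. semilinear b V X (\<lambda>v. B v w))
     \<and> (\<forall>v \<in> carrier V. semilinear b W X (\<lambda>w. B v w))"


section \<open>The tensor product\<close>

text \<open>Each generating relation has both sides inside the carriers. This is what guarantees
  that the representative picked by \<open>SOME\<close> again has its entries in the
  carriers.\<close>

lemma tensor_rel_carrier:
  assumes "tensor_rel V W k l" "vector_space_C V" "vector_space_C W"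
  shows "set k \<subseteq> carrier V \<times> carrier W \<longleftrightarrow> set l \<subseteq> carrier V \<times> carrier W"
  using assms by (induction rule: tensor_rel.induct) auto

text \<open>Related lists have equal classes as predicates, so the choice operator returns the same
  member for both; conversely each list is related to the member chosen for it.\<close>

lemma tensor_class_eq_iff: "tensor_class V W k = tensor_class V W l \<longleftrightarrow> tensor_rel V W k l"
proof
  assume "tensor_class V W k = tensor_class V W l"
  moreover have "tensor_rel V W k (SOME m. tensor_rel V W k m)"
    "tensor_rel V W l (SOME m. tensor_rel V W l m)"
    by (rule someI, rule tensor_rel.refl)+
  ultimately show "tensor_rel V W k l"
    unfolding tensor_class_def by (metis tensor_rel.sym tensor_rel.trans univ.inject(3))
next
  assume "tensor_rel V W k l"
  then have "tensor_rel V W k = tensor_rel V W l"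
    by (blast intro: tensor_rel.sym tensor_rel.trans)
  then show "tensor_class V W k = tensor_class V W l"
    by (simp add: tensor_class_def)
qed

lemma tensor_rel_summands: "tensor_rel V W l (summands (tensor_class V W l))"
  unfolding tensor_class_def by (simp, rule someI, rule tensor_rel.refl)

lemma carrier_tensor:
  "t \<in> carrier (tensor V W) \<longleftrightarrow> (\<exists>l. t = tensor_class V W l \<and> set l \<subseteq> carrier V \<times> carrier W)"
  by (auto simp: tensor_def)

lemma summands_carrier:
  assumes "vector_space_C V" "vector_space_C W" "t \<in> carrier (tensor V W)"
  shows "set (summands t) \<subseteq> carrier V \<times> carrier W"
  using assms tensor_rel_carrier[OF tensor_rel_summands] unfolding carrier_tensor by blast

lemma tensor_zero: "\<zero>\<^bsub>tensor V W\<^esub> = tensor_class V W []"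
  by (simp add: tensor_def)

lemma tensor_add: "tensor_class V W k \<oplus>\<^bsub>tensor V W\<^esub> tensor_class V W l = tensor_class V W (k @ l)"
  by (simp add: tensor_def tensor_class_eq_iff)
    (blast intro: tensor_rel.append tensor_rel.sym tensor_rel_summands)

lemma tensor_rel_smult:
  assumes "tensor_rel V W k l" "vector_space_C V" "vector_space_C W"
  shows "tensor_rel V W (map (\<lambda>(v, w). (c \<odot>\<^bsub>V\<^esub> v, w)) k) (map (\<lambda>(v, w). (c \<odot>\<^bsub>V\<^esub> v, w)) l)"
  using assms
proof (induction rule: tensor_rel.induct)
  case (smult v w d)
  have "c \<odot>\<^bsub>V\<^esub> (d \<odot>\<^bsub>V\<^esub> v) = d \<odot>\<^bsub>V\<^esub> (c \<odot>\<^bsub>V\<^esub> v)"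
    using smult by (simp add: vs_smult_smult mult.commute)
  with smult show ?case by (simp add: tensor_rel.smult)
qed (auto simp: vs_smult_add_right intro: tensor_rel.intros)

lemma tensor_smult:
  assumes "vector_space_C V" "vector_space_C W"
  shows "c \<odot>\<^bsub>tensor V W\<^esub> tensor_class V W l = tensor_class V W (map (\<lambda>(v, w). (c \<odot>\<^bsub>V\<^esub> v, w)) l)"
  by (simp add: tensor_def tensor_class_eq_iff tensor_rel_smult tensor_rel_summands tensor_rel.sym assms)

text \<open>Pulls an entry forward past \<open>k\<close>; this reordering is what the law (c + d) x
  = c x + d x needs when the two scaled lists are interleaved.\<close>

lemma tensor_rel_middle: "tensor_rel V W (x # k @ y # l) (x # y # k @ l)"
proof -
  have "tensor_rel V W ([x] @ ((k @ [y]) @ l)) ([x] @ (([y] @ k) @ l))"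
    by (intro tensor_rel.append tensor_rel.refl tensor_rel.commute)
  then show ?thesis by simp
qed

text \<open>Most axioms are equalities of lists or the generating commutativity. Only 0 x = 0 and (c
  + d) x = c x + d x use the bilinearity relations entry by entry, by induction on the list.\<close>

lemma vector_space_tensor [simp]:
  assumes V: "vector_space_C V" and W: "vector_space_C W"
  shows "vector_space_C (tensor V W)"
proof (rule vector_spaceI, goal_cases)
  case 1 then show ?case by (auto simp: carrier_tensor tensor_zero intro: exI[of _ "[]"])
next
  case (2 x y) then show ?case
    by (auto simp: carrier_tensor tensor_add) (metis Un_least set_append)
next
  case (3 c x)
  then obtain l where "x = tensor_class V W l" "set l \<subseteq> carrier V \<times> carrier W"
    by (auto simp: carrier_tensor)
  moreover from this have "\<And>v w. (v, w) \<in> set l \<Longrightarrow> v \<in> carrier V \<and> w \<in> carrier W" by auto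
  ultimately show ?case using V W
    by (auto simp: carrier_tensor tensor_smult intro!: exI[of _ "map (\<lambda>(v, w). (c \<odot>\<^bsub>V\<^esub> v, w)) l"])
next
  case 4 then show ?case by (auto simp: carrier_tensor tensor_add tensor_zero)
next
  case 5 then show ?case by (auto simp: carrier_tensor tensor_add)
next
  case 6 then show ?case
    by (auto simp: carrier_tensor tensor_add tensor_class_eq_iff intro: tensor_rel.commute)
next
  case (7 x)
  have "tensor_rel V W (map (\<lambda>(v, w). (0 \<odot>\<^bsub>V\<^esub> v, w)) l) []"
    if "set l \<subseteq> carrier V \<times> carrier W" for l
    using that
  proof (induction l)
    case (Cons p l)
    then have "tensor_rel V W ([case p of (v, w) \<Rightarrow> (0 \<odot>\<^bsub>V\<^esub> v, w)]
        @ map (\<lambda>(v, w). (0 \<odot>\<^bsub>V\<^esub> v, w)) l) ([] @ [])"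
      using V W by (intro tensor_rel.append) (auto intro: tensor_rel.intros)
    then show ?case by simp
  qed (auto intro: tensor_rel.intros)
  with 7 show ?case using V W
    by (auto simp: carrier_tensor tensor_smult tensor_zero tensor_class_eq_iff)
next
  case (8 x)
  then obtain l where l: "x = tensor_class V W l" "set l \<subseteq> carrier V \<times> carrier W"
    by (auto simp: carrier_tensor)
  then have "map (\<lambda>(v, w). (1 \<odot>\<^bsub>V\<^esub> v, w)) l = l"
    using V by (intro map_idI) auto
  with l show ?case using V W by (simp add: tensor_smult)
next
  case (9 c d x)
  then obtain l where l: "x = tensor_class V W l" "set l \<subseteq> carrier V \<times> carrier W"
    by (auto simp: carrier_tensor)
  then have "map (\<lambda>(v, w). (c \<odot>\<^bsub>V\<^esub> v, w)) (map (\<lambda>(v, w). (d \<odot>\<^bsub>V\<^esub> v, w)) l)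
      = map (\<lambda>(v, w). ((c * d) \<odot>\<^bsub>V\<^esub> v, w)) l"
    using V by (auto simp: vs_smult_smult)
  then show ?case unfolding l(1) by (simp only: tensor_smult[OF V W])
next
  case 10 then show ?case using V W by (auto simp: carrier_tensor tensor_add tensor_smult)
next
  case (11 c d x)
  have "tensor_rel V W (map (\<lambda>(v, w). ((c + d) \<odot>\<^bsub>V\<^esub> v, w)) l)
     (map (\<lambda>(v, w). (c \<odot>\<^bsub>V\<^esub> v, w)) l @ map (\<lambda>(v, w). (d \<odot>\<^bsub>V\<^esub> v, w)) l)"
    if "set l \<subseteq> carrier V \<times> carrier W" for l
    using that
  proof (induction l)
    case (Cons p l)
    obtain v w where p: "p = (v, w)" by force
    have "tensor_rel V W ([((c + d) \<odot>\<^bsub>V\<^esub> v, w)] @ map (\<lambda>(v, w). ((c + d) \<odot>\<^bsub>V\<^esub> v, w)) l)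
       ([(c \<odot>\<^bsub>V\<^esub> v, w), (d \<odot>\<^bsub>V\<^esub> v, w)] @
         map (\<lambda>(v, w). (c \<odot>\<^bsub>V\<^esub> v, w)) l @ map (\<lambda>(v, w). (d \<odot>\<^bsub>V\<^esub> v, w)) l)"
      using V W Cons p
      by (intro tensor_rel.append) (auto simp: vs_smult_add_left intro: tensor_rel.intros)
    then show ?case using p
      by simp (metis (no_types, lifting) tensor_rel.sym tensor_rel.trans tensor_rel_middle)
  qed (auto intro: tensor_rel.intros)
  with 11 show ?case using V W
    by (auto simp: carrier_tensor tensor_smult tensor_add tensor_class_eq_iff)
qed

lemma pure_closed [simp]:
  "v \<in> carrier V \<Longrightarrow> w \<in> carrier W \<Longrightarrow> pure V W v w \<in> carrier (tensor V W)"
  by (auto simp: carrier_tensor pure_def intro!: exI[of _ "[(v, w)]"])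

lemma bisemilinear_pure:
  assumes "vector_space_C V" "vector_space_C W"
  shows "bisemilinear False V W (tensor V W) (pure V W)"
  using assms
  by (auto simp: bisemilinear_def semilinear_def)
    (auto simp: pure_def tensor_add tensor_smult tensor_class_eq_iff
      intro: tensor_rel.intros)

lemma tensor_class_Cons: "tensor_class V W ((v, w) # l) = pure V W v w \<oplus>\<^bsub>tensor V W\<^esub> tensor_class V W l"
  by (simp add: pure_def tensor_add)

lemma tensor_induct [consumes 1, case_names zero add]:
  assumes t: "t \<in> carrier (tensor V W)"
    and zero: "P \<zero>\<^bsub>tensor V W\<^esub>"
    and add: "\<And>v w t. \<lbrakk>v \<in> carrier V; w \<in> carrier W; t \<in> carrier (tensor V W); P t\<rbrakk>
      \<Longrightarrow> P (pure V W v w \<oplus>\<^bsub>tensor V W\<^esub> t)"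
  shows "P t"
proof -
  obtain l where l: "t = tensor_class V W l" "set l \<subseteq> carrier V \<times> carrier W"
    using t by (auto simp: carrier_tensor)
  have "P (tensor_class V W l)"
    using l(2)
  proof (induction l)
    case Nil then show ?case using zero by (simp add: tensor_zero)
  next
    case (Cons p l)
    then show ?case by (cases p) (auto simp: tensor_class_Cons carrier_tensor intro!: add)
  qed
  with l show ?thesis by simp
qed

text \<open>Pure tensors generate additively, so only additivity and the value at zero enter the
  induction; the two parities are therefore independent parameters.\<close>

lemma semilinear_tensor_eqI:
  assumes "t \<in> carrier (tensor V W)" "vector_space_C V" "vector_space_C W" "vector_space_C X"
    and "semilinear b (tensor V W) X f" "semilinear b' (tensor V W) X g"
    and "\<And>v w. v \<in> carrier V \<Longrightarrow> w \<in> carrier W \<Longrightarrow> f (pure V W v w) = g (pure V W v w)"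
  shows "f t = g t"
  using assms(1)
proof (induction rule: tensor_induct)
  case zero then show ?case using assms by (simp add: semilinear_zero[where V = "tensor V W"])
next
  case (add v w t) then show ?case using assms by (simp add: semilinear_add[where V = "tensor V W"])
qed


section \<open>Sums over tensors\<close>

text \<open>
  \<open>tsum V W X B t\<close> is Sweedler's notation \<open>\<Sum> B t\<^sub>1 t\<^sub>2\<close> for
  \<open>t \<in> V \<otimes> W\<close> with values in \<open>X\<close>. Cutting \<open>B\<close> off outside the carriers makes the
  congruence rule and the exchange of two sums hold without side conditions on \<open>t\<close>.
\<close>

definition tsum ::
  "(complex, 'a univ, 'x) module_scheme \<Rightarrow> (complex, 'a univ, 'y) module_scheme
    \<Rightarrow> (complex, 'u, 'z) module_scheme \<Rightarrow> ('a univ \<Rightarrow> 'a univ \<Rightarrow> 'u) \<Rightarrow> 'a univ \<Rightarrow> 'u" where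
  "tsum V W X B =
     lift X (\<lambda>v w. if v \<in> carrier V \<and> w \<in> carrier W then B v w else \<zero>\<^bsub>X\<^esub>)"

definition list_sum ::
  "(complex, 'u, 'z) module_scheme \<Rightarrow> ('v \<Rightarrow> 'w \<Rightarrow> 'u) \<Rightarrow> ('v \<times> 'w) list \<Rightarrow> 'u" where
  "list_sum X B l = foldr (\<lambda>(v, w) s. B v w \<oplus>\<^bsub>X\<^esub> s) l \<zero>\<^bsub>X\<^esub>"

lemma list_sum_simps [simp]:
  "list_sum X B [] = \<zero>\<^bsub>X\<^esub>"
  "list_sum X B ((v, w) # l) = B v w \<oplus>\<^bsub>X\<^esub> list_sum X B l"
  by (auto simp: list_sum_def)

lemma list_sum_closed [simp]:
  assumes "vector_space_C X" "\<And>v w. B v w \<in> carrier X"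
  shows "list_sum X B l \<in> carrier X"
  by (induction l) (auto simp: assms split: prod.splits)

lemma list_sum_append:
  assumes "vector_space_C X" "\<And>v w. B v w \<in> carrier X"
  shows "list_sum X B (k @ l) = list_sum X B k \<oplus>\<^bsub>X\<^esub> list_sum X B l"
  by (induction k) (auto simp: assms vs_add_assoc split: prod.splits)

lemma list_sum_add:
  assumes "vector_space_C X" "\<And>v w. B v w \<in> carrier X" "\<And>v w. B' v w \<in> carrier X"
  shows "list_sum X (\<lambda>v w. B v w \<oplus>\<^bsub>X\<^esub> B' v w) l = list_sum X B l \<oplus>\<^bsub>X\<^esub> list_sum X B' l"
  by (induction l)
    (auto simp: assms vs_add_assoc vs_add_left_commute[of X "list_sum X B _"])

lemma list_sum_zero: "vector_space_C X \<Longrightarrow> list_sum X (\<lambda>v w. \<zero>\<^bsub>X\<^esub>) l = \<zero>\<^bsub>X\<^esub>"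
  by (induction l) auto

lemma list_sum_commute:
  assumes "vector_space_C X" "\<And>a b c d. G a b c d \<in> carrier X"
  shows "list_sum X (\<lambda>a b. list_sum X (\<lambda>c d. G a b c d) k) l
    = list_sum X (\<lambda>c d. list_sum X (\<lambda>a b. G a b c d) l) k"
  by (induction l) (auto simp: assms list_sum_zero list_sum_add)

lemma list_sum_map:
  assumes "\<And>x y. x \<in> carrier X \<Longrightarrow> y \<in> carrier X \<Longrightarrow> f (x \<oplus>\<^bsub>X\<^esub> y) = f x \<oplus>\<^bsub>Y\<^esub> f y"
    "f \<zero>\<^bsub>X\<^esub> = \<zero>\<^bsub>Y\<^esub>" "vector_space_C X" "\<And>v w. B v w \<in> carrier X"
  shows "f (list_sum X B l) = list_sum Y (\<lambda>v w. f (B v w)) l"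
  by (induction l) (auto simp: assms)

lemma list_sum_cong:
  "(\<And>v w. (v, w) \<in> set l \<Longrightarrow> B v w = B' v w) \<Longrightarrow> list_sum X B l = list_sum X B' l"
  by (induction l) auto

lemma tsum_list_sum: "tsum V W X B t = list_sum X
    (\<lambda>v w. if v \<in> carrier V \<and> w \<in> carrier W then B v w else \<zero>\<^bsub>X\<^esub>) (summands t)"
  by (simp add: tsum_def lift_def list_sum_def)

lemma tsum_cong [cong]:
  assumes "V = V'" "W = W'" "X = X'" "t = t'"
    and "\<And>v w. v \<in> carrier V' \<Longrightarrow> w \<in> carrier W' \<Longrightarrow> B v w = B' v w"
  shows "tsum V W X B t = tsum V' W' X' B' t'"
  using assms by (auto simp: tsum_list_sum intro!: list_sum_cong)

text \<open>The cut-off in \<open>tsum\<close> is invisible on genuine tensors, since their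
  representatives have all entries in the carriers.\<close>

lemma lift_eq_tsum:
  assumes "t \<in> carrier (tensor V W)" "vector_space_C V" "vector_space_C W"
  shows "lift X B t = tsum V W X B t"
proof -
  have "set (summands t) \<subseteq> carrier V \<times> carrier W" using assms by (intro summands_carrier)
  then show ?thesis
    unfolding tsum_list_sum unfolding lift_def list_sum_def[symmetric] by (auto intro!: list_sum_cong)
qed

lemma tsum_closed [simp]:
  assumes "vector_space_C X" "\<forall>v \<in> carrier V. \<forall>w \<in> carrier W. B v w \<in> carrier X"
  shows "tsum V W X B t \<in> carrier X"
  using assms by (simp add: tsum_list_sum)

lemma tsum_commute:
  assumes "vector_space_C X"
    "\<forall>a \<in> carrier V. \<forall>b \<in> carrier W. \<forall>c \<in> carrier V'. \<forall>d \<in> carrier W'. G a b c d \<in> carrier X"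
  shows "tsum V W X (\<lambda>a b. tsum V' W' X (\<lambda>c d. G a b c d) s) t
    = tsum V' W' X (\<lambda>c d. tsum V W X (\<lambda>a b. G a b c d) t) s"
proof -
  \<comment> \<open>The truncated function takes values in the carrier of \<open>X\<close>
    everywhere, so the exchange of two list sums applies to it unconditionally.\<close>
  define G' where "G' = (\<lambda>a b c d. if a \<in> carrier V \<and> b \<in> carrier W \<and> c \<in> carrier V' \<and> d \<in> carrier W'
    then G a b c d else \<zero>\<^bsub>X\<^esub>)"
  have "tsum V W X (\<lambda>a b. tsum V' W' X (\<lambda>c d. G a b c d) s) t
     = list_sum X (\<lambda>a b. list_sum X (\<lambda>c d. G' a b c d) (summands s)) (summands t)"
    unfolding tsum_list_sum G'_def using assms(1)
    by (intro list_sum_cong) (auto simp: list_sum_zero intro!: list_sum_cong)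
  moreover have "tsum V' W' X (\<lambda>c d. tsum V W X (\<lambda>a b. G a b c d) t) s
     = list_sum X (\<lambda>c d. list_sum X (\<lambda>a b. G' a b c d) (summands t)) (summands s)"
    unfolding tsum_list_sum G'_def using assms(1)
    by (intro list_sum_cong) (auto simp: list_sum_zero intro!: list_sum_cong)
  moreover have "\<And>a b c d. G' a b c d \<in> carrier X"
    using assms by (simp add: G'_def)
  ultimately show ?thesis
    using list_sum_commute[OF assms(1), of G'] by metis
qed

lemma tsum_map:
  assumes "semilinear b X Y f" "vector_space_C X" "vector_space_C Y"
    "\<forall>v \<in> carrier V. \<forall>w \<in> carrier W. B v w \<in> carrier X"
  shows "f (tsum V W X B t) = tsum V W Y (\<lambda>v w. f (B v w)) t"
  unfolding tsum_list_sum using assms semilinear_zero[of X Y b f]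
  by (subst list_sum_map[of X f Y])
    (auto simp: semilinear_add intro!: list_sum_cong)

text \<open>Well-definedness in the universal property of the tensor product: a bilinear or
  bi-anti-linear map respects each generating relation, so the sum depends on the class
  only.\<close>

lemma list_sum_tensor_rel:
  assumes "tensor_rel V W k l" "vector_space_C V" "vector_space_C W" "vector_space_C X"
    "bisemilinear b V W X B"
  shows "list_sum X (\<lambda>v w. if v \<in> carrier V \<and> w \<in> carrier W then B v w else \<zero>\<^bsub>X\<^esub>) k
    = list_sum X (\<lambda>v w. if v \<in> carrier V \<and> w \<in> carrier W then B v w else \<zero>\<^bsub>X\<^esub>) l"
proof -
  have closed: "\<And>v w. v \<in> carrier V \<Longrightarrow> w \<in> carrier W \<Longrightarrow> B v w \<in> carrier X"
    using assms(5) by (auto simp: bisemilinear_def dest!: semilinear_closed)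
  show ?thesis
    using assms
  proof (induction rule: tensor_rel.induct)
    case append then show ?case using closed by (simp add: list_sum_append)
  next
    case commute then show ?case using closed by (simp add: list_sum_append vs_add_commute)
  next
    case (zero w)
    then have "B \<zero>\<^bsub>V\<^esub> w = \<zero>\<^bsub>X\<^esub>"
      using semilinear_zero[of V X b "\<lambda>v. B v w"] by (auto simp: bisemilinear_def)
    with zero show ?case by simp
  qed (use closed in \<open>auto simp: bisemilinear_def semilinear_def vs_add_assoc vs_smult_smult\<close>)
qed

lemma tsum_class:
  assumes "vector_space_C V" "vector_space_C W" "vector_space_C X" "bisemilinear b V W X B"
  shows "tsum V W X B (tensor_class V W l) = list_sum X
    (\<lambda>v w. if v \<in> carrier V \<and> w \<in> carrier W then B v w else \<zero>\<^bsub>X\<^esub>) l"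
  unfolding tsum_list_sum
  by (rule list_sum_tensor_rel[OF tensor_rel.sym[OF tensor_rel_summands] assms])

lemma tsum_pure:
  assumes "vector_space_C V" "vector_space_C W" "vector_space_C X" "bisemilinear b V W X B"
    "v \<in> carrier V" "w \<in> carrier W"
  shows "tsum V W X B (pure V W v w) = B v w"
proof -
  have "B v w \<in> carrier X"
    using assms(4-) by (auto simp: bisemilinear_def dest!: semilinear_closed)
  with assms show ?thesis by (simp add: pure_def tsum_class)
qed

lemma semilinear_tsum:
  assumes "vector_space_C V" "vector_space_C W" "vector_space_C X" "bisemilinear b V W X B"
  shows "semilinear b (tensor V W) X (tsum V W X B)"
proof -
  have closed: "\<And>v w. v \<in> carrier V \<Longrightarrow> w \<in> carrier W \<Longrightarrow> B v w \<in> carrier X"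
    using assms(4) by (auto simp: bisemilinear_def dest!: semilinear_closed)
  have smult: "list_sum X (\<lambda>v w. if v \<in> carrier V \<and> w \<in> carrier W then B v w else \<zero>\<^bsub>X\<^esub>)
      (map (\<lambda>(v, w). (c \<odot>\<^bsub>V\<^esub> v, w)) l)
    = (if b then cnj c else c) \<odot>\<^bsub>X\<^esub>
      list_sum X (\<lambda>v w. if v \<in> carrier V \<and> w \<in> carrier W then B v w else \<zero>\<^bsub>X\<^esub>) l"
    if "set l \<subseteq> carrier V \<times> carrier W" for c l
    using that
  proof (induction l)
    case (Cons p l)
    then obtain v w where p: "p = (v, w)" "v \<in> carrier V" "w \<in> carrier W" by force
    then have "B (c \<odot>\<^bsub>V\<^esub> v) w = (if b then cnj c else c) \<odot>\<^bsub>X\<^esub> B v w"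
      using assms(4) by (simp add: bisemilinear_def semilinear_def)
    moreover have "set l \<subseteq> carrier V \<times> carrier W" using Cons.prems by simp
    ultimately show ?case using p Cons.IH assms closed
      by (simp add: vs_smult_add_right del: if_split_asm)
  qed (use assms in simp)
  show ?thesis
    unfolding semilinear_def using assms closed
    by (auto simp: carrier_tensor tensor_add tensor_smult tsum_class list_sum_append smult)
qed

text \<open>Presents an arbitrary tensor as a sum of pure ones. This is how general elements enter
  computations whose rules speak of pure tensors.\<close>

lemma tsum_ident:
  assumes "t \<in> carrier (tensor V W)" "vector_space_C V" "vector_space_C W"
  shows "tsum V W (tensor V W) (pure V W) t = t"
proof -
  have "list_sum (tensor V W) (\<lambda>v w. if v \<in> carrier V \<and> w \<in> carrier W
      then pure V W v w else \<zero>\<^bsub>tensor V W\<^esub>) l = tensor_class V W l"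
    if "set l \<subseteq> carrier V \<times> carrier W" for l
    using that by (induction l) (auto simp: tensor_zero tensor_class_Cons)
  with assms show ?thesis
    by (auto simp: carrier_tensor tsum_class[OF _ _ _ bisemilinear_pure])
qed

section \<open>Rewriting rules: pulling sums out of tensors, and semilinearity of composite
  expressions\<close>

lemma semilinear_pure_left [simp]:
  assumes "semilinear b V Y f" "z \<in> carrier Z" "vector_space_C Y" "vector_space_C Z"
  shows "semilinear b V (tensor Y Z) (\<lambda>v. pure Y Z (f v) z)"
  using assms bisemilinear_pure[of Y Z] by (simp add: bisemilinear_def semilinear_def)

lemma semilinear_pure_right [simp]:
  assumes "semilinear b V Z f" "y \<in> carrier Y" "vector_space_C Y" "vector_space_C Z"
  shows "semilinear b V (tensor Y Z) (\<lambda>v. pure Y Z y (f v))"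
  using assms bisemilinear_pure[of Y Z] by (simp add: bisemilinear_def semilinear_def)

lemma pure_tsum_left [simp]:
  assumes "vector_space_C Y" "vector_space_C Z" "z \<in> carrier Z"
    "\<forall>v \<in> carrier V. \<forall>w \<in> carrier W. B v w \<in> carrier Y"
  shows "pure Y Z (tsum V W Y B t) z = tsum V W (tensor Y Z) (\<lambda>v w. pure Y Z (B v w) z) t"
  using assms by (intro tsum_map[of False Y _ "\<lambda>y. pure Y Z y z"]) auto

lemma pure_tsum_right [simp]:
  assumes "vector_space_C Y" "vector_space_C Z" "y \<in> carrier Y"
    "\<forall>v \<in> carrier V. \<forall>w \<in> carrier W. B v w \<in> carrier Z"
  shows "pure Y Z y (tsum V W Z B t) = tsum V W (tensor Y Z) (\<lambda>v w. pure Y Z y (B v w)) t"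
  using assms by (intro tsum_map[of False Z _ "\<lambda>z. pure Y Z y z"]) auto

lemma pure_smult:
  assumes "vector_space_C V" "vector_space_C W" "v \<in> carrier V" "w \<in> carrier W"
  shows "pure V W (c \<odot>\<^bsub>V\<^esub> v) w = c \<odot>\<^bsub>tensor V W\<^esub> pure V W v w"
    and "pure V W v (c \<odot>\<^bsub>W\<^esub> w) = c \<odot>\<^bsub>tensor V W\<^esub> pure V W v w"
  using bisemilinear_pure[OF assms(1,2)] assms by (auto simp: bisemilinear_def semilinear_def)

lemma smult_tsum:
  assumes "vector_space_C Y" "\<forall>v \<in> carrier V. \<forall>w \<in> carrier W. B v w \<in> carrier Y"
  shows "c \<odot>\<^bsub>Y\<^esub> (tsum V W Y B t) = tsum V W Y (\<lambda>v w. c \<odot>\<^bsub>Y\<^esub> B v w) t"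
  using assms
  by (intro tsum_map[of False Y _ "\<lambda>y. c \<odot>\<^bsub>Y\<^esub> y"])
    (auto simp: semilinear_def vs_smult_add_right vs_smult_smult mult.commute)

text \<open>The parity does not occur in the left-hand side of \<open>tsum_pure\<close>, so
  simplification could not determine it; hence one instance for each parity, here and in the similar
  pairs below.\<close>

lemma tsum_pure_linear [simp]:
  assumes "vector_space_C V" "vector_space_C W" "vector_space_C X" "bisemilinear False V W X B"
    "v \<in> carrier V" "w \<in> carrier W"
  shows "tsum V W X B (pure V W v w) = B v w"
  using assms by (rule tsum_pure)

lemma tsum_pure_antilinear [simp]:
  assumes "vector_space_C V" "vector_space_C W" "vector_space_C X" "bisemilinear True V W X B"
    "v \<in> carrier V" "w \<in> carrier W"
  shows "tsum V W X B (pure V W v w) = B v w"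
  using assms by (rule tsum_pure)

lemma tsum_tsum:
  assumes "vector_space_C V" "vector_space_C W" "vector_space_C X" "bisemilinear b V W X B"
    "\<forall>y \<in> carrier Y. \<forall>z \<in> carrier Z. C y z \<in> carrier (tensor V W)"
  shows "tsum V W X B (tsum Y Z (tensor V W) C t) = tsum Y Z X (\<lambda>y z. tsum V W X B (C y z)) t"
  using assms by (intro tsum_map[of b "tensor V W"]) (auto intro: semilinear_tsum)

lemmas tsum_tsum_linear [simp] = tsum_tsum[where b = False]
lemmas tsum_tsum_antilinear [simp] = tsum_tsum[where b = True]

lemma list_sum_smult:
  assumes "vector_space_C X" "\<And>v w. B v w \<in> carrier X"
  shows "list_sum X (\<lambda>v w. c \<odot>\<^bsub>X\<^esub> B v w) l = c \<odot>\<^bsub>X\<^esub> list_sum X B l"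
  by (induction l) (auto simp: assms vs_smult_add_right)

text \<open>The tensor \<open>t\<close> is fixed, so the sum runs over one fixed list
  \<open>summands t\<close> and semilinearity in \<open>v\<close> passes through it term by
  term.\<close>

lemma semilinear_tsum_body [simp]:
  assumes "vector_space_C X" "vector_space_C V"
    "\<forall>y \<in> carrier Y. \<forall>z \<in> carrier Z. semilinear b V X (\<lambda>v. B v y z)"
  shows "semilinear b V X (\<lambda>v. tsum Y Z X (\<lambda>y z. B v y z) t)"
proof -
  have closed: "B v y z \<in> carrier X" if "v \<in> carrier V" "y \<in> carrier Y" "z \<in> carrier Z" for v y z
    using that assms(3) semilinear_closed by fastforce
  have "tsum Y Z X (\<lambda>y z. B (v \<oplus>\<^bsub>V\<^esub> v') y z) t
      = tsum Y Z X (\<lambda>y z. B v y z) t \<oplus>\<^bsub>X\<^esub> tsum Y Z X (\<lambda>y z. B v' y z) t"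
    if "v \<in> carrier V" "v' \<in> carrier V" for v v'
    unfolding tsum_list_sum using that assms closed
    by (subst list_sum_add[symmetric])
      (auto intro!: list_sum_cong simp: semilinear_def)
  moreover have "tsum Y Z X (\<lambda>y z. B (c \<odot>\<^bsub>V\<^esub> v) y z) t
      = (if b then cnj c else c) \<odot>\<^bsub>X\<^esub> tsum Y Z X (\<lambda>y z. B v y z) t"
    if "v \<in> carrier V" for c v
    unfolding tsum_list_sum using that assms closed
    by (subst list_sum_smult[symmetric])
      (auto intro!: list_sum_cong simp: semilinear_def)
  ultimately show ?thesis using assms(1) closed by (simp add: semilinear_def)
qed

text \<open>Here the tensor itself varies with \<open>v\<close>, and with it the representative;
  \<open>B\<close> has to be bilinear so that the sum is a linear function of the tensor.\<close>

lemma semilinear_tsum_arg [simp]: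
  assumes "vector_space_C X" "vector_space_C Y" "vector_space_C Z"
    "bisemilinear False Y Z X B" "semilinear b V (tensor Y Z) f"
  shows "semilinear b V X (\<lambda>v. tsum Y Z X B (f v))"
  using semilinear_comp[OF assms(5) semilinear_tsum[OF assms(2,3,1,4)]] by simp

lemma semilinear_tsum_arg_antilinear [simp]:
  assumes "vector_space_C X" "vector_space_C Y" "vector_space_C Z"
    "bisemilinear True Y Z X B" "semilinear (\<not> b) V (tensor Y Z) f"
  shows "semilinear b V X (\<lambda>v. tsum Y Z X B (f v))"
  using semilinear_comp[OF assms(5) semilinear_tsum[OF assms(2,3,1,4)]] by simp

declare bisemilinear_def [simp]

lemma semilinear_closed_all: "semilinear b V W f \<Longrightarrow> \<forall>x \<in> carrier V. f x \<in> carrier W"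
  by (simp add: semilinear_def)


section \<open>Canonical maps between tensor products\<close>

lemma tensor_map_eq_tsum:
  assumes "t \<in> carrier (tensor V W)" "vector_space_C V" "vector_space_C W"
  shows "tensor_map V' W' f g t = tsum V W (tensor V' W') (\<lambda>v w. pure V' W' (f v) (g w)) t"
  unfolding tensor_map_def using assms by (rule lift_eq_tsum)

lemma semilinear_tensor_map [simp]:
  assumes "vector_space_C V" "vector_space_C W" "vector_space_C V'" "vector_space_C W'"
    "semilinear b V V' f" "semilinear b W W' g"
  shows "semilinear b (tensor V W) (tensor V' W') (tensor_map V' W' f g)"
proof -
  have "semilinear b (tensor V W) (tensor V' W')
      (tsum V W (tensor V' W') (\<lambda>v w. pure V' W' (f v) (g w)))"
    using assms assms(5,6)[THEN semilinear_closed_all] by (intro semilinear_tsum) auto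
  then show ?thesis using assms
    by (subst semilinear_cong[OF tensor_map_eq_tsum]) auto
qed

lemma tensor_map_pure:
  assumes "vector_space_C V" "vector_space_C W" "vector_space_C V'" "vector_space_C W'"
    "semilinear b V V' f" "semilinear b W W' g" "v \<in> carrier V" "w \<in> carrier W"
  shows "tensor_map V' W' f g (pure V W v w) = pure V' W' (f v) (g w)"
  using assms assms(5,6)[THEN semilinear_closed_all]
  by (subst tensor_map_eq_tsum[where V = V and W = W])
    (auto intro!: tsum_pure[where b = b])

lemmas tensor_map_pure_linear [simp] = tensor_map_pure[where b = False]
lemmas tensor_map_pure_antilinear [simp] = tensor_map_pure[where b = True]

lemma tensor_map_tsum:
  assumes "vector_space_C V" "vector_space_C W" "vector_space_C V'" "vector_space_C W'"
    "semilinear b V V' f" "semilinear b W W' g"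
    "\<forall>y \<in> carrier Y. \<forall>z \<in> carrier Z. C y z \<in> carrier (tensor V W)"
  shows "tensor_map V' W' f g (tsum Y Z (tensor V W) C t)
    = tsum Y Z (tensor V' W') (\<lambda>y z. tensor_map V' W' f g (C y z)) t"
  using assms by (intro tsum_map[where X = "tensor V W" and b = b]) auto

lemmas tensor_map_tsum_linear [simp] = tensor_map_tsum[where b = False]
lemmas tensor_map_tsum_antilinear [simp] = tensor_map_tsum[where b = True]

lemma flip_pure [simp]:
  assumes "vector_space_C V" "vector_space_C W" "v \<in> carrier V" "w \<in> carrier W"
  shows "flip V W (pure V W v w) = pure W V w v"
  unfolding flip_def using assms by (subst lift_eq_tsum[where V = V and W = W]) auto

lemma semilinear_flip [simp]:
  assumes "vector_space_C V" "vector_space_C W"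
  shows "semilinear False (tensor V W) (tensor W V) (flip V W)"
proof -
  have "semilinear False (tensor V W) (tensor W V) (tsum V W (tensor W V) (\<lambda>v w. pure W V w v))"
    using assms by (intro semilinear_tsum) auto
  then show ?thesis using assms unfolding flip_def
    by (subst semilinear_cong[OF lift_eq_tsum[where V = V and W = W]]) auto
qed

lemma assoc_eq_tsum:
  assumes "t \<in> carrier (tensor (tensor U V) W)"
    "vector_space_C U" "vector_space_C V" "vector_space_C W"
  shows "assoc U V W t = tsum (tensor U V) W (tensor U (tensor V W))
    (\<lambda>s w. tsum U V (tensor U (tensor V W)) (\<lambda>u v. pure U (tensor V W) u (pure V W v w)) s) t"
  unfolding assoc_def using assms
  by (subst lift_eq_tsum[where V = "tensor U V" and W = W])
    (auto intro!: tsum_cong lift_eq_tsum)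

lemma semilinear_assoc [simp]:
  assumes "vector_space_C U" "vector_space_C V" "vector_space_C W"
  shows "semilinear False (tensor (tensor U V) W) (tensor U (tensor V W)) (assoc U V W)"
  using assms
  by (subst semilinear_cong[OF assoc_eq_tsum]) (auto intro!: semilinear_tsum)

text \<open>The left factor \<open>t\<close> is kept general because coproducts and coactions, which
  are not pure, get substituted there; a pure \<open>t\<close> collapses further by
  \<open>tsum_pure_linear\<close>.\<close>

lemma assoc_pure [simp]:
  assumes "vector_space_C U" "vector_space_C V" "vector_space_C W"
    "t \<in> carrier (tensor U V)" "w \<in> carrier W"
  shows "assoc U V W (pure (tensor U V) W t w)
    = tsum U V (tensor U (tensor V W)) (\<lambda>u v. pure U (tensor V W) u (pure V W v w)) t"
  using assms by (subst assoc_eq_tsum) auto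

lemma assoc_inv_eq_tsum:
  assumes "t \<in> carrier (tensor U (tensor V W))"
    "vector_space_C U" "vector_space_C V" "vector_space_C W"
  shows "assoc_inv U V W t = tsum U (tensor V W) (tensor (tensor U V) W)
    (\<lambda>u s. tsum V W (tensor (tensor U V) W) (\<lambda>v w. pure (tensor U V) W (pure U V u v) w) s) t"
  unfolding assoc_inv_def using assms
  by (subst lift_eq_tsum[where V = U and W = "tensor V W"])
    (auto intro!: tsum_cong lift_eq_tsum)

lemma semilinear_assoc_inv [simp]:
  assumes "vector_space_C U" "vector_space_C V" "vector_space_C W"
  shows "semilinear False (tensor U (tensor V W)) (tensor (tensor U V) W) (assoc_inv U V W)"
  using assms
  by (subst semilinear_cong[OF assoc_inv_eq_tsum]) (auto intro!: semilinear_tsum)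

lemma assoc_inv_pure [simp]:
  assumes "vector_space_C U" "vector_space_C V" "vector_space_C W"
    "t \<in> carrier (tensor V W)" "u \<in> carrier U"
  shows "assoc_inv U V W (pure U (tensor V W) u t)
    = tsum V W (tensor (tensor U V) W) (\<lambda>v w. pure (tensor U V) W (pure U V u v) w) t"
  using assms by (subst assoc_inv_eq_tsum) auto

lemma assoc_tsum [simp]:
  assumes "vector_space_C U" "vector_space_C V" "vector_space_C W"
    "\<forall>y \<in> carrier Y. \<forall>z \<in> carrier Z. C y z \<in> carrier (tensor (tensor U V) W)"
  shows "assoc U V W (tsum Y Z (tensor (tensor U V) W) C t)
    = tsum Y Z (tensor U (tensor V W)) (\<lambda>y z. assoc U V W (C y z)) t"
  using assms by (intro tsum_map[OF semilinear_assoc]) auto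

lemma assoc_inv_tsum [simp]:
  assumes "vector_space_C U" "vector_space_C V" "vector_space_C W"
    "\<forall>y \<in> carrier Y. \<forall>z \<in> carrier Z. C y z \<in> carrier (tensor U (tensor V W))"
  shows "assoc_inv U V W (tsum Y Z (tensor U (tensor V W)) C t)
    = tsum Y Z (tensor (tensor U V) W) (\<lambda>y z. assoc_inv U V W (C y z)) t"
  using assms by (intro tsum_map[OF semilinear_assoc_inv]) auto

lemma semilinear_swap_last [simp]:
  assumes "vector_space_C U" "vector_space_C V" "vector_space_C W"
  shows "semilinear False (tensor (tensor U V) W) (tensor (tensor U W) V) (swap_last U V W)"
proof -
  have "semilinear False (tensor U (tensor V W)) (tensor U (tensor W V))
      (tensor_map U (tensor W V) id (flip V W))"
    using assms by simp
  from semilinear_comp[OF semilinear_comp[OF semilinear_assoc[OF assms] this] semilinear_assoc_inv]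
  show ?thesis using assms by (simp add: swap_last_def comp_def)
qed

lemma swap_last_tsum [simp]:
  assumes "vector_space_C U" "vector_space_C V" "vector_space_C W"
    "\<forall>y \<in> carrier Y. \<forall>z \<in> carrier Z. C y z \<in> carrier (tensor (tensor U V) W)"
  shows "swap_last U V W (tsum Y Z (tensor (tensor U V) W) C t)
    = tsum Y Z (tensor (tensor U W) V) (\<lambda>y z. swap_last U V W (C y z)) t"
  using assms by (intro tsum_map[OF semilinear_swap_last]) auto

lemma swap_last_pure [simp]:
  assumes "vector_space_C U" "vector_space_C V" "vector_space_C W"
    "t \<in> carrier (tensor U V)" "w \<in> carrier W"
  shows "swap_last U V W (pure (tensor U V) W t w)
    = tsum U V (tensor (tensor U W) V) (\<lambda>u v. pure (tensor U W) V (pure U W u w) v) t"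
  using assms by (simp add: swap_last_def)

lemma semilinear_swap_mid [simp]:
  assumes "vector_space_C U" "vector_space_C V" "vector_space_C W" "vector_space_C X"
  shows "semilinear False (tensor (tensor U V) (tensor W X)) (tensor (tensor U W) (tensor V X))
    (swap_mid U V W X)"
proof -
  have "semilinear False (tensor (tensor (tensor U V) W) X) (tensor (tensor (tensor U W) V) X)
      (tensor_map (tensor (tensor U W) V) X (swap_last U V W) id)"
    using assms by simp
  from semilinear_comp[OF semilinear_comp[OF semilinear_assoc_inv this] semilinear_assoc]
  show ?thesis using assms by (simp add: swap_mid_def comp_def)
qed

lemma swap_mid_tsum [simp]:
  assumes "vector_space_C U" "vector_space_C V" "vector_space_C W" "vector_space_C X"
    "\<forall>y \<in> carrier Y. \<forall>z \<in> carrier Z. C y z \<in> carrier (tensor (tensor U V) (tensor W X))"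
  shows "swap_mid U V W X (tsum Y Z (tensor (tensor U V) (tensor W X)) C t)
    = tsum Y Z (tensor (tensor U W) (tensor V X)) (\<lambda>y z. swap_mid U V W X (C y z)) t"
  using assms by (intro tsum_map[OF semilinear_swap_mid]) auto

lemma swap_mid_pure [simp]:
  assumes "vector_space_C U" "vector_space_C V" "vector_space_C W" "vector_space_C X"
    "s \<in> carrier (tensor U V)" "t \<in> carrier (tensor W X)"
  shows "swap_mid U V W X (pure (tensor U V) (tensor W X) s t)
    = tsum W X (tensor (tensor U W) (tensor V X)) (\<lambda>w x. tsum U V (tensor (tensor U W) (tensor V X))
       (\<lambda>u v. pure (tensor U W) (tensor V X) (pure U W u w) (pure V X v x)) s) t"
  using assms by (simp add: swap_mid_def)


section \<open>Forgetting additional structure on vector spaces\<close>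

text \<open>An object of the category and its underlying tensor product are different records. The
  relation compares exactly the fields on which tensor products, sums and semilinearity
  depend.\<close>

definition same_space ::
  "(complex, 'u, 'x) module_scheme \<Rightarrow> (complex, 'u, 'y) module_scheme \<Rightarrow> bool" where
  "same_space V V' \<longleftrightarrow> carrier V = carrier V' \<and> zero V = zero V' \<and> add V = add V'
     \<and> module.smult V = module.smult V'"

lemma same_space_sym: "same_space V V' \<Longrightarrow> same_space V' V"
  by (simp add: same_space_def)

lemma same_space_vector_space:
  assumes "same_space V V'" "vector_space_C V"
  shows "vector_space_C V'"
proof -
  have eq: "carrier V' = carrier V" "zero V' = zero V" "add V' = add V"
    "module.smult V' = module.smult V"
    using assms by (auto simp: same_space_def)
  show ?thesis
    by (rule vector_spaceI)
      (use assms(2) in \<open>auto simp: eq vs_add_assoc vs_smult_smult vs_smult_add_left vs_smult_add_right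
        intro: vs_add_commute\<close>)
qed

lemma same_space_tensor_rel_imp:
  assumes "tensor_rel V W k l" "same_space V V'" "same_space W W'"
  shows "tensor_rel V' W' k l"
  using assms
  by (induction rule: tensor_rel.induct)
    (auto simp: same_space_def intro: tensor_rel.refl tensor_rel.append tensor_rel.commute
      tensor_rel.zero[of _ W' V'] tensor_rel.add_left[of _ V' _ _ W']
      tensor_rel.add_right[of _ V' _ W'] tensor_rel.smult[of _ V' _ W']
      dest: tensor_rel.sym tensor_rel.trans)

lemma same_space_tensor_rel:
  assumes "same_space V V'" "same_space W W'"
  shows "tensor_rel V W = tensor_rel V' W'"
proof (intro ext iffI)
  fix k l
  show "tensor_rel V W k l \<Longrightarrow> tensor_rel V' W' k l"
    using assms by (blast intro: same_space_tensor_rel_imp)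
  show "tensor_rel V' W' k l \<Longrightarrow> tensor_rel V W k l"
    using assms[THEN same_space_sym] by (blast intro: same_space_tensor_rel_imp)
qed

text \<open>These are equalities and not just isomorphisms: the relation on formal sums is literally
  the same, hence so is the representative chosen from each class.\<close>

lemma
  assumes "same_space V V'" "same_space W W'"
  shows same_space_tensor: "tensor V W = tensor V' W'"
    and same_space_pure: "pure V W = pure V' W'"
  using assms
  by (auto simp: tensor_def pure_def tensor_class_def same_space_tensor_rel[OF assms]
      same_space_def fun_eq_iff)

lemma same_space_tsum:
  assumes "same_space V V'" "same_space W W'" "same_space X X'"
  shows "tsum V W X = tsum V' W' X'"
proof -
  have "carrier V = carrier V'" "carrier W = carrier W'" "add X = add X'" "zero X = zero X'"
    using assms by (auto simp: same_space_def)
  then show ?thesis unfolding tsum_def lift_def by metis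
qed

lemma same_space_semilinear:
  assumes "same_space V V'" "same_space W W'"
  shows "semilinear b V W = semilinear b V' W'"
  using assms by (auto simp: semilinear_def same_space_def fun_eq_iff)

lemma same_space_refl [simp]: "same_space V V"
  by (simp add: same_space_def)

lemma same_space_yd_tensor [simp]: "same_space (yd_tensor A V W) (tensor V W)"
  by (simp add: same_space_def yd_tensor_def module.defs)

lemma same_space_yd_unit [simp]: "same_space (yd_unit A) complex_space"
  by (simp add: same_space_def yd_unit_def module.defs)

lemmas same_space_yd = same_space_yd_tensor same_space_yd_unit

lemma carrier_yd_tensor [simp]: "carrier (yd_tensor A V W) = carrier (tensor V W)"
  and carrier_yd_unit [simp]: "carrier (yd_unit A) = carrier complex_space"
  using same_space_yd unfolding same_space_def by blast+

lemmas tensor_yd [simp] =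
  same_space_yd[THEN same_space_tensor, OF same_space_refl]
  same_space_yd[THEN same_space_tensor[OF same_space_refl]]

lemmas pure_yd [simp] =
  same_space_yd[THEN same_space_pure, OF same_space_refl]
  same_space_yd[THEN same_space_pure[OF same_space_refl]]

lemmas tsum_yd [simp] =
  same_space_yd[THEN same_space_tsum, OF same_space_refl same_space_refl]
  same_space_yd[THEN same_space_tsum[OF same_space_refl], OF same_space_refl]
  same_space_yd[THEN same_space_tsum[OF same_space_refl same_space_refl]]

lemmas semilinear_yd [simp] =
  same_space_yd[THEN same_space_semilinear, OF same_space_refl]
  same_space_yd[THEN same_space_semilinear[OF same_space_refl]]

lemma vector_space_complex_space [simp]: "vector_space_C complex_space"
  by (rule vector_spaceI) (auto simp: complex_space_def algebra_simps)

lemma vector_space_yd_tensor [simp]: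
  "vector_space_C V \<Longrightarrow> vector_space_C W \<Longrightarrow> vector_space_C (yd_tensor A V W)"
  by (rule same_space_vector_space[OF same_space_sym[OF same_space_yd_tensor]]) simp

lemma vector_space_yd_unit [simp]: "vector_space_C (yd_unit A)"
  by (rule same_space_vector_space[OF same_space_sym[OF same_space_yd_unit]]) simp

lemma smult_yd_tensor [simp]: "module.smult (yd_tensor A V W) = module.smult (tensor V W)"
  and smult_yd_unit [simp]: "module.smult (yd_unit A) = module.smult complex_space"
  using same_space_yd unfolding same_space_def by blast+


section \<open>Sweedler calculus in an involutive Hopf algebra\<close>

lemma
  assumes "ring R"
  shows ring_mult_closed: "a \<in> carrier R \<Longrightarrow> b \<in> carrier R \<Longrightarrow> a \<otimes>\<^bsub>R\<^esub> b \<in> carrier R"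
    and ring_one_closed: "\<one>\<^bsub>R\<^esub> \<in> carrier R"
    and ring_mult_assoc: "a \<in> carrier R \<Longrightarrow> b \<in> carrier R \<Longrightarrow> c \<in> carrier R
      \<Longrightarrow> (a \<otimes>\<^bsub>R\<^esub> b) \<otimes>\<^bsub>R\<^esub> c = a \<otimes>\<^bsub>R\<^esub> (b \<otimes>\<^bsub>R\<^esub> c)"
    and ring_one_left: "a \<in> carrier R \<Longrightarrow> \<one>\<^bsub>R\<^esub> \<otimes>\<^bsub>R\<^esub> a = a"
    and ring_one_right: "a \<in> carrier R \<Longrightarrow> a \<otimes>\<^bsub>R\<^esub> \<one>\<^bsub>R\<^esub> = a"
    and ring_distrib_left: "a \<in> carrier R \<Longrightarrow> b \<in> carrier R \<Longrightarrow> c \<in> carrier R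
      \<Longrightarrow> (a \<oplus>\<^bsub>R\<^esub> b) \<otimes>\<^bsub>R\<^esub> c = a \<otimes>\<^bsub>R\<^esub> c \<oplus>\<^bsub>R\<^esub> b \<otimes>\<^bsub>R\<^esub> c"
    and ring_distrib_right: "a \<in> carrier R \<Longrightarrow> b \<in> carrier R \<Longrightarrow> c \<in> carrier R
      \<Longrightarrow> c \<otimes>\<^bsub>R\<^esub> (a \<oplus>\<^bsub>R\<^esub> b) = c \<otimes>\<^bsub>R\<^esub> a \<oplus>\<^bsub>R\<^esub> c \<otimes>\<^bsub>R\<^esub> b"
proof -
  interpret ring R by fact
  show "a \<in> carrier R \<Longrightarrow> b \<in> carrier R \<Longrightarrow> a \<otimes>\<^bsub>R\<^esub> b \<in> carrier R"
    "\<one>\<^bsub>R\<^esub> \<in> carrier R"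
    "a \<in> carrier R \<Longrightarrow> b \<in> carrier R \<Longrightarrow> c \<in> carrier R
      \<Longrightarrow> (a \<otimes>\<^bsub>R\<^esub> b) \<otimes>\<^bsub>R\<^esub> c = a \<otimes>\<^bsub>R\<^esub> (b \<otimes>\<^bsub>R\<^esub> c)"
    "a \<in> carrier R \<Longrightarrow> \<one>\<^bsub>R\<^esub> \<otimes>\<^bsub>R\<^esub> a = a" "a \<in> carrier R \<Longrightarrow> a \<otimes>\<^bsub>R\<^esub> \<one>\<^bsub>R\<^esub> = a"
    "a \<in> carrier R \<Longrightarrow> b \<in> carrier R \<Longrightarrow> c \<in> carrier R
      \<Longrightarrow> (a \<oplus>\<^bsub>R\<^esub> b) \<otimes>\<^bsub>R\<^esub> c = a \<otimes>\<^bsub>R\<^esub> c \<oplus>\<^bsub>R\<^esub> b \<otimes>\<^bsub>R\<^esub> c"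
    "a \<in> carrier R \<Longrightarrow> b \<in> carrier R \<Longrightarrow> c \<in> carrier R
      \<Longrightarrow> c \<otimes>\<^bsub>R\<^esub> (a \<oplus>\<^bsub>R\<^esub> b) = c \<otimes>\<^bsub>R\<^esub> a \<oplus>\<^bsub>R\<^esub> c \<otimes>\<^bsub>R\<^esub> b"
    by (simp_all add: m_assoc l_distr r_distr)
qed

context involutive_hopf_algebra
begin

lemma A_ring: "ring A"
  by (rule hopf_algebra.axioms(1)[OF hopf_algebra_axioms])

lemmas mult_closed [simp] = ring_mult_closed[OF A_ring]
  and unit_closed [simp] = ring_one_closed[OF A_ring]
  and mult_assoc_A = ring_mult_assoc[OF A_ring]
  and mult_one_left [simp] = ring_one_left[OF A_ring]
  and mult_one_right [simp] = ring_one_right[OF A_ring]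
  and distrib_left_A = ring_distrib_left[OF A_ring]
  and distrib_right_A = ring_distrib_right[OF A_ring]

lemma vector_space_A [simp]: "vector_space_C A"
  by (rule module_axioms)

lemma semilinear_mult_left [simp]:
  "semilinear b V A f \<Longrightarrow> a \<in> carrier A \<Longrightarrow> semilinear b V A (\<lambda>v. f v \<otimes> a)"
  by (simp add: semilinear_def distrib_left_A mult_smult_left)

lemma semilinear_mult_right [simp]:
  "semilinear b V A f \<Longrightarrow> a \<in> carrier A \<Longrightarrow> semilinear b V A (\<lambda>v. a \<otimes> f v)"
  by (simp add: semilinear_def distrib_right_A mult_smult_right)

lemma semilinear_coprod_comp [simp]:
  "semilinear b V A f \<Longrightarrow> semilinear b V (tensor A A) (\<lambda>v. coprod A (f v))"
  using semilinear_comp[of b V A f False "tensor A A" "coprod A"] coprod_linear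
  by (simp add: linear_map_iff_semilinear)

lemma semilinear_antipode_comp [simp]:
  "semilinear b V A f \<Longrightarrow> semilinear b V A (\<lambda>v. antipode A (f v))"
  using semilinear_comp[of b V A f False A "antipode A"] antipode_linear
  by (simp add: linear_map_iff_semilinear)

lemma semilinear_star_comp [simp]:
  "semilinear (\<not> b) V A f \<Longrightarrow> semilinear b V A (\<lambda>v. star A (f v))"
  using semilinear_comp[of "\<not> b" V A f True A "star A"] star_conjugation
  by (simp add: conjugation_iff_semilinear)

lemma semilinear_coprod [simp]: "semilinear False A (tensor A A) (coprod A)"
  using semilinear_coprod_comp[OF semilinear_ident] by simp

lemma semilinear_antipode [simp]: "semilinear False A A (antipode A)"
  using semilinear_antipode_comp[OF semilinear_ident] by simp

lemma semilinear_star [simp]: "semilinear True A A (star A)"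
  using semilinear_star_comp[of True A "\<lambda>x. x"] by simp

lemma coprod_closed [simp]: "a \<in> carrier A \<Longrightarrow> coprod A a \<in> carrier (tensor A A)"
  by (rule semilinear_closed[OF semilinear_coprod])

lemma antipode_closed [simp]: "a \<in> carrier A \<Longrightarrow> antipode A a \<in> carrier A"
  by (rule semilinear_closed[OF semilinear_antipode])

lemma star_closed [simp]: "a \<in> carrier A \<Longrightarrow> star A a \<in> carrier A"
  by (rule semilinear_closed[OF semilinear_star])

lemma star_star [simp]: "a \<in> carrier A \<Longrightarrow> star A (star A a) = a"
  using star_conjugation by (simp add: conjugation_iff_semilinear)

text \<open>With e = star 1 one has e = e \<otimes> star e = star (e \<otimes> 1) = star e = 1,
  because star is an anti-multiplicative involution.\<close>

lemma star_one [simp]: "star A \<one> = \<one>"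
  
proof -
  have "star A \<one> = star A \<one> \<otimes> star A (star A \<one>)" by simp
  also have "\<dots> = star A (star A \<one> \<otimes> \<one>)" by (subst star_mult) auto
  also have "\<dots> = \<one>" by simp
  finally show ?thesis .
qed

lemma semilinear_counit_smult [simp]:
  assumes "semilinear b V A f" "vector_space_C X" "x \<in> carrier X"
  shows "semilinear b V X (\<lambda>v. counit A (f v) \<odot>\<^bsub>X\<^esub> x)"
  using assms by (simp add: semilinear_def counit_add counit_smult vs_smult_smult vs_smult_add_left)

lemma semilinear_smult_comp [simp]:
  assumes "semilinear b V X f" "vector_space_C X"
  shows "semilinear b V X (\<lambda>v. c \<odot>\<^bsub>X\<^esub> f v)"
  using assms by (simp add: semilinear_def vs_smult_smult vs_smult_add_right mult.commute)

lemma star_tsum [simp]: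
  assumes "\<forall>v \<in> carrier V. \<forall>w \<in> carrier W. B v w \<in> carrier A"
  shows "star A (tsum V W A B t) = tsum V W A (\<lambda>v w. star A (B v w)) t"
  using assms by (intro tsum_map[OF semilinear_star]) auto

lemma mult_map_eq_tsum:
  "t \<in> carrier (tensor A A) \<Longrightarrow> mult_map A t = tsum A A A (\<lambda>a b. a \<otimes> b) t"
  unfolding mult_map_def by (rule lift_eq_tsum) auto

lemma semilinear_mult_map [simp]: "semilinear False (tensor A A) A (mult_map A)"
  by (subst semilinear_cong[OF mult_map_eq_tsum]) (auto intro!: semilinear_tsum)

lemma mult_map_pure [simp]:
  "a \<in> carrier A \<Longrightarrow> b \<in> carrier A \<Longrightarrow> mult_map A (pure A A a b) = a \<otimes> b"
  by (simp add: mult_map_eq_tsum)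

lemma mult_map_tsum [simp]:
  assumes "\<forall>v \<in> carrier V. \<forall>w \<in> carrier W. B v w \<in> carrier (tensor A A)"
  shows "mult_map A (tsum V W (tensor A A) B t) = tsum V W A (\<lambda>v w. mult_map A (B v w)) t"
  using assms by (intro tsum_map[OF semilinear_mult_map]) auto

lemma tensor_map_coprod [simp]:
  "a \<in> carrier A \<Longrightarrow> tensor_map V' W' f g (coprod A a)
    = tsum A A (tensor V' W') (\<lambda>a b. pure V' W' (f a) (g b)) (coprod A a)"
  by (rule tensor_map_eq_tsum) auto

lemma coprod_mult_tsum:
  assumes "a \<in> carrier A" "b \<in> carrier A"
  shows "coprod A (a \<otimes> b) = tsum A A (tensor A A) (\<lambda>a1 a2. tsum A A (tensor A A)
    (\<lambda>b1 b2. pure A A (a1 \<otimes> b1) (a2 \<otimes> b2)) (coprod A b)) (coprod A a)"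
  \<comment> \<open>\<open>swap_mid_pure\<close> puts the sum over its second tensor outermost; here
    the sum over the coproduct of \<open>a\<close> is wanted outside.\<close>
  using assms by (subst tsum_commute) (auto simp: coprod_mult)

lemma coprod_star_tsum:
  "a \<in> carrier A \<Longrightarrow> coprod A (star A a)
    = tsum A A (tensor A A) (\<lambda>a1 a2. pure A A (star A a1) (star A a2)) (coprod A a)"
  by (simp add: coprod_star)

text \<open>Coassociativity under an arbitrary trilinear or tri-anti-linear \<open>B\<close>: both
  sides are images of the two iterated coproducts under the map on A \<otimes> (A \<otimes> A)
  induced by \<open>B\<close>. In this form it can be applied deep inside larger sums.\<close>

lemma coassoc_tsum:
  assumes "a \<in> carrier A" "vector_space_C X"
    and "\<forall>x \<in> carrier A. \<forall>y \<in> carrier A. semilinear b A X (\<lambda>z. B x y z)"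
    and "\<forall>x \<in> carrier A. \<forall>z \<in> carrier A. semilinear b A X (\<lambda>y. B x y z)"
    and "\<forall>y \<in> carrier A. \<forall>z \<in> carrier A. semilinear b A X (\<lambda>x. B x y z)"
  shows "tsum A A X (\<lambda>a1 a3. tsum A A X (\<lambda>a1 a2. B a1 a2 a3) (coprod A a1)) (coprod A a)
    = tsum A A X (\<lambda>a1 a2. tsum A A X (\<lambda>a2 a3. B a1 a2 a3) (coprod A a2)) (coprod A a)"
proof -
  let ?F = "tsum A (tensor A A) X (\<lambda>a s. tsum A A X (\<lambda>b c. B a b c) s)"
  have closed: "\<forall>x \<in> carrier A. \<forall>y \<in> carrier A. \<forall>z \<in> carrier A. B x y z \<in> carrier X"
    using assms(3) by (meson semilinear_closed)
  have "tsum A A X (\<lambda>a1 a3. tsum A A X (\<lambda>a1 a2. B a1 a2 a3) (coprod A a1)) (coprod A a)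
    = ?F (assoc A A A (tensor_map (tensor A A) A (coprod A) id (coprod A a)))"
    \<comment> \<open>The case split fixes the parity, since the simplification rules exist for a
      definite parity only.\<close>
    using assms closed by (cases b) simp_all
  also have "\<dots> = ?F (tensor_map A (tensor A A) id (coprod A) (coprod A a))"
    by (simp only: coassociative[OF assms(1)])
  also have "\<dots> = tsum A A X (\<lambda>a1 a2. tsum A A X (\<lambda>a2 a3. B a1 a2 a3) (coprod A a2)) (coprod A a)"
    using assms closed by (cases b) simp_all
  finally show ?thesis .
qed

text \<open>Apply \<open>g\<close> to the counit axiom; an anti-linear \<open>g\<close> conjugates
  the scalar, which accounts for the conditional.\<close>

lemma counit_left_tsum:
  assumes "a \<in> carrier A" "vector_space_C X" "semilinear b A X g"
  shows "tsum A A X (\<lambda>a1 a2. (if b then cnj (counit A a1) else counit A a1) \<odot>\<^bsub>X\<^esub> g a2) (coprod A a) = g a"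
proof -
  have "g a = g (tsum A A A (\<lambda>a1 a2. counit A a1 \<odot> a2) (coprod A a))"
    using counit_left[OF assms(1)] by (simp add: lift_eq_tsum[where V = A and W = A] assms(1))
  also have "\<dots> = tsum A A X (\<lambda>a1 a2. g (counit A a1 \<odot> a2)) (coprod A a)"
    using assms by (intro tsum_map[OF assms(3)]) auto
  also have "\<dots> = tsum A A X
      (\<lambda>a1 a2. (if b then cnj (counit A a1) else counit A a1) \<odot>\<^bsub>X\<^esub> g a2) (coprod A a)"
    using semilinear_smult[OF assms(3)] by (intro tsum_cong) auto
  finally show ?thesis ..
qed

lemma counit_right_tsum:
  assumes "a \<in> carrier A" "vector_space_C X" "semilinear b A X g"
  shows "tsum A A X (\<lambda>a1 a2. (if b then cnj (counit A a2) else counit A a2) \<odot>\<^bsub>X\<^esub> g a1) (coprod A a) = g a"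
proof -
  have "g a = g (tsum A A A (\<lambda>a1 a2. counit A a2 \<odot> a1) (coprod A a))"
    using counit_right[OF assms(1)] by (simp add: lift_eq_tsum[where V = A and W = A] assms(1))
  also have "\<dots> = tsum A A X (\<lambda>a1 a2. g (counit A a2 \<odot> a1)) (coprod A a)"
    using assms by (intro tsum_map[OF assms(3)]) auto
  also have "\<dots> = tsum A A X
      (\<lambda>a1 a2. (if b then cnj (counit A a2) else counit A a2) \<odot>\<^bsub>X\<^esub> g a1) (coprod A a)"
    using semilinear_smult[OF assms(3)] by (intro tsum_cong) auto
  finally show ?thesis ..
qed

lemma antipode_left_tsum:
  assumes "a \<in> carrier A"
  shows "tsum A A A (\<lambda>a1 a2. antipode A a1 \<otimes> a2) (coprod A a) = counit A a \<odot> \<one>"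
  using antipode_left[OF assms] assms by simp

lemma antipode_right_tsum:
  assumes "a \<in> carrier A"
  shows "tsum A A A (\<lambda>a1 a2. a1 \<otimes> antipode A a2) (coprod A a) = counit A a \<odot> \<one>"
  using antipode_right[OF assms] assms by simp

text \<open>Apply \<epsilon> to S(a1) a2 = \<epsilon>(a) 1 and absorb \<epsilon>(a2) into a1. Sums
  take values in a vector space record, so \<epsilon> is replaced by \<open>?e\<close>, with values
  in \<open>A\<close>; applying the counit at the end removes the factor 1. The result yields
  condition (b) for the unit object.\<close>

lemma counit_antipode [simp]:
  assumes a: "a \<in> carrier A"
  shows "counit A (antipode A a) = counit A a"
proof -
  let ?e = "\<lambda>x. counit A x \<odot> \<one>"
  have "?e (antipode A a)
      = ?e (antipode A (tsum A A A (\<lambda>a1 a2. counit A a2 \<odot> a1) (coprod A a)))"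
    using counit_right_tsum[of a A False "\<lambda>x. x"] a by simp
  also have "\<dots> = tsum A A A (\<lambda>a1 a2. ?e (antipode A (counit A a2 \<odot> a1))) (coprod A a)"
    using a by (intro tsum_map[of False A A "\<lambda>x. ?e (antipode A x)"]) auto
  also have "\<dots> = tsum A A A (\<lambda>a1 a2. ?e (antipode A a1 \<otimes> a2)) (coprod A a)"
    by (intro tsum_cong)
      (auto simp: semilinear_smult[OF semilinear_antipode] counit_smult counit_mult mult.commute)
  also have "\<dots> = ?e (tsum A A A (\<lambda>a1 a2. antipode A a1 \<otimes> a2) (coprod A a))"
    using a by (intro tsum_map[of False A A ?e, symmetric]) auto
  also have "\<dots> = ?e a"
    using a by (simp add: antipode_left_tsum counit_smult counit_one)
  finally have "counit A (?e (antipode A a)) = counit A (?e a)" by simp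
  then show ?thesis by (simp add: counit_smult counit_one)
qed


section \<open>Sweedler calculus for Yetter--Drinfeld modules\<close>

definition act :: "'a univ star_bimodule \<Rightarrow> 'a univ \<Rightarrow> 'a univ \<Rightarrow> 'a univ" where
  "act V a v = action V (pure A V a v)"

lemma
  assumes "V \<in> yd_obj A"
  shows yd_vector_space: "vector_space_C V"
    and yd_conjugation: "conjugation V (involution V)"
    and yd_left_action: "left_action A V (action V)"
    and yd_left_coaction: "left_coaction A V (coaction V)"
  using assms unfolding yd_obj_def by blast+

lemma yd_involution_involution [simp]:
  "\<lbrakk>V \<in> yd_obj A; v \<in> carrier V\<rbrakk> \<Longrightarrow> involution V (involution V v) = v"
  by (drule yd_conjugation) (simp add: conjugation_iff_semilinear)

text \<open>The part of being an object that makes the Sweedler calculus work. It holds for a tensor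
  product by construction, so that the calculus can be used to prove the remaining axioms for that
  tensor product.\<close>

definition linear_structure :: "'a univ star_bimodule \<Rightarrow> bool" where
  "linear_structure V \<longleftrightarrow> vector_space_C V \<and> semilinear False (tensor A V) V (action V)
     \<and> semilinear False V (tensor A V) (coaction V) \<and> semilinear True V V (involution V)"

lemma yd_linear_structure [simp]: "V \<in> yd_obj A \<Longrightarrow> linear_structure V"
  using yd_vector_space yd_conjugation yd_left_action yd_left_coaction
  unfolding linear_structure_def left_action_def left_coaction_def linear_map_iff_semilinear
      conjugation_iff_semilinear by blast

lemma
  assumes "linear_structure V"
  shows linear_structure_vector_space [simp]: "vector_space_C V"
    and yd_semilinear_action: "semilinear False (tensor A V) V (action V)"
    and yd_semilinear_coaction: "semilinear False V (tensor A V) (coaction V)"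
    and yd_semilinear_involution: "semilinear True V V (involution V)"
  using assms unfolding linear_structure_def by blast+

lemma semilinear_act_left:
  assumes "linear_structure V" "semilinear b X A f" "v \<in> carrier V"
  shows "semilinear b X V (\<lambda>x. act V (f x) v)"
  unfolding act_def
  using semilinear_comp[of b X "tensor A V" "\<lambda>x. pure A V (f x) v", OF _ yd_semilinear_action[OF assms(1)]]
    assms by simp

lemma semilinear_act_right:
  assumes "linear_structure V" "semilinear b X V f" "a \<in> carrier A"
  shows "semilinear b X V (\<lambda>x. act V a (f x))"
  unfolding act_def
  using semilinear_comp[of b X "tensor A V" "\<lambda>x. pure A V a (f x)", OF _ yd_semilinear_action[OF assms(1)]]
    assms by simp

lemma semilinear_coaction_comp:
  assumes "linear_structure V" "semilinear b X V f"
  shows "semilinear b X (tensor A V) (\<lambda>x. coaction V (f x))"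
  using semilinear_comp[OF assms(2) yd_semilinear_coaction[OF assms(1)]] assms by simp

lemma semilinear_involution_comp:
  assumes "linear_structure V" "semilinear (\<not> b) X V f"
  shows "semilinear b X V (\<lambda>x. involution V (f x))"
  using semilinear_comp[OF assms(2) yd_semilinear_involution[OF assms(1)]] assms by simp

lemma act_closed:
  "\<lbrakk>linear_structure V; a \<in> carrier A; v \<in> carrier V\<rbrakk> \<Longrightarrow> act V a v \<in> carrier V"
  by (rule semilinear_closed[OF semilinear_act_left[where b = False and f = "\<lambda>x. x"]]) auto

lemma coaction_closed: "\<lbrakk>linear_structure V; v \<in> carrier V\<rbrakk> \<Longrightarrow> coaction V v \<in> carrier (tensor A V)"
  by (rule semilinear_closed[OF yd_semilinear_coaction])

lemma involution_closed: "\<lbrakk>linear_structure V; v \<in> carrier V\<rbrakk> \<Longrightarrow> involution V v \<in> carrier V"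
  by (rule semilinear_closed[OF yd_semilinear_involution])

lemmas yd_rules [simp] =
  yd_semilinear_action yd_semilinear_coaction yd_semilinear_involution
  semilinear_act_left semilinear_act_right semilinear_coaction_comp semilinear_involution_comp
  act_closed coaction_closed involution_closed act_def[symmetric]

lemma action_tsum [simp]:
  assumes "linear_structure V" "\<forall>y \<in> carrier Y. \<forall>z \<in> carrier Z. B y z \<in> carrier (tensor A V)"
  shows "action V (tsum Y Z (tensor A V) B t) = tsum Y Z V (\<lambda>y z. action V (B y z)) t"
  using assms by (intro tsum_map[OF yd_semilinear_action]) auto

lemma act_tsum_left [simp]:
  assumes "linear_structure V" "v \<in> carrier V" "\<forall>y \<in> carrier Y. \<forall>z \<in> carrier Z. B y z \<in> carrier A"
  shows "act V (tsum Y Z A B t) v = tsum Y Z V (\<lambda>y z. act V (B y z) v) t"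
  using assms by (intro tsum_map[of False A V "\<lambda>x. act V x v"]) auto

lemma involution_tsum [simp]:
  assumes "linear_structure V" "\<forall>y \<in> carrier Y. \<forall>z \<in> carrier Z. B y z \<in> carrier V"
  shows "involution V (tsum Y Z V B t) = tsum Y Z V (\<lambda>y z. involution V (B y z)) t"
  using assms by (intro tsum_map[OF yd_semilinear_involution]) auto

lemma tensor_map_coaction [simp]:
  "\<lbrakk>linear_structure V; v \<in> carrier V\<rbrakk> \<Longrightarrow> tensor_map V' W' f g (coaction V v)
    = tsum A V (tensor V' W') (\<lambda>a b. pure V' W' (f a) (g b)) (coaction V v)"
  by (rule tensor_map_eq_tsum) auto

lemma act_mult [simp]:
  assumes V: "V \<in> yd_obj A" and "a \<in> carrier A" "b \<in> carrier A" "v \<in> carrier V"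
  shows "act V (a \<otimes> b) v = act V a (act V b v)"
proof -
  have "\<forall>x \<in> carrier (tensor (tensor A A) V).
      action V (tensor_map A V (mult_map A) id x) = action V (tensor_map A V id (action V) (assoc A A V x))"
    using yd_left_action[OF V] unfolding left_action_def by blast
  moreover have "pure (tensor A A) V (pure A A a b) v \<in> carrier (tensor (tensor A A) V)"
    using assms by simp
  ultimately have "action V (tensor_map A V (mult_map A) id (pure (tensor A A) V (pure A A a b) v))
    = action V (tensor_map A V id (action V) (assoc A A V (pure (tensor A A) V (pure A A a b) v)))"
    by (rule bspec)
  then show ?thesis using assms by simp
qed

lemma act_one [simp]: "\<lbrakk>V \<in> yd_obj A; v \<in> carrier V\<rbrakk> \<Longrightarrow> act V \<one> v = v"
  unfolding act_def by (drule yd_left_action) (simp only: left_action_def)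

lemma act_smult [simp]:
  "\<lbrakk>linear_structure V; a \<in> carrier A; v \<in> carrier V\<rbrakk> \<Longrightarrow> act V (c \<odot> a) v = c \<odot>\<^bsub>V\<^esub> act V a v"
  using semilinear_smult[of False A V "\<lambda>a. act V a v" a c] by simp

text \<open>Same device as \<open>coassoc_tsum\<close>: both sides are images, under the map induced
  by \<open>B\<close>, of the two members of the coaction axiom. It exchanges an iterated coaction
  for the coproduct of the first leg.\<close>

lemma coaction_coassoc_tsum:
  assumes V: "V \<in> yd_obj A" and v: "v \<in> carrier V" and X: "vector_space_C X"
    and "\<forall>x \<in> carrier A. \<forall>y \<in> carrier A. semilinear b V X (\<lambda>z. B x y z)"
    and "\<forall>x \<in> carrier A. \<forall>z \<in> carrier V. semilinear b A X (\<lambda>y. B x y z)"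
    and "\<forall>y \<in> carrier A. \<forall>z \<in> carrier V. semilinear b A X (\<lambda>x. B x y z)"
  shows "tsum A V X (\<lambda>a v0. tsum A V X (\<lambda>b v1. B a b v1) (coaction V v0)) (coaction V v)
    = tsum A V X (\<lambda>a v0. tsum A A X (\<lambda>a1 a2. B a1 a2 v0) (coprod A a)) (coaction V v)"
proof -
  let ?F = "tsum A (tensor A V) X (\<lambda>a s. tsum A V X (\<lambda>b c. B a b c) s)"
  have closed: "\<forall>x \<in> carrier A. \<forall>y \<in> carrier A. \<forall>z \<in> carrier V. B x y z \<in> carrier X"
    using assms(4) by (meson semilinear_closed)
  have coassoc: "tensor_map A (tensor A V) id (coaction V) (coaction V v)
      = assoc A A V (tensor_map (tensor A A) V (coprod A) id (coaction V v))"
    using yd_left_coaction[OF V] v unfolding left_coaction_def by metis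
  have "tsum A V X (\<lambda>a v0. tsum A V X (\<lambda>b v1. B a b v1) (coaction V v0)) (coaction V v)
    = ?F (tensor_map A (tensor A V) id (coaction V) (coaction V v))"
    using assms closed by (cases b) simp_all
  also have "\<dots> = ?F (assoc A A V (tensor_map (tensor A A) V (coprod A) id (coaction V v)))"
    by (simp only: coassoc)
  also have "\<dots> = tsum A V X (\<lambda>a v0. tsum A A X (\<lambda>a1 a2. B a1 a2 v0) (coprod A a)) (coaction V v)"
    using assms closed by (cases b) simp_all
  finally show ?thesis .
qed

lemma coaction_counit_tsum:
  assumes V: "V \<in> yd_obj A" and v: "v \<in> carrier V" and X: "vector_space_C X"
    and g: "semilinear False V X g"
  shows "tsum A V X (\<lambda>a u. counit A a \<odot>\<^bsub>X\<^esub> g u) (coaction V v) = g v"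
proof -
  have "lift V (\<lambda>a u. counit A a \<odot>\<^bsub>V\<^esub> u) (coaction V v) = v"
    using yd_left_coaction[OF V] v unfolding left_coaction_def by metis
  then have "g v = g (tsum A V V (\<lambda>a u. counit A a \<odot>\<^bsub>V\<^esub> u) (coaction V v))"
    using V v by (simp add: lift_eq_tsum[where V = A and W = V])
  also have "\<dots> = tsum A V X (\<lambda>a u. g (counit A a \<odot>\<^bsub>V\<^esub> u)) (coaction V v)"
    using assms by (intro tsum_map[OF g]) auto
  also have "\<dots> = tsum A V X (\<lambda>a u. counit A a \<odot>\<^bsub>X\<^esub> g u) (coaction V v)"
    using semilinear_smult[OF g] by (intro tsum_cong) auto
  finally show ?thesis ..
qed

lemma yd_compat_pure:
  assumes V: "V \<in> yd_obj A" and a: "a \<in> carrier A" and v: "v \<in> carrier V"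
  shows "tsum A A (tensor A V) (\<lambda>a1 a2. tsum A V (tensor A V)
      (\<lambda>b u. pure A V (a1 \<otimes> b) (act V a2 u)) (coaction V v)) (coprod A a)
    = tsum A A (tensor A V) (\<lambda>a1 a2. tsum A V (tensor A V)
      (\<lambda>b u. pure A V (b \<otimes> a2) u) (coaction V (act V a1 v))) (coprod A a)"
proof -
  have "\<forall>x \<in> carrier (tensor A V).
          (tensor_map A V (mult_map A) (action V)
             \<circ> swap_mid A A A V
             \<circ> tensor_map (tensor A A) (tensor A V) (coprod A) (coaction V)) x
          = (tensor_map A V (mult_map A) id
             \<circ> swap_last A V A
             \<circ> tensor_map (tensor A V) A (coaction V) id
             \<circ> tensor_map V A (action V) id
             \<circ> swap_last A A V
             \<circ> tensor_map (tensor A A) V (coprod A) id) x"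
    using V unfolding yd_obj_def by blast
  from bspec[OF this, of "pure A V a v"] V a v
  have "tsum A V (tensor A V) (\<lambda>b u. tsum A A (tensor A V)
      (\<lambda>a1 a2. pure A V (a1 \<otimes> b) (act V a2 u)) (coprod A a)) (coaction V v)
    = tsum A A (tensor A V) (\<lambda>a1 a2. tsum A V (tensor A V)
      (\<lambda>b u. pure A V (b \<otimes> a2) u) (coaction V (act V a1 v))) (coprod A a)"
    by simp
  then show ?thesis using V a v by (subst tsum_commute) auto
qed

text \<open>Condition (a) pushed through a bilinear \<open>B\<close>, so that it can be used where
  the two legs are consumed by further actions or products.\<close>

lemma yd_compat_tsum:
  assumes V: "V \<in> yd_obj A" and a: "a \<in> carrier A" and v: "v \<in> carrier V"
    and X: "vector_space_C X"
    and B: "\<forall>x \<in> carrier A. semilinear False V X (\<lambda>z. B x z)"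
      "\<forall>z \<in> carrier V. semilinear False A X (\<lambda>x. B x z)"
  shows "tsum A A X (\<lambda>a1 a2. tsum A V X
      (\<lambda>b u. B (a1 \<otimes> b) (act V a2 u)) (coaction V v)) (coprod A a)
    = tsum A A X (\<lambda>a1 a2. tsum A V X
      (\<lambda>b u. B (b \<otimes> a2) u) (coaction V (act V a1 v))) (coprod A a)"
proof -
  have closed: "\<forall>x \<in> carrier A. \<forall>z \<in> carrier V. B x z \<in> carrier X"
    using B by (meson semilinear_closed)
  have "tsum A V X B (tsum A A (tensor A V) (\<lambda>a1 a2. tsum A V (tensor A V)
      (\<lambda>b u. pure A V (a1 \<otimes> b) (act V a2 u)) (coaction V v)) (coprod A a))
    = tsum A A X (\<lambda>a1 a2. tsum A V X
      (\<lambda>b u. B (a1 \<otimes> b) (act V a2 u)) (coaction V v)) (coprod A a)"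
    using assms closed by simp
  moreover have "tsum A V X B (tsum A A (tensor A V) (\<lambda>a1 a2. tsum A V (tensor A V)
      (\<lambda>b u. pure A V (b \<otimes> a2) u) (coaction V (act V a1 v))) (coprod A a))
    = tsum A A X (\<lambda>a1 a2. tsum A V X
      (\<lambda>b u. B (b \<otimes> a2) u) (coaction V (act V a1 v))) (coprod A a)"
    using assms closed by simp
  ultimately show ?thesis by (simp only: yd_compat_pure[OF V a v])
qed

lemma involution_act:
  assumes V: "V \<in> yd_obj A" and a: "a \<in> carrier A" and v: "v \<in> carrier V"
  shows "involution V (act V a v) = act V (star A (antipode A a)) (involution V v)"
proof -
  have "\<forall>x \<in> carrier (tensor A V).
          (involution V \<circ> action V) x
          = (action V
             \<circ> tensor_map A V (star A) (involution V)
             \<circ> tensor_map A V (antipode A) id) x"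
    using V unfolding yd_obj_def by blast
  from bspec[OF this, of "pure A V a v"] V a v show ?thesis by simp
qed

lemma coaction_involution:
  assumes V: "V \<in> yd_obj A" and v: "v \<in> carrier V"
  shows "coaction V (involution V v) = tsum A V (tensor A V)
    (\<lambda>b u. pure A V (star A b) (involution V u)) (coaction V v)"
proof -
  have "\<forall>v \<in> carrier V.
          (coaction V \<circ> involution V) v
          = (tensor_map A V (star A) (involution V) \<circ> coaction V) v"
    using V unfolding yd_obj_def by blast
  from bspec[OF this v] V v show ?thesis by simp
qed


section \<open>Structure maps of tensor products\<close>

lemma semilinear_o:
  "semilinear b V W f \<Longrightarrow> semilinear False W X g \<Longrightarrow> semilinear b V X (g \<circ> f)"
  "semilinear False V W f \<Longrightarrow> semilinear b W X g \<Longrightarrow> semilinear b V X (g \<circ> f)"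
  by (simp_all add: semilinear_def)

lemma semilinear_braid [simp]:
  assumes "linear_structure V" "linear_structure W"
  shows "semilinear False (tensor V W) (tensor W V) (yd_braid A V W)"
proof -
  have "semilinear False (tensor V W) (tensor (tensor A V) W)
      (tensor_map (tensor A V) W (coaction V) id)"
    "semilinear False (tensor (tensor A V) W) (tensor (tensor A W) V) (swap_last A V W)"
    "semilinear False (tensor (tensor A W) V) (tensor W V) (tensor_map W V (action W) id)"
    using assms by simp_all
  then show ?thesis
    unfolding yd_braid_def by (blast intro: semilinear_o)
qed

lemma semilinear_braid_comp [simp]:
  assumes "linear_structure V" "linear_structure W" "semilinear b X (tensor V W) f"
  shows "semilinear b X (tensor W V) (\<lambda>x. yd_braid A V W (f x))"
  using semilinear_comp[OF assms(3) semilinear_braid[OF assms(1,2)]] by simp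

lemma braid_closed [simp]:
  assumes "linear_structure V" "linear_structure W" "t \<in> carrier (tensor V W)"
  shows "yd_braid A V W t \<in> carrier (tensor W V)"
  by (rule semilinear_closed[OF semilinear_braid[OF assms(1,2)] assms(3)])

lemma braid_pure [simp]:
  assumes "linear_structure V" "linear_structure W" "v \<in> carrier V" "w \<in> carrier W"
  shows "yd_braid A V W (pure V W v w)
    = tsum A V (tensor W V) (\<lambda>a v0. pure W V (act W a w) v0) (coaction V v)"
  using assms by (simp add: yd_braid_def)

lemma braid_tsum [simp]:
  assumes "linear_structure V" "linear_structure W"
    "\<forall>y \<in> carrier Y. \<forall>z \<in> carrier Z. B y z \<in> carrier (tensor V W)"
  shows "yd_braid A V W (tsum Y Z (tensor V W) B t)
    = tsum Y Z (tensor W V) (\<lambda>y z. yd_braid A V W (B y z)) t"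
  using assms by (intro tsum_map[OF semilinear_braid]) auto

section \<open>Action, coaction and involution of V \<otimes> W in Sweedler form\<close>

lemma yd_tensor_sel:
  "action (yd_tensor A V W) = tensor_map V W (action V) (action W)
     \<circ> swap_mid A A V W \<circ> tensor_map (tensor A A) (tensor V W) (coprod A) id"
  "coaction (yd_tensor A V W) = tensor_map A (tensor V W) (mult_map A) id
     \<circ> swap_mid A V A W \<circ> tensor_map (tensor A V) (tensor A W) (coaction V) (coaction W)"
  "involution (yd_tensor A V W) = yd_braid A W V
     \<circ> tensor_map W V (involution W) (involution V) \<circ> flip V W"
  by (simp_all add: yd_tensor_def module.defs star_bimodule.defs)

lemma linear_structure_yd_tensor [simp]:
  assumes "linear_structure V" "linear_structure W"
  shows "linear_structure (yd_tensor A V W)"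
proof -
  have "semilinear False (tensor A (tensor V W)) (tensor (tensor A A) (tensor V W))
      (tensor_map (tensor A A) (tensor V W) (coprod A) id)"
    "semilinear False (tensor (tensor A A) (tensor V W)) (tensor (tensor A V) (tensor A W))
      (swap_mid A A V W)"
    "semilinear False (tensor (tensor A V) (tensor A W)) (tensor V W)
      (tensor_map V W (action V) (action W))"
    using assms by simp_all
  then have action: "semilinear False (tensor A (tensor V W)) (tensor V W) (action (yd_tensor A V W))"
    unfolding yd_tensor_sel by (blast intro: semilinear_o)
  have "semilinear False (tensor V W) (tensor (tensor A V) (tensor A W))
      (tensor_map (tensor A V) (tensor A W) (coaction V) (coaction W))"
    "semilinear False (tensor (tensor A V) (tensor A W)) (tensor (tensor A A) (tensor V W))
      (swap_mid A V A W)"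
    "semilinear False (tensor (tensor A A) (tensor V W)) (tensor A (tensor V W))
      (tensor_map A (tensor V W) (mult_map A) id)"
    using assms by simp_all
  then have coaction: "semilinear False (tensor V W) (tensor A (tensor V W)) (coaction (yd_tensor A V W))"
    unfolding yd_tensor_sel by (blast intro: semilinear_o)
  have "semilinear False (tensor V W) (tensor W V) (flip V W)"
    "semilinear True (tensor W V) (tensor W V) (tensor_map W V (involution W) (involution V))"
    "semilinear False (tensor W V) (tensor V W) (yd_braid A W V)"
    using assms by simp_all
  then have involution: "semilinear True (tensor V W) (tensor V W) (involution (yd_tensor A V W))"
    unfolding yd_tensor_sel by (blast intro: semilinear_o)
  show ?thesis
    unfolding linear_structure_def using action coaction involution assms by simp
qed

lemma act_yd_tensor [simp]:
  assumes "linear_structure V" "linear_structure W" "a \<in> carrier A" "t \<in> carrier (tensor V W)"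
  shows "act (yd_tensor A V W) a t = tsum A A (tensor V W)
    (\<lambda>a1 a2. tsum V W (tensor V W) (\<lambda>v w. pure V W (act V a1 v) (act W a2 w)) t) (coprod A a)"
  using assms unfolding act_def yd_tensor_sel
  by (subst tsum_commute) (auto simp: act_def[symmetric])

lemma coaction_yd_tensor [simp]:
  assumes "linear_structure V" "linear_structure W" "t \<in> carrier (tensor V W)"
  shows "coaction (yd_tensor A V W) t = tsum V W (tensor A (tensor V W))
    (\<lambda>v w. tsum A V (tensor A (tensor V W)) (\<lambda>a v0. tsum A W (tensor A (tensor V W))
      (\<lambda>b w0. pure A (tensor V W) (a \<otimes> b) (pure V W v0 w0)) (coaction W w)) (coaction V v)) t"
proof -
  have "coaction (yd_tensor A V W) t = tsum V W (tensor A (tensor V W))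
    (\<lambda>v w. tsum A W (tensor A (tensor V W)) (\<lambda>b w0. tsum A V (tensor A (tensor V W))
      (\<lambda>a v0. pure A (tensor V W) (a \<otimes> b) (pure V W v0 w0)) (coaction V v)) (coaction W w)) t"
    using assms
    by (simp add: yd_tensor_sel tensor_map_eq_tsum[where V = V and W = W and t = t])
  also have "\<dots> = tsum V W (tensor A (tensor V W))
    (\<lambda>v w. tsum A V (tensor A (tensor V W)) (\<lambda>a v0. tsum A W (tensor A (tensor V W))
      (\<lambda>b w0. pure A (tensor V W) (a \<otimes> b) (pure V W v0 w0)) (coaction W w)) (coaction V v)) t"
    using assms by (intro tsum_cong refl tsum_commute) auto
  finally show ?thesis .
qed

lemma involution_yd_tensor:
  assumes "linear_structure V" "linear_structure W" "v \<in> carrier V" "w \<in> carrier W"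
  shows "involution (yd_tensor A V W) (pure V W v w)
    = yd_braid A W V (pure W V (involution W w) (involution V v))"
  using assms by (simp add: yd_tensor_sel del: braid_pure)

text \<open>
  The carrier of \<open>yd_tensor A V W\<close> is simplified to that of \<open>tensor V W\<close>, so that
  the rules for a general object do not apply to it.
\<close>

lemma
  assumes "linear_structure V" "linear_structure W"
  shows semilinear_act_yd_tensor_left [simp]: "\<lbrakk>semilinear b X A f; t \<in> carrier (tensor V W)\<rbrakk>
      \<Longrightarrow> semilinear b X (tensor V W) (\<lambda>x. act (yd_tensor A V W) (f x) t)"
    and semilinear_act_yd_tensor_right [simp]: "\<lbrakk>semilinear b X (tensor V W) g; a \<in> carrier A\<rbrakk>
      \<Longrightarrow> semilinear b X (tensor V W) (\<lambda>x. act (yd_tensor A V W) a (g x))"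
    and semilinear_coaction_yd_tensor [simp]: "semilinear b X (tensor V W) g
      \<Longrightarrow> semilinear b X (tensor A (tensor V W)) (\<lambda>x. coaction (yd_tensor A V W) (g x))"
    and semilinear_involution_yd_tensor [simp]: "semilinear (\<not> b) X (tensor V W) g
      \<Longrightarrow> semilinear b X (tensor V W) (\<lambda>x. involution (yd_tensor A V W) (g x))"
    and act_yd_tensor_closed: "\<lbrakk>a \<in> carrier A; t \<in> carrier (tensor V W)\<rbrakk>
      \<Longrightarrow> act (yd_tensor A V W) a t \<in> carrier (tensor V W)"
    and involution_yd_tensor_closed [simp]: "t \<in> carrier (tensor V W)
      \<Longrightarrow> involution (yd_tensor A V W) t \<in> carrier (tensor V W)"
  using semilinear_act_left[of "yd_tensor A V W" b X f t] semilinear_act_right[of "yd_tensor A V W" b X g a]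
    semilinear_coaction_comp[of "yd_tensor A V W" b X g]
    semilinear_involution_comp[of "yd_tensor A V W" b X g]
    act_closed[of "yd_tensor A V W" a t] involution_closed[of "yd_tensor A V W" t] assms
  by (simp_all del: act_yd_tensor)

lemma involution_yd_tensor_tsum [simp]:
  assumes "linear_structure V" "linear_structure W"
    "\<forall>y \<in> carrier Y. \<forall>z \<in> carrier Z. B y z \<in> carrier (tensor V W)"
  shows "involution (yd_tensor A V W) (tsum Y Z (tensor V W) B t)
    = tsum Y Z (tensor V W) (\<lambda>y z. involution (yd_tensor A V W) (B y z)) t"
  using assms by (intro tsum_map[of True "tensor V W"]) auto

text \<open>A recipe for objects with all axioms in Sweedler form on pure tensors. The proof returns
  to the original formulation by expanding every tensor into pure ones; both sides of each axiom are
  compatible with such sums.\<close>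

lemma yd_objI:
  assumes lin: "linear_structure V"
    and involution: "\<And>v. v \<in> carrier V \<Longrightarrow> involution V (involution V v) = v"
    and act_mult: "\<And>a b v. \<lbrakk>a \<in> carrier A; b \<in> carrier A; v \<in> carrier V\<rbrakk>
      \<Longrightarrow> act V (a \<otimes> b) v = act V a (act V b v)"
    and act_one: "\<And>v. v \<in> carrier V \<Longrightarrow> act V \<one> v = v"
    and coassoc: "\<And>v. v \<in> carrier V \<Longrightarrow>
      tsum A V (tensor A (tensor A V)) (\<lambda>a v0. tsum A A (tensor A (tensor A V))
        (\<lambda>a1 a2. pure A (tensor A V) a1 (pure A V a2 v0)) (coprod A a)) (coaction V v)
      = tsum A V (tensor A (tensor A V)) (\<lambda>a v0. pure A (tensor A V) a (coaction V v0)) (coaction V v)"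
    and counit: "\<And>v. v \<in> carrier V \<Longrightarrow>
      tsum A V V (\<lambda>a u. counit A a \<odot>\<^bsub>V\<^esub> u) (coaction V v) = v"
    and compat: "\<And>a v. \<lbrakk>a \<in> carrier A; v \<in> carrier V\<rbrakk> \<Longrightarrow>
      tsum A A (tensor A V) (\<lambda>a1 a2. tsum A V (tensor A V)
        (\<lambda>b u. pure A V (a1 \<otimes> b) (act V a2 u)) (coaction V v)) (coprod A a)
      = tsum A A (tensor A V) (\<lambda>a1 a2. tsum A V (tensor A V)
        (\<lambda>b u. pure A V (b \<otimes> a2) u) (coaction V (act V a1 v))) (coprod A a)"
    and involution_act: "\<And>a v. \<lbrakk>a \<in> carrier A; v \<in> carrier V\<rbrakk> \<Longrightarrow>
      involution V (act V a v) = act V (star A (antipode A a)) (involution V v)"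
    and coaction_involution: "\<And>v. v \<in> carrier V \<Longrightarrow> coaction V (involution V v)
      = tsum A V (tensor A V) (\<lambda>b u. pure A V (star A b) (involution V u)) (coaction V v)"
  shows "V \<in> yd_obj A"
proof -
  have ident: "x = tsum A V (tensor A V) (pure A V) x" if "x \<in> carrier (tensor A V)" for x
    using that lin by (simp add: tsum_ident)
  have "\<forall>x \<in> carrier (tensor (tensor A A) V).
      action V (tensor_map A V (mult_map A) id x) = action V (tensor_map A V id (action V) (assoc A A V x))"
  proof
    fix x assume x: "x \<in> carrier (tensor (tensor A A) V)"
    \<comment> \<open>\<open>x\<close> with both layers of the tensor product expanded. A separate
      name is needed because the equation \<open>x = y\<close> has \<open>x\<close> on its
      right-hand side as well and would rewrite forever.\<close>
    define y where "y = tsum (tensor A A) V (tensor (tensor A A) V)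
        (\<lambda>s v. tsum A A (tensor (tensor A A) V) (\<lambda>a b. pure (tensor A A) V (pure A A a b) v) s) x"
    have "x = tsum (tensor A A) V (tensor (tensor A A) V) (pure (tensor A A) V) x"
      using x lin by (simp add: tsum_ident)
    also have "\<dots> = tsum (tensor A A) V (tensor (tensor A A) V)
        (\<lambda>s v. pure (tensor A A) V (tsum A A (tensor A A) (pure A A) s) v) x"
      by (intro tsum_cong) (auto simp: tsum_ident)
    also have "\<dots> = y"
      unfolding y_def using lin by (intro tsum_cong) auto
    finally have "x = y" .
    moreover have "action V (tensor_map A V (mult_map A) id y)
        = action V (tensor_map A V id (action V) (assoc A A V y))"
      unfolding y_def using lin by (simp add: act_mult)
    ultimately show "action V (tensor_map A V (mult_map A) id x)
        = action V (tensor_map A V id (action V) (assoc A A V x))" by simp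
  qed
  moreover have "\<forall>v \<in> carrier V. action V (pure A V \<one> v) = v"
    using act_one unfolding act_def by blast
  ultimately have "left_action A V (action V)"
    using lin unfolding left_action_def linear_map_iff_semilinear linear_structure_def by blast
  moreover have "left_coaction A V (coaction V)"
    unfolding left_coaction_def linear_map_iff_semilinear
    using lin coassoc counit by (simp add: lift_eq_tsum[where V = A and W = V])
  moreover have "\<forall>x \<in> carrier (tensor A V).
          (tensor_map A V (mult_map A) (action V)
             \<circ> swap_mid A A A V
             \<circ> tensor_map (tensor A A) (tensor A V) (coprod A) (coaction V)) x
          = (tensor_map A V (mult_map A) id
             \<circ> swap_last A V A
             \<circ> tensor_map (tensor A V) A (coaction V) id
             \<circ> tensor_map V A (action V) id
             \<circ> swap_last A A V
             \<circ> tensor_map (tensor A A) V (coprod A) id) x" (is "\<forall>x \<in> _. ?l x = ?r x")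
  proof
    fix x assume x: "x \<in> carrier (tensor A V)"
    have commute: "tsum A V (tensor A V) (\<lambda>b u. tsum A A (tensor A V)
        (\<lambda>a1 a2. pure A V (a1 \<otimes> b) (act V a2 u)) (coprod A a)) (coaction V v)
      = tsum A A (tensor A V) (\<lambda>a1 a2. tsum A V (tensor A V)
        (\<lambda>b u. pure A V (a1 \<otimes> b) (act V a2 u)) (coaction V v)) (coprod A a)"
      if "a \<in> carrier A" "v \<in> carrier V" for a v
      using that lin by (intro tsum_commute) auto
    have "?l (tsum A V (tensor A V) (pure A V) x) = ?r (tsum A V (tensor A V) (pure A V) x)"
      using lin by (simp add: commute compat)
    then show "?l x = ?r x" using ident[OF x] by simp
  qed
  moreover have "\<forall>x \<in> carrier (tensor A V).
          (involution V \<circ> action V) x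
          = (action V
             \<circ> tensor_map A V (star A) (involution V)
             \<circ> tensor_map A V (antipode A) id) x" (is "\<forall>x \<in> _. ?l x = ?r x")
  proof
    fix x assume x: "x \<in> carrier (tensor A V)"
    have "?l (tsum A V (tensor A V) (pure A V) x) = ?r (tsum A V (tensor A V) (pure A V) x)"
      using lin by (simp add: involution_act)
    then show "?l x = ?r x" using ident[OF x] by simp
  qed
  moreover have "\<forall>v \<in> carrier V.
          (coaction V \<circ> involution V) v
          = (tensor_map A V (star A) (involution V) \<circ> coaction V) v"
    using lin by (simp add: coaction_involution)
  ultimately show ?thesis
    using lin involution
    unfolding yd_obj_def conjugation_iff_semilinear linear_structure_def by blast
qed


section \<open>The braiding commutes with actions and coactions\<close>

text \<open>On v \<otimes> w the two sides are (a1 v)_(-1) a2 w \<otimes> (a1 v)_(0) and a1 v_(-1) w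
  \<otimes> a2 v_(0): precisely condition (a) for V, with the algebra leg acting on w.\<close>

lemma braid_act:
  assumes V: "V \<in> yd_obj A" and W: "W \<in> yd_obj A" and a: "a \<in> carrier A"
    and t: "t \<in> carrier (tensor V W)"
  shows "yd_braid A V W (act (yd_tensor A V W) a t) = act (yd_tensor A W V) a (yd_braid A V W t)"
proof (rule semilinear_tensor_eqI[OF t, where b = False and b' = False and X = "tensor W V"])
  fix v w assume v: "v \<in> carrier V" and w: "w \<in> carrier W"
  let ?X = "tensor W V"
  have "yd_braid A V W (act (yd_tensor A V W) a (pure V W v w))
    = tsum A A ?X (\<lambda>a1 a2. tsum A V ?X
        (\<lambda>b u. pure W V (act W b (act W a2 w)) u) (coaction V (act V a1 v))) (coprod A a)"
    using V W a v w by simp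
  also have "\<dots> = tsum A A ?X (\<lambda>a1 a2. tsum A V ?X
        (\<lambda>b u. pure W V (act W a1 (act W b w)) (act V a2 u)) (coaction V v)) (coprod A a)"
    using yd_compat_tsum[of V a v ?X "\<lambda>x u. pure W V (act W x w) u"] V W a v w by simp
  also have "\<dots> = tsum A V ?X (\<lambda>b u. tsum A A ?X
        (\<lambda>a1 a2. pure W V (act W a1 (act W b w)) (act V a2 u)) (coprod A a)) (coaction V v)"
    using V W a v w by (intro tsum_commute) auto
  also have "\<dots> = act (yd_tensor A W V) a (yd_braid A V W (pure V W v w))"
    using V W a v w by (subst tsum_commute) auto
  finally show "yd_braid A V W (act (yd_tensor A V W) a (pure V W v w))
    = act (yd_tensor A W V) a (yd_braid A V W (pure V W v w))" .
qed (use V W a in simp_all)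

text \<open>The roles are dual to those in \<open>braid_act\<close>: condition (a) is now used for
  W, with v_(-1) as the acting element, and coassociativity of the coaction of V before and after
  it.\<close>

lemma braid_coaction:
  assumes V: "V \<in> yd_obj A" and W: "W \<in> yd_obj A" and t: "t \<in> carrier (tensor V W)"
  shows "coaction (yd_tensor A W V) (yd_braid A V W t)
    = tsum A (tensor V W) (tensor A (tensor W V))
        (\<lambda>a u. pure A (tensor W V) a (yd_braid A V W u)) (coaction (yd_tensor A V W) t)"
proof (rule semilinear_tensor_eqI[OF t, where b = False and b' = False and X = "tensor A (tensor W V)"])
  fix v w assume v: "v \<in> carrier V" and w: "w \<in> carrier W"
  let ?X = "tensor A (tensor W V)"
  have "coaction (yd_tensor A W V) (yd_braid A V W (pure V W v w))
    = tsum A V ?X (\<lambda>a v0. tsum A W ?X (\<lambda>c w'. tsum A V ?X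
        (\<lambda>b v1. pure A (tensor W V) (c \<otimes> b) (pure W V w' v1)) (coaction V v0))
          (coaction W (act W a w))) (coaction V v)"
    using V W v w by simp
  also have "\<dots> = tsum A V ?X (\<lambda>a v0. tsum A V ?X (\<lambda>b v1. tsum A W ?X
        (\<lambda>c w'. pure A (tensor W V) (c \<otimes> b) (pure W V w' v1)) (coaction W (act W a w)))
          (coaction V v0)) (coaction V v)"
    using V W v w by (intro tsum_cong refl tsum_commute) auto
  \<comment> \<open>The two successive coactions on v become the coproduct of v_(-1), which is the
    shape that condition (a) for W requires.\<close>
  also have "\<dots> = tsum A V ?X (\<lambda>a v0. tsum A A ?X (\<lambda>a1 a2. tsum A W ?X
        (\<lambda>c w'. pure A (tensor W V) (c \<otimes> a2) (pure W V w' v0)) (coaction W (act W a1 w)))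
          (coprod A a)) (coaction V v)"
    using V W v w by (intro coaction_coassoc_tsum[where b = False]) auto
  \<comment> \<open>Condition (a) for W, from right to left: the factor a2 behind the coaction of a1
    w turns into a1 in front of it, with a2 acting on the remaining leg.\<close>
  also have "\<dots> = tsum A V ?X (\<lambda>a v0. tsum A A ?X (\<lambda>a1 a2. tsum A W ?X
        (\<lambda>c w'. pure A (tensor W V) (a1 \<otimes> c) (pure W V (act W a2 w') v0)) (coaction W w))
          (coprod A a)) (coaction V v)"
    using V W v w by (intro tsum_cong refl
      yd_compat_tsum[symmetric, where B = "\<lambda>x u. pure A (tensor W V) x (pure W V u _)"]) auto
  also have "\<dots> = tsum A V ?X (\<lambda>a v0. tsum A V ?X (\<lambda>b v1. tsum A W ?X
        (\<lambda>c w'. pure A (tensor W V) (a \<otimes> c) (pure W V (act W b w') v1)) (coaction W w))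
          (coaction V v0)) (coaction V v)"
    using V W v w by (intro coaction_coassoc_tsum[symmetric, where b = False]) auto
  also have "\<dots> = tsum A V ?X (\<lambda>a v0. tsum A W ?X (\<lambda>c w'. tsum A V ?X
        (\<lambda>b v1. pure A (tensor W V) (a \<otimes> c) (pure W V (act W b w') v1)) (coaction V v0))
          (coaction W w)) (coaction V v)"
    using V W v w by (intro tsum_cong refl tsum_commute) auto
  also have "\<dots> = tsum A (tensor V W) ?X
        (\<lambda>a u. pure A (tensor W V) a (yd_braid A V W u)) (coaction (yd_tensor A V W) (pure V W v w))"
    using V W v w by simp
  finally show "coaction (yd_tensor A W V) (yd_braid A V W (pure V W v w))
    = tsum A (tensor V W) ?X
        (\<lambda>a u. pure A (tensor W V) a (yd_braid A V W u)) (coaction (yd_tensor A V W) (pure V W v w))" .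
qed (use V W in simp_all)


section \<open>The tensor product of two objects\<close>

lemma act_yd_tensor_mult:
  assumes V: "V \<in> yd_obj A" and W: "W \<in> yd_obj A" and a: "a \<in> carrier A" and b: "b \<in> carrier A"
    and t: "t \<in> carrier (tensor V W)"
  shows "act (yd_tensor A V W) (a \<otimes> b) t = act (yd_tensor A V W) a (act (yd_tensor A V W) b t)"
proof (rule semilinear_tensor_eqI[OF t, where b = False and b' = False and X = "tensor V W"])
  fix v w assume v: "v \<in> carrier V" and w: "w \<in> carrier W"
  show "act (yd_tensor A V W) (a \<otimes> b) (pure V W v w)
    = act (yd_tensor A V W) a (act (yd_tensor A V W) b (pure V W v w))"
    using V W a b v w by (simp add: coprod_mult_tsum)
qed (use V W a b in simp_all)

lemma act_yd_tensor_one: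
  assumes V: "V \<in> yd_obj A" and W: "W \<in> yd_obj A" and t: "t \<in> carrier (tensor V W)"
  shows "act (yd_tensor A V W) \<one> t = t"
  using V W t by (simp add: coprod_one tsum_ident)

text \<open>The sums over V and over W are separated, each factor uses its own coassociativity, and
  multiplicativity of \<Delta> recombines the legs a1 b1 and a2 b2 into the coproduct of a
  b.\<close>

lemma coaction_yd_tensor_coassoc:
  assumes V: "V \<in> yd_obj A" and W: "W \<in> yd_obj A" and t: "t \<in> carrier (tensor V W)"
  defines "U \<equiv> yd_tensor A V W"
  shows "tsum A U (tensor A (tensor A U)) (\<lambda>a u. tsum A A (tensor A (tensor A U))
        (\<lambda>a1 a2. pure A (tensor A U) a1 (pure A U a2 u)) (coprod A a)) (coaction U t)
      = tsum A U (tensor A (tensor A U)) (\<lambda>a u. pure A (tensor A U) a (coaction U u)) (coaction U t)"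
    (is "?l t = ?r t")
proof (rule semilinear_tensor_eqI[OF t, where b = False and b' = False
      and X = "tensor A (tensor A (tensor V W))"])
  fix v w assume v: "v \<in> carrier V" and w: "w \<in> carrier W"
  let ?X = "tensor A (tensor A (tensor V W))"
  let ?p = "\<lambda>a b v w. pure A (tensor A (tensor V W)) a (pure A (tensor V W) b (pure V W v w))"
  have "?r (pure V W v w) = tsum A V ?X (\<lambda>a v0. tsum A W ?X (\<lambda>b w0. tsum A V ?X (\<lambda>a' v1.
      tsum A W ?X (\<lambda>b' w1. ?p (a \<otimes> b) (a' \<otimes> b') v1 w1)
        (coaction W w0)) (coaction V v0)) (coaction W w)) (coaction V v)"
    unfolding U_def using V W v w by simp
  also have "\<dots> = tsum A V ?X (\<lambda>a v0. tsum A V ?X (\<lambda>a' v1. tsum A W ?X (\<lambda>b w0.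
      tsum A W ?X (\<lambda>b' w1. ?p (a \<otimes> b) (a' \<otimes> b') v1 w1)
        (coaction W w0)) (coaction W w)) (coaction V v0)) (coaction V v)"
    using V W v w by (intro tsum_cong refl tsum_commute) auto
  also have "\<dots> = tsum A V ?X (\<lambda>a v0. tsum A V ?X (\<lambda>a' v1. tsum A W ?X (\<lambda>b w0.
      tsum A A ?X (\<lambda>b1 b2. ?p (a \<otimes> b1) (a' \<otimes> b2) v1 w0)
        (coprod A b)) (coaction W w)) (coaction V v0)) (coaction V v)"
    using V W v w by (intro tsum_cong refl coaction_coassoc_tsum[where b = False]) auto
  also have "\<dots> = tsum A V ?X (\<lambda>a v0. tsum A A ?X (\<lambda>a1 a2. tsum A W ?X (\<lambda>b w0.
      tsum A A ?X (\<lambda>b1 b2. ?p (a1 \<otimes> b1) (a2 \<otimes> b2) v0 w0)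
        (coprod A b)) (coaction W w)) (coprod A a)) (coaction V v)"
    using V W v w by (intro coaction_coassoc_tsum[where b = False]) auto
  also have "\<dots> = tsum A V ?X (\<lambda>a v0. tsum A W ?X (\<lambda>b w0. tsum A A ?X (\<lambda>a1 a2.
      tsum A A ?X (\<lambda>b1 b2. ?p (a1 \<otimes> b1) (a2 \<otimes> b2) v0 w0)
        (coprod A b)) (coprod A a)) (coaction W w)) (coaction V v)"
    using V W v w by (intro tsum_cong refl tsum_commute) auto
  also have "\<dots> = ?l (pure V W v w)"
    unfolding U_def using V W v w by (simp add: coprod_mult_tsum)
  finally show "?l (pure V W v w) = ?r (pure V W v w)" ..
qed (use V W in \<open>simp_all add: U_def\<close>)

lemma coaction_yd_tensor_counit:
  assumes V: "V \<in> yd_obj A" and W: "W \<in> yd_obj A" and t: "t \<in> carrier (tensor V W)"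
  shows "tsum A (tensor V W) (tensor V W) (\<lambda>a u. counit A a \<odot>\<^bsub>tensor V W\<^esub> u)
    (coaction (yd_tensor A V W) t) = t"
proof (rule semilinear_tensor_eqI[OF t, where b = False and b' = False and X = "tensor V W"])
  fix v w assume v: "v \<in> carrier V" and w: "w \<in> carrier W"
  let ?X = "tensor V W"
  have "tsum A ?X ?X (\<lambda>a u. counit A a \<odot>\<^bsub>?X\<^esub> u) (coaction (yd_tensor A V W) (pure V W v w))
    = tsum A V ?X (\<lambda>a v0. counit A a \<odot>\<^bsub>?X\<^esub> tsum A W ?X (\<lambda>b w0.
        counit A b \<odot>\<^bsub>?X\<^esub> pure V W v0 w0) (coaction W w)) (coaction V v)"
    using V W v w by (simp add: smult_tsum counit_mult vs_smult_smult)
  also have "\<dots> = tsum A V ?X (\<lambda>a v0. counit A a \<odot>\<^bsub>?X\<^esub> pure V W v0 w) (coaction V v)"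
    using V W v w coaction_counit_tsum[of W w ?X "\<lambda>w. pure V W _ w"]
    by (intro tsum_cong refl) auto
  also have "\<dots> = pure V W v w"
    using V W v w coaction_counit_tsum[of V v ?X "\<lambda>v. pure V W v w"] by simp
  finally show "tsum A ?X ?X (\<lambda>a u. counit A a \<odot>\<^bsub>?X\<^esub> u)
    (coaction (yd_tensor A V W) (pure V W v w)) = pure V W v w" .
qed (use V W in simp_all)

text \<open>The algebra element is moved past the coaction of V and then past that of W. Three legs
  of its iterated coproduct take part, and coassociativity regroups them so that the two legs needed
  at each stage come from one coproduct.\<close>

lemma yd_tensor_compat:
  assumes V: "V \<in> yd_obj A" and W: "W \<in> yd_obj A" and a: "a \<in> carrier A"
    and t: "t \<in> carrier (tensor V W)"
  defines "U \<equiv> yd_tensor A V W"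
  shows "tsum A A (tensor A U) (\<lambda>a1 a2. tsum A U (tensor A U)
        (\<lambda>b u. pure A U (a1 \<otimes> b) (act U a2 u)) (coaction U t)) (coprod A a)
      = tsum A A (tensor A U) (\<lambda>a1 a2. tsum A U (tensor A U)
        (\<lambda>b u. pure A U (b \<otimes> a2) u) (coaction U (act U a1 t))) (coprod A a)"
    (is "?l t = ?r t")
proof (rule semilinear_tensor_eqI[OF t, where b = False and b' = False
      and X = "tensor A (tensor V W)"])
  fix v w assume v: "v \<in> carrier V" and w: "w \<in> carrier W"
  let ?X = "tensor A (tensor V W)"
  let ?p = "\<lambda>a v w. pure A (tensor V W) a (pure V W v w)"
  have "?l (pure V W v w) = tsum A A ?X (\<lambda>a1 a2. tsum A V ?X (\<lambda>b v0. tsum A W ?X (\<lambda>c w0.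
      tsum A A ?X (\<lambda>a2 a3. ?p (a1 \<otimes> (b \<otimes> c)) (act V a2 v0) (act W a3 w0)) (coprod A a2))
        (coaction W w)) (coaction V v)) (coprod A a)"
    unfolding U_def using V W a v w by simp
  also have "\<dots> = tsum A A ?X (\<lambda>a1 a2. tsum A V ?X (\<lambda>b v0. tsum A A ?X (\<lambda>a2 a3.
      tsum A W ?X (\<lambda>c w0. ?p (a1 \<otimes> (b \<otimes> c)) (act V a2 v0) (act W a3 w0)) (coaction W w))
        (coprod A a2)) (coaction V v)) (coprod A a)"
    using V W a v w by (intro tsum_cong refl tsum_commute) auto
  also have "\<dots> = tsum A A ?X (\<lambda>a1 a2. tsum A A ?X (\<lambda>a2 a3. tsum A V ?X (\<lambda>b v0.
      tsum A W ?X (\<lambda>c w0. ?p (a1 \<otimes> (b \<otimes> c)) (act V a2 v0) (act W a3 w0)) (coaction W w))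
        (coaction V v)) (coprod A a2)) (coprod A a)"
    using V W a v w by (intro tsum_cong refl tsum_commute) auto
  also have "\<dots> = tsum A A ?X (\<lambda>a1 a3. tsum A A ?X (\<lambda>a1 a2. tsum A V ?X (\<lambda>b v0.
      tsum A W ?X (\<lambda>c w0. ?p (a1 \<otimes> (b \<otimes> c)) (act V a2 v0) (act W a3 w0)) (coaction W w))
        (coaction V v)) (coprod A a1)) (coprod A a)"
    using V W a v w by (intro coassoc_tsum[symmetric, where b = False]) auto
  also have "\<dots> = tsum A A ?X (\<lambda>a1 a3. tsum A A ?X (\<lambda>a1 a2. tsum A V ?X (\<lambda>b v0.
      tsum A W ?X (\<lambda>c w0. ?p ((a1 \<otimes> b) \<otimes> c) (act V a2 v0) (act W a3 w0)) (coaction W w))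
        (coaction V v)) (coprod A a1)) (coprod A a)"
    using V W a v w by (intro tsum_cong refl) (simp_all add: mult_assoc_A)
  \<comment> \<open>Condition (a) for V on the first two legs; everything that involves W is part of
    the bilinear map \<open>B\<close>.\<close>
  also have "\<dots> = tsum A A ?X (\<lambda>a1 a3. tsum A A ?X (\<lambda>a1 a2. tsum A V ?X (\<lambda>b v0.
      tsum A W ?X (\<lambda>c w0. ?p ((b \<otimes> a2) \<otimes> c) v0 (act W a3 w0)) (coaction W w))
        (coaction V (act V a1 v))) (coprod A a1)) (coprod A a)"
    using V W a v w by (intro tsum_cong refl yd_compat_tsum[where
        B = "\<lambda>x u. tsum A W ?X (\<lambda>c w0. ?p (x \<otimes> c) u (act W _ w0)) (coaction W w)"]) auto
  also have "\<dots> = tsum A A ?X (\<lambda>a1 a2. tsum A A ?X (\<lambda>a2 a3. tsum A V ?X (\<lambda>b v0.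
      tsum A W ?X (\<lambda>c w0. ?p ((b \<otimes> a2) \<otimes> c) v0 (act W a3 w0)) (coaction W w))
        (coaction V (act V a1 v))) (coprod A a2)) (coprod A a)"
    using V W a v w by (intro coassoc_tsum[where b = False]) auto
  also have "\<dots> = tsum A A ?X (\<lambda>a1 a2. tsum A V ?X (\<lambda>b v0. tsum A A ?X (\<lambda>a2 a3.
      tsum A W ?X (\<lambda>c w0. ?p ((b \<otimes> a2) \<otimes> c) v0 (act W a3 w0)) (coaction W w))
        (coprod A a2)) (coaction V (act V a1 v))) (coprod A a)"
    using V W a v w by (intro tsum_cong refl tsum_commute) auto
  also have "\<dots> = tsum A A ?X (\<lambda>a1 a2. tsum A V ?X (\<lambda>b v0. tsum A A ?X (\<lambda>a2 a3.
      tsum A W ?X (\<lambda>c w0. ?p (b \<otimes> (a2 \<otimes> c)) v0 (act W a3 w0)) (coaction W w))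
        (coprod A a2)) (coaction V (act V a1 v))) (coprod A a)"
    using V W a v w by (intro tsum_cong refl) (simp_all add: mult_assoc_A)
  \<comment> \<open>Condition (a) for W on the last two legs, applied beneath the factor b coming
    from V.\<close>
  also have "\<dots> = tsum A A ?X (\<lambda>a1 a2. tsum A V ?X (\<lambda>b v0. tsum A A ?X (\<lambda>a2 a3.
      tsum A W ?X (\<lambda>c w0. ?p (b \<otimes> (c \<otimes> a3)) v0 w0) (coaction W (act W a2 w)))
        (coprod A a2)) (coaction V (act V a1 v))) (coprod A a)"
    using V W a v w by (intro tsum_cong refl yd_compat_tsum[where
        B = "\<lambda>x u. ?p (_ \<otimes> x) _ u"]) auto
  also have "\<dots> = tsum A A ?X (\<lambda>a1 a2. tsum A A ?X (\<lambda>a2 a3. tsum A V ?X (\<lambda>b v0.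
      tsum A W ?X (\<lambda>c w0. ?p (b \<otimes> (c \<otimes> a3)) v0 w0) (coaction W (act W a2 w)))
        (coaction V (act V a1 v))) (coprod A a2)) (coprod A a)"
    using V W a v w by (intro tsum_cong refl tsum_commute) auto
  also have "\<dots> = tsum A A ?X (\<lambda>a1 a3. tsum A A ?X (\<lambda>a1 a2. tsum A V ?X (\<lambda>b v0.
      tsum A W ?X (\<lambda>c w0. ?p (b \<otimes> (c \<otimes> a3)) v0 w0) (coaction W (act W a2 w)))
        (coaction V (act V a1 v))) (coprod A a1)) (coprod A a)"
    using V W a v w by (intro coassoc_tsum[symmetric, where b = False]) auto
  also have "\<dots> = ?r (pure V W v w)"
    unfolding U_def using V W a v w by (simp add: mult_assoc_A)
  finally show "?l (pure V W v w) = ?r (pure V W v w)" .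
qed (use V W a in \<open>simp_all add: U_def\<close>)

section \<open>The involution of V \<otimes> W: it squares to the identity and satisfies (b) and
  (c)\<close>

lemma skew_antipode:
  assumes a: "a \<in> carrier A"
  shows "tsum A A A (\<lambda>a1 a2. a2 \<otimes> star A (antipode A (star A a1))) (coprod A a) = counit A a \<odot> \<one>"
proof -
  have "counit A a \<odot> \<one> = star A (counit A (star A a) \<odot> \<one>)"
    using a by (simp add: counit_star semilinear_smult[OF semilinear_star])
  also have "\<dots> = star A (tsum A A A (\<lambda>a1 a2. antipode A a1 \<otimes> a2) (coprod A (star A a)))"
    using a by (simp add: antipode_left_tsum)
  also have "\<dots> = tsum A A A (\<lambda>a1 a2. a2 \<otimes> star A (antipode A (star A a1))) (coprod A a)"
    using a by (simp add: coprod_star_tsum star_mult)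
  finally show ?thesis ..
qed

text \<open>One application gives star(b) \<cdot> star(v) \<otimes> star(w0), where b \<otimes> w0
  is the coaction of w. A second one gives b2 T(b1) \<cdot> v \<otimes> w0 by (b), (c) and
  coassociativity, where T(b) = star(S(star b)); \<open>skew_antipode\<close> and the counit axiom
  remove b.\<close>

lemma involution_yd_tensor_involution:
  assumes V: "V \<in> yd_obj A" and W: "W \<in> yd_obj A" and t: "t \<in> carrier (tensor V W)"
  defines "U \<equiv> yd_tensor A V W"
  shows "involution U (involution U t) = t"
proof (rule semilinear_tensor_eqI[OF t, where b = False and b' = False and X = "tensor V W"])
  fix v w assume v: "v \<in> carrier V" and w: "w \<in> carrier W"
  let ?X = "tensor V W"
  have *: "involution V (act V (star A b) (involution V v))
      = act V (star A (antipode A (star A b))) v" if "b \<in> carrier A" for b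
    using V v that by (simp add: involution_act)
  have "involution U (pure V W v w) = tsum A W ?X
      (\<lambda>b w0. pure V W (act V (star A b) (involution V v)) (involution W w0)) (coaction W w)"
    unfolding U_def using V W v w by (simp add: involution_yd_tensor coaction_involution)
  then have "involution U (involution U (pure V W v w)) = tsum A W ?X (\<lambda>b w0.
      tsum A W ?X (\<lambda>c w1. pure V W (act V c (act V (star A (antipode A (star A b))) v)) w1)
        (coaction W w0)) (coaction W w)"
    unfolding U_def using V W v w by (simp add: involution_yd_tensor *)
  also have "\<dots> = tsum A W ?X (\<lambda>b w0. tsum A A ?X (\<lambda>b1 b2.
      pure V W (act V b2 (act V (star A (antipode A (star A b1))) v)) w0)
        (coprod A b)) (coaction W w)"
    using V W v w by (intro coaction_coassoc_tsum[where b = False]) auto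
  also have "\<dots> = tsum A W ?X (\<lambda>b w0. pure V W (act V (tsum A A A (\<lambda>b1 b2.
      b2 \<otimes> star A (antipode A (star A b1))) (coprod A b)) v) w0) (coaction W w)"
    using V W v w by (intro tsum_cong refl) simp_all
  also have "\<dots> = tsum A W ?X (\<lambda>b w0. counit A b \<odot>\<^bsub>?X\<^esub> pure V W v w0) (coaction W w)"
    using V W v w by (intro tsum_cong refl) (simp_all add: skew_antipode pure_smult)
  also have "\<dots> = pure V W v w"
    using V W v w coaction_counit_tsum[of W w ?X "\<lambda>w. pure V W v w"] by simp
  finally show "involution U (involution U (pure V W v w)) = pure V W v w" .
qed (use V W in \<open>simp_all add: U_def\<close>)

text \<open>The equation for \<open>L\<close> is established beneath the braiding. By
  \<open>braid_act\<close>, star(a2) acts there on W \<otimes> V through its coproduct, and four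
  legs of a meet: star(S(a2) a3) acts on the conjugate of w and star(S(a1) a4) on that of v. The
  inner product collapses by the antipode axiom, then the outer one.\<close>

lemma involution_act_yd_tensor:
  assumes V: "V \<in> yd_obj A" and W: "W \<in> yd_obj A" and a: "a \<in> carrier A"
    and t: "t \<in> carrier (tensor V W)"
  defines "U \<equiv> yd_tensor A V W"
  shows "involution U (act U a t) = act U (star A (antipode A a)) (involution U t)"
proof (rule semilinear_tensor_eqI[OF t, where b = True and b' = True and X = "tensor V W"])
  fix v w assume v: "v \<in> carrier V" and w: "w \<in> carrier W"
  let ?X = "tensor V W"
  define L where "L a = involution U (act U a (pure V W v w))" for a
  define J where "J = involution U (pure V W v w)"
  have U: "linear_structure U" and carrier_U: "carrier U = carrier ?X"
    using V W by (simp_all add: U_def)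
  have L_semilinear: "semilinear True A ?X L"
    unfolding L_def U_def using V W v w by simp
  have L_closed: "L a \<in> carrier ?X" if "a \<in> carrier A" for a
    using semilinear_closed[OF L_semilinear that] .
  have J_closed: "J \<in> carrier ?X"
    unfolding J_def U_def using V W v w by simp
  have "tsum A A ?X (\<lambda>a1 a2. act U (star A a2) (L a1)) (coprod A a) = cnj (counit A a) \<odot>\<^bsub>?X\<^esub> J"
    if a: "a \<in> carrier A" for a
  proof -
    let ?Y = "tensor W V"
    let ?G = "\<lambda>a1 a2 a3 a4. pure W V (act W (star A (antipode A a2 \<otimes> a3)) (involution W w))
      (act V (star A (antipode A a1 \<otimes> a4)) (involution V v))"
    \<comment> \<open>The braiding is deliberately left unexpanded: all cancellations take place in
      W \<otimes> V before it is applied.\<close>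
    have L_eq: "L a = yd_braid A W V (tsum A A ?Y (\<lambda>a1 a2.
        pure W V (act W (star A (antipode A a2)) (involution W w))
          (act V (star A (antipode A a1)) (involution V v))) (coprod A a))" if "a \<in> carrier A" for a
      unfolding L_def U_def using V W v w that
      by (simp add: involution_yd_tensor involution_act del: braid_pure)
    have G_semilinear:
      "\<forall>x \<in> carrier A. \<forall>y \<in> carrier A. \<forall>z \<in> carrier A. semilinear True A ?Y (\<lambda>a. ?G a x y z)"
      "\<forall>x \<in> carrier A. \<forall>y \<in> carrier A. \<forall>z \<in> carrier A. semilinear True A ?Y (\<lambda>a. ?G x a y z)"
      "\<forall>x \<in> carrier A. \<forall>y \<in> carrier A. \<forall>z \<in> carrier A. semilinear True A ?Y (\<lambda>a. ?G x y a z)"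
      "\<forall>x \<in> carrier A. \<forall>y \<in> carrier A. \<forall>z \<in> carrier A. semilinear True A ?Y (\<lambda>a. ?G x y z a)"
      "\<forall>x \<in> carrier A. \<forall>y \<in> carrier A. \<forall>z \<in> carrier A. \<forall>a \<in> carrier A. ?G x y z a \<in> carrier ?Y"
      using V W v w by simp_all
    have "tsum A A ?X (\<lambda>a1 a2. act U (star A a2) (L a1)) (coprod A a)
      = tsum A A ?X (\<lambda>a1 a2. yd_braid A W V (act (yd_tensor A W V) (star A a2)
          (tsum A A ?Y (\<lambda>a1 a2. pure W V (act W (star A (antipode A a2)) (involution W w))
            (act V (star A (antipode A a1)) (involution V v))) (coprod A a1)))) (coprod A a)"
      unfolding U_def using V W v w
      by (intro tsum_cong refl) (simp_all only: L_eq, subst braid_act, auto)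
    also have "\<dots> = tsum A A ?X (\<lambda>a1 a3. yd_braid A W V (tsum A A ?Y (\<lambda>a3 a4.
        tsum A A ?Y (\<lambda>a1 a2. ?G a1 a2 a3 a4) (coprod A a1)) (coprod A a3))) (coprod A a)"
      using V W v w
      by (intro tsum_cong refl) (simp_all add: coprod_star_tsum star_mult del: braid_pure)
    also have "\<dots> = yd_braid A W V (tsum A A ?Y (\<lambda>a1 a3. tsum A A ?Y (\<lambda>a3 a4.
        tsum A A ?Y (\<lambda>a1 a2. ?G a1 a2 a3 a4) (coprod A a1)) (coprod A a3)) (coprod A a))"
      using V W v w G_semilinear(5) by (simp del: braid_pure)
    \<comment> \<open>The legs are regrouped until a2 and a3 are the coproduct of a single leg, so
      that the antipode axiom applies to S(a2) a3 while a1 and a4 stay outside.\<close>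
    also have "tsum A A ?Y (\<lambda>a1 a3. tsum A A ?Y (\<lambda>a3 a4.
        tsum A A ?Y (\<lambda>a1 a2. ?G a1 a2 a3 a4) (coprod A a1)) (coprod A a3)) (coprod A a)
      = tsum A A ?Y (\<lambda>a1 a3. tsum A A ?Y (\<lambda>a1 a2.
        tsum A A ?Y (\<lambda>a3 a4. ?G a1 a2 a3 a4) (coprod A a3)) (coprod A a1)) (coprod A a)"
      using V W v w by (intro tsum_cong refl tsum_commute) auto
    also have "\<dots> = tsum A A ?Y (\<lambda>a1 a2. tsum A A ?Y (\<lambda>a2 a3.
        tsum A A ?Y (\<lambda>a3 a4. ?G a1 a2 a3 a4) (coprod A a3)) (coprod A a2)) (coprod A a)"
      using V W v w a by (intro coassoc_tsum[where b = True]) auto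
    also have "\<dots> = tsum A A ?Y (\<lambda>a1 a2. tsum A A ?Y (\<lambda>a2 a4.
        tsum A A ?Y (\<lambda>a2 a3. ?G a1 a2 a3 a4) (coprod A a2)) (coprod A a2)) (coprod A a)"
      using V W v w a by (intro tsum_cong refl coassoc_tsum[symmetric, where b = True]) auto
    also have "\<dots> = tsum A A ?Y (\<lambda>a1 a2. tsum A A ?Y (\<lambda>a2 a4. pure W V
        (act W (star A (tsum A A A (\<lambda>a2 a3. antipode A a2 \<otimes> a3) (coprod A a2))) (involution W w))
        (act V (star A (antipode A a1 \<otimes> a4)) (involution V v))) (coprod A a2)) (coprod A a)"
      using V W v w by (intro tsum_cong refl) (simp_all add: star_mult)
    also have "\<dots> = tsum A A ?Y (\<lambda>a1 a2. tsum A A ?Y (\<lambda>a2 a4. cnj (counit A a2) \<odot>\<^bsub>?Y\<^esub>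
        pure W V (involution W w) (act V (star A (antipode A a1 \<otimes> a4)) (involution V v)))
          (coprod A a2)) (coprod A a)"
      using V W v w by (intro tsum_cong refl)
        (simp_all add: antipode_left_tsum semilinear_smult[OF semilinear_star] star_mult pure_smult)
    \<comment> \<open>The counit left over from the inner collapse merges with a4. The coefficient
      is conjugated, and \<open>g\<close> anti-linear, because the legs act through star.\<close>
    also have "\<dots> = tsum A A ?Y (\<lambda>a1 a2.
        pure W V (involution W w) (act V (star A (antipode A a1 \<otimes> a2)) (involution V v))) (coprod A a)"
      using V W v w counit_left_tsum[where b = True and X = ?Y and
        g = "\<lambda>x. pure W V (involution W w)
          (act V (star A x) (act V (star A (antipode A _)) (involution V v)))"]
      by (intro tsum_cong refl) (simp_all add: star_mult)
    also have "\<dots> = pure W V (involution W w) (act V (star A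
        (tsum A A A (\<lambda>a1 a2. antipode A a1 \<otimes> a2) (coprod A a))) (involution V v))"
      using V W v w by (simp add: star_mult)
    also have "\<dots> = cnj (counit A a) \<odot>\<^bsub>?Y\<^esub> pure W V (involution W w) (involution V v)"
      using V W v w a by (simp add: antipode_left_tsum semilinear_smult[OF semilinear_star] pure_smult)
    also have "yd_braid A W V \<dots> = cnj (counit A a) \<odot>\<^bsub>?X\<^esub> J"
      unfolding J_def U_def using V W v w
      by (simp add: involution_yd_tensor semilinear_smult[OF semilinear_braid] del: braid_pure)
    finally show ?thesis .
  qed
  note claim = this
  have act_J: "semilinear True A ?X (\<lambda>a. act U (star A (antipode A a)) J)"
    unfolding U_def using V W J_closed by (simp del: act_yd_tensor)
  have act_smult_J: "act U b (c \<odot>\<^bsub>?X\<^esub> J) = c \<odot>\<^bsub>?X\<^esub> act U b J" if "b \<in> carrier A" for b c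
  proof -
    have "semilinear False ?X ?X (\<lambda>x. act U b x)"
      unfolding U_def using V W that by (simp del: act_yd_tensor)
    from semilinear_smult[OF this J_closed] show ?thesis by simp
  qed
  \<comment> \<open>Uniqueness of the solution: starting from star(S(a)) \<cdot> J, insert the
    counit, replace cnj(\<epsilon>(a1)) J by the equation just proved, and cancel a2 S(a3).\<close>
  have "act U (star A (antipode A a)) J = tsum A A ?X (\<lambda>a1 a2. cnj (counit A a1) \<odot>\<^bsub>?X\<^esub>
      act U (star A (antipode A a2)) J) (coprod A a)"
    using counit_left_tsum[OF a _ act_J] V W by simp
  also have "\<dots> = tsum A A ?X (\<lambda>a1 a3. act U (star A (antipode A a3))
      (tsum A A ?X (\<lambda>a1 a2. act U (star A a2) (L a1)) (coprod A a1))) (coprod A a)"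
    by (intro tsum_cong refl) (simp_all add: claim act_smult_J)
  also have "\<dots> = tsum A A ?X (\<lambda>a1 a3. tsum A A ?X (\<lambda>a1 a2. act U (star A (antipode A a3))
      (act U (star A a2) (L a1))) (coprod A a1)) (coprod A a)"
    using V W L_closed
    by (intro tsum_cong refl tsum_map[of False ?X ?X])
      (auto simp: U_def act_yd_tensor_closed simp del: act_yd_tensor)
  also have "\<dots> = tsum A A ?X (\<lambda>a1 a3. tsum A A ?X (\<lambda>a1 a2.
      act U (star A (a2 \<otimes> antipode A a3)) (L a1)) (coprod A a1)) (coprod A a)"
    using V W L_closed
    by (intro tsum_cong refl) (simp_all add: U_def star_mult act_yd_tensor_mult del: act_yd_tensor)
  also have "\<dots> = tsum A A ?X (\<lambda>a1 a2. tsum A A ?X (\<lambda>a2 a3.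
      act U (star A (a2 \<otimes> antipode A a3)) (L a1)) (coprod A a2)) (coprod A a)"
    using V W L_closed a L_semilinear unfolding U_def
    by (intro coassoc_tsum[where b = True]) (simp_all del: act_yd_tensor)
  also have "\<dots> = tsum A A ?X (\<lambda>a1 a2. act U (star A (tsum A A A
      (\<lambda>a2 a3. a2 \<otimes> antipode A a3) (coprod A a2))) (L a1)) (coprod A a)"
    using V W L_closed unfolding U_def
    by (intro tsum_cong refl tsum_map[of True A ?X "\<lambda>x. act (yd_tensor A V W) (star A x) (L _)", symmetric])
      (simp_all del: act_yd_tensor)
  also have "\<dots> = tsum A A ?X (\<lambda>a1 a2. cnj (counit A a2) \<odot>\<^bsub>?X\<^esub> L a1) (coprod A a)"
  proof (intro tsum_cong refl)
    fix a1 a2 assume a12: "a1 \<in> carrier A" "a2 \<in> carrier A"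
    have "semilinear True A ?X (\<lambda>x. act (yd_tensor A V W) (star A x) (L a1))"
      using V W L_closed a12 by (simp del: act_yd_tensor)
    from semilinear_smult[OF this, of \<one> "counit A a2"]
    show "act U (star A (tsum A A A (\<lambda>a2 a3. a2 \<otimes> antipode A a3) (coprod A a2))) (L a1)
      = cnj (counit A a2) \<odot>\<^bsub>?X\<^esub> L a1"
      using V W L_closed a12
      by (simp add: antipode_right_tsum U_def act_yd_tensor_one del: act_yd_tensor)
  qed simp_all
  also have "\<dots> = L a"
    using counit_right_tsum[OF a _ L_semilinear] V W by simp
  finally show "involution U (act U a (pure V W v w))
    = act U (star A (antipode A a)) (involution U (pure V W v w))"
    by (simp add: L_def J_def)
qed (use V W a in \<open>simp_all add: U_def del: act_yd_tensor\<close>)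

text \<open>The coaction passes through the braiding by \<open>braid_coaction\<close>. On the
  flipped conjugates it multiplies star(b) star(a), where a comes from v and b from w; this is
  star(a b) because star reverses products, so the flip is exactly compensated.\<close>

lemma coaction_involution_yd_tensor:
  assumes V: "V \<in> yd_obj A" and W: "W \<in> yd_obj A" and t: "t \<in> carrier (tensor V W)"
  defines "U \<equiv> yd_tensor A V W"
  shows "coaction U (involution U t) = tsum A (tensor V W) (tensor A (tensor V W))
    (\<lambda>b u. pure A (tensor V W) (star A b) (involution U u)) (coaction U t)"
    (is "_ = ?r t")
proof (rule semilinear_tensor_eqI[OF t, where b = True and b' = True and X = "tensor A (tensor V W)"])
  fix v w assume v: "v \<in> carrier V" and w: "w \<in> carrier W"
  let ?X = "tensor A (tensor V W)"
  let ?p = "\<lambda>a b v w. pure A (tensor V W) (star A (a \<otimes> b))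
      (yd_braid A W V (pure W V (involution W w) (involution V v)))"
  have "coaction U (involution U (pure V W v w)) = tsum A (tensor W V) ?X
      (\<lambda>a u. pure A (tensor V W) a (yd_braid A W V u))
        (coaction (yd_tensor A W V) (pure W V (involution W w) (involution V v)))"
    unfolding U_def using V W v w
    by (simp add: involution_yd_tensor braid_coaction del: braid_pure coaction_yd_tensor)
  also have "\<dots> = tsum A W ?X (\<lambda>b w0. tsum A V ?X
      (\<lambda>a v0. ?p a b v0 w0) (coaction V v)) (coaction W w)"
    using V W v w by (simp add: coaction_involution star_mult del: braid_pure)
  also have "\<dots> = tsum A V ?X (\<lambda>a v0. tsum A W ?X
      (\<lambda>b w0. ?p a b v0 w0) (coaction W w)) (coaction V v)"
    using V W v w by (intro tsum_commute) auto
  also have "\<dots> = ?r (pure V W v w)"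
    unfolding U_def using V W v w by (simp add: involution_yd_tensor del: braid_pure)
  finally show "coaction U (involution U (pure V W v w)) = ?r (pure V W v w)" .
qed (use V W in \<open>simp_all add: U_def\<close>)

lemma yd_tensor_in_yd_obj [simp]:
  assumes V: "V \<in> yd_obj A" and W: "W \<in> yd_obj A"
  shows "yd_tensor A V W \<in> yd_obj A"
proof (rule yd_objI, goal_cases)
  case 1 show ?case using V W by simp
next
  case (2 v) then show ?case using involution_yd_tensor_involution[OF V W] by simp
next
  case (3 a b v) then show ?case using act_yd_tensor_mult[OF V W] by simp
next
  case (4 v) then show ?case using act_yd_tensor_one[OF V W] by simp
next
  case (5 v) then show ?case using coaction_yd_tensor_coassoc[OF V W, of v] by (simp only: carrier_yd_tensor)
next
  case (6 v) then show ?case using coaction_yd_tensor_counit[OF V W, of v]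
    by (simp only: carrier_yd_tensor tsum_yd smult_yd_tensor)
next
  case (7 a v) then show ?case using yd_tensor_compat[OF V W, of a v] by (simp only: carrier_yd_tensor)
next
  case (8 a v) then show ?case using involution_act_yd_tensor[OF V W, of a v] by (simp only: carrier_yd_tensor)
next
  case (9 v) then show ?case using coaction_involution_yd_tensor[OF V W, of v]
    by (simp only: carrier_yd_tensor tsum_yd tensor_yd pure_yd)
qed

end

section \<open>Maps between tensor products of records with the same underlying space; expansion
  into pure tensors\<close>

lemma
  assumes "same_space V V'" "same_space W W'"
  shows same_space_tensor_map: "tensor_map V W = tensor_map V' W'"
    and same_space_assoc: "same_space U U' \<Longrightarrow> assoc U V W = assoc U' V' W'"
    and same_space_assoc_inv: "same_space U U' \<Longrightarrow> assoc_inv U V W = assoc_inv U' V' W'"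
proof -
  note eqs = same_space_tensor[OF assms] same_space_pure[OF assms]
  show "tensor_map V W = tensor_map V' W'"
    unfolding tensor_map_def by (simp add: fun_eq_iff eqs)
  assume U: "same_space U U'"
  show "assoc U V W = assoc U' V' W'"
    unfolding assoc_def by (simp add: eqs same_space_tensor[OF U same_space_refl[of "tensor V' W'"]]
      same_space_pure[OF U same_space_refl[of "tensor V' W'"]])
  show "assoc_inv U V W = assoc_inv U' V' W'"
    unfolding assoc_inv_def
    by (simp add: same_space_tensor[OF U assms(1)] same_space_pure[OF U assms(1)]
        same_space_tensor[OF same_space_refl[of "tensor U' V'"] assms(2)]
        same_space_pure[OF same_space_refl[of "tensor U' V'"] assms(2)])
qed

lemmas tensor_map_yd [simp] =
  same_space_yd[THEN same_space_tensor_map, OF same_space_refl]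
  same_space_yd[THEN same_space_tensor_map[OF same_space_refl]]

lemmas assoc_yd [simp] =
  same_space_assoc[OF same_space_refl same_space_refl same_space_yd(1)]
  same_space_assoc[OF same_space_yd(1) same_space_refl same_space_refl]
  same_space_assoc[OF same_space_refl same_space_yd(1) same_space_refl]
  same_space_assoc[OF same_space_refl same_space_refl same_space_yd(2)]
  same_space_assoc[OF same_space_yd(2) same_space_refl same_space_refl]
  same_space_assoc[OF same_space_refl same_space_yd(2) same_space_refl]

text \<open>The witness is \<open>t\<close> itself. Giving it a new name allows \<open>t\<close> to
  be replaced by its expansion once without the equation rewriting its own right-hand side.\<close>

lemma tensor_expand:
  assumes "t \<in> carrier (tensor V W)" "vector_space_C V" "vector_space_C W"
  obtains s where "t = tsum V W (tensor V W) (pure V W) s"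
  using tsum_ident[OF assms] by metis

lemma tensor_expand3:
  assumes t: "t \<in> carrier (tensor (tensor U V) W)"
    and vs: "vector_space_C U" "vector_space_C V" "vector_space_C W"
  obtains r where "t = tsum (tensor U V) W (tensor (tensor U V) W) (\<lambda>s w.
    tsum U V (tensor (tensor U V) W) (\<lambda>u v. pure (tensor U V) W (pure U V u v) w) s) r"
proof -
  have "t = tsum (tensor U V) W (tensor (tensor U V) W)
      (\<lambda>s w. pure (tensor U V) W (tsum U V (tensor U V) (pure U V) s) w) t"
    \<comment> \<open>The inner sum has to stay inside the pure tensor here, where it is recognised
      as \<open>s\<close>; pulling it out is the next step.\<close>
    using vs tsum_ident[OF t] by (simp add: tsum_ident del: pure_tsum_left)
  then show thesis using that vs by simp
qed


section \<open>The unit object\<close>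

lemma complex_space_simps [simp]:
  "Scalar c \<in> carrier complex_space"
  "scalar_of (c \<odot>\<^bsub>complex_space\<^esub> x) = c * scalar_of x"
  "scalar_of (x \<oplus>\<^bsub>complex_space\<^esub> y) = scalar_of x + scalar_of y"
  "c \<odot>\<^bsub>complex_space\<^esub> Scalar d = Scalar (c * d)"
  "x \<in> carrier complex_space \<Longrightarrow> Scalar (scalar_of x) = x"
  by (auto simp: complex_space_def)

lemma semilinear_scalar_of [simp]:
  assumes "semilinear b V complex_space f" "vector_space_C X" "x \<in> carrier X"
  shows "semilinear b V X (\<lambda>v. scalar_of (f v) \<odot>\<^bsub>X\<^esub> x)"
  using assms by (simp add: semilinear_def vs_smult_smult vs_smult_add_left)

lemma semilinear_cnj_scalar [simp]:
  assumes "semilinear (\<not> b) V complex_space f"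
  shows "semilinear b V complex_space (\<lambda>v. Scalar (cnj (scalar_of (f v))))"
  using assms by (simp add: semilinear_def) (simp add: complex_space_def)

context involutive_hopf_algebra
begin

lemma yd_unit_sel:
  "action (yd_unit A) = lift complex_space (\<lambda>a z. counit A a \<odot>\<^bsub>complex_space\<^esub> z)"
  "coaction (yd_unit A) z = pure A complex_space \<one> z"
  "involution (yd_unit A) z = Scalar (cnj (scalar_of z))"
  by (simp_all add: yd_unit_def module.defs star_bimodule.defs)

declare yd_unit_sel(2,3) [simp]

lemma linear_structure_yd_unit [simp]: "linear_structure (yd_unit A)"
proof -
  have "semilinear False (tensor A complex_space) complex_space (action (yd_unit A))"
    unfolding yd_unit_sel
    by (subst semilinear_cong[OF lift_eq_tsum[where V = A and W = complex_space]])
      (auto intro!: semilinear_tsum)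
  moreover have "semilinear False complex_space (tensor A complex_space) (coaction (yd_unit A))"
    by (subst semilinear_cong[where g = "pure A complex_space \<one>"]) auto
  moreover have "semilinear True complex_space complex_space (involution (yd_unit A))"
    by (subst semilinear_cong[where g = "\<lambda>z. Scalar (cnj (scalar_of z))"]) auto
  ultimately show ?thesis unfolding linear_structure_def by simp
qed

lemma act_yd_unit [simp]:
  "a \<in> carrier A \<Longrightarrow> z \<in> carrier complex_space
    \<Longrightarrow> act (yd_unit A) a z = counit A a \<odot>\<^bsub>complex_space\<^esub> z"
  unfolding act_def yd_unit_sel by (subst lift_eq_tsum[where V = A and W = complex_space]) auto

lemma
  shows semilinear_act_yd_unit_left [simp]: "\<lbrakk>semilinear b X A f; z \<in> carrier complex_space\<rbrakk>
      \<Longrightarrow> semilinear b X complex_space (\<lambda>x. act (yd_unit A) (f x) z)"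
    and semilinear_act_yd_unit_right [simp]: "\<lbrakk>semilinear b X complex_space g; a \<in> carrier A\<rbrakk>
      \<Longrightarrow> semilinear b X complex_space (\<lambda>x. act (yd_unit A) a (g x))"
  using semilinear_act_left[of "yd_unit A" b X f z] semilinear_act_right[of "yd_unit A" b X g a]
  by simp_all

lemma yd_unit_in_yd_obj [simp]: "yd_unit A \<in> yd_obj A"
proof (rule yd_objI, goal_cases)
  case (7 a z)
  \<comment> \<open>Condition (a) for the unit object: both sides reduce to a \<otimes> z, one by
    each counit axiom, as the action is through \<epsilon> and the coaction inserts the
    unit.\<close>
  then have
    "tsum A A (tensor A complex_space) (\<lambda>a1 a2.
      pure A complex_space a1 (counit A a2 \<odot>\<^bsub>complex_space\<^esub> z)) (coprod A a) = pure A complex_space a z"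
    "tsum A A (tensor A complex_space) (\<lambda>a1 a2.
      pure A complex_space a2 (counit A a1 \<odot>\<^bsub>complex_space\<^esub> z)) (coprod A a) = pure A complex_space a z"
    using counit_right_tsum[of a "tensor A complex_space" False "\<lambda>a. pure A complex_space a z"]
      counit_left_tsum[of a "tensor A complex_space" False "\<lambda>a. pure A complex_space a z"]
    by (simp_all add: pure_smult)
  with 7 show ?case by simp
qed (simp_all add: coprod_one counit_one counit_mult vs_smult_smult counit_star)


section \<open>Morphisms\<close>

definition yd_map ::
  "'a univ star_bimodule \<Rightarrow> 'a univ star_bimodule \<Rightarrow> ('a univ \<Rightarrow> 'a univ) \<Rightarrow> bool" where
  "yd_map V W f \<longleftrightarrow> semilinear False V W f
     \<and> (\<forall>a \<in> carrier A. \<forall>v \<in> carrier V. f (act V a v) = act W a (f v))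
     \<and> (\<forall>v \<in> carrier V. coaction W (f v) = tsum A V (tensor A W) (\<lambda>a u. pure A W a (f u)) (coaction V v))"

lemma yd_mapD:
  assumes "yd_map V W f"
  shows "semilinear False V W f" "\<And>v. v \<in> carrier V \<Longrightarrow> f v \<in> carrier W"
    "\<And>a v. a \<in> carrier A \<Longrightarrow> v \<in> carrier V \<Longrightarrow> f (act V a v) = act W a (f v)"
    "\<And>v. v \<in> carrier V \<Longrightarrow> coaction W (f v)
      = tsum A V (tensor A W) (\<lambda>a u. pure A W a (f u)) (coaction V v)"
  using assms by (auto simp: yd_map_def semilinear_def)

lemma yd_hom_iff:
  assumes V: "V \<in> yd_obj A" and W: "W \<in> yd_obj A"
  shows "h \<in> yd_hom A V W \<longleftrightarrow> (\<exists>f. h = mk_arrow V W f \<and> yd_map V W f)"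
proof -
  have "(\<forall>x \<in> carrier (tensor A V). f (action V x) = action W (tensor_map A W id f x))
      \<longleftrightarrow> (\<forall>a \<in> carrier A. \<forall>v \<in> carrier V. f (act V a v) = act W a (f v))" (is "?l \<longleftrightarrow> ?r")
    if f: "semilinear False V W f" for f
  proof
    assume l: ?l
    have "f (action V (pure A V a v)) = action W (tensor_map A W id f (pure A V a v))"
      if "a \<in> carrier A" "v \<in> carrier V" for a v
      using l that by (simp del: yd_rules)
    then show ?r using V W f semilinear_closed_all[OF f] by simp
  next
    assume r: ?r
    show ?l
    proof
      fix x assume x: "x \<in> carrier (tensor A V)"
      then obtain s where s: "x = tsum A V (tensor A V) (pure A V) s"
        using V by (auto elim: tensor_expand)
      have "f (tsum A V V (\<lambda>a v. act V a v) s) = tsum A V W (\<lambda>a v. f (act V a v)) s"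
        using V W by (intro tsum_map[OF f]) auto
      then show "f (action V x) = action W (tensor_map A W id f x)"
        unfolding s using V W f r semilinear_closed_all[OF f] by simp
    qed
  qed
  moreover have "tensor_map A W id f (coaction V v)
      = tsum A V (tensor A W) (\<lambda>a u. pure A W a (f u)) (coaction V v)" if "v \<in> carrier V" for f v
    using V that by simp
  ultimately show ?thesis
    unfolding yd_hom_def yd_map_def linear_map_iff_semilinear by auto
qed

lemma mk_arrow_eq_iff [simp]:
  "mk_arrow V W f = mk_arrow V' W' f' \<longleftrightarrow> V = V' \<and> W = W' \<and> (\<forall>v \<in> carrier V. f v = f' v)"
  by (auto simp: mk_arrow_def fun_eq_iff restrict_def)

lemma yd_category_simps [simp]:
  "obj (yd_category A) = yd_obj A"
  "hom_set (yd_category A) = yd_hom A"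
  "ident (yd_category A) = (\<lambda>V. mk_arrow V V id)"
  "tensor_obj (yd_category A) = yd_tensor A"
  "unit_obj (yd_category A) = yd_unit A"
  "associator (yd_category A) = (\<lambda>U V W. mk_arrow (yd_tensor A (yd_tensor A U V) W)
       (yd_tensor A U (yd_tensor A V W)) (assoc U V W))"
  "braiding (yd_category A)
    = (\<lambda>V W. mk_arrow (yd_tensor A V W) (yd_tensor A W V) (yd_braid A V W))"
  by (simp_all add: yd_category_def)

text \<open>The premise keeps \<open>f u\<close> inside the carrier of \<open>V\<close>, where the
  restricted map stored in the second arrow agrees with \<open>g\<close>.\<close>

lemma comp_mk_arrow [simp]:
  assumes "\<forall>u \<in> carrier U. f u \<in> carrier V"
  shows "mk_arrow V W g \<bullet>\<^bsub>yd_category A\<^esub> mk_arrow U V f = mk_arrow U W (\<lambda>u. g (f u))"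
  using assms by (auto simp: yd_category_def mk_arrow_def)

lemma tensor_mk_arrow [simp]:
  assumes "vector_space_C V" "vector_space_C W"
  shows "mk_arrow V V' f \<boxdot>\<^bsub>yd_category A\<^esub> mk_arrow W W' g
    = mk_arrow (yd_tensor A V W) (yd_tensor A V' W') (tensor_map V' W' f g)"
proof -
  have "tensor_map V' W' (restrict f (carrier V)) (restrict g (carrier W)) t
    = tensor_map V' W' f g t" if "t \<in> carrier (tensor V W)" for t
    using assms that by (simp add: tensor_map_eq_tsum[where V = V and W = W])
  then show ?thesis by (auto simp: yd_category_def mk_arrow_def)
qed

lemma yd_map_id: "V \<in> yd_obj A \<Longrightarrow> yd_map V V id"
  by (simp add: yd_map_def tsum_ident)

lemma yd_map_comp:
  assumes "U \<in> yd_obj A" "V \<in> yd_obj A" "W \<in> yd_obj A" and f: "yd_map U V f" and g: "yd_map V W g"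
  shows "yd_map U W (\<lambda>u. g (f u))"
  using assms(1-3) semilinear_comp[OF yd_mapD(1)[OF f] yd_mapD(1)[OF g]] yd_mapD[OF f] yd_mapD[OF g]
  by (simp add: yd_map_def)

text \<open>Every w is f v, and g (f v) = v transports each property of f to g. Hence invertibility
  of a morphism is a question about bare maps, which matters for the braiding, whose inverse is
  written with anti-linear factors.\<close>

lemma yd_map_inverse:
  assumes V: "V \<in> yd_obj A" and W: "W \<in> yd_obj A" and f: "yd_map V W f"
    and g: "\<forall>w \<in> carrier W. g w \<in> carrier V \<and> f (g w) = w" and gf: "\<forall>v \<in> carrier V. g (f v) = v"
  shows "yd_map V W f \<and> yd_map W V g"
proof -
  have surj: "\<exists>v \<in> carrier V. w = f v" if "w \<in> carrier W" for w
    using g that by metis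
  have g_lin: "semilinear False W V g"
    unfolding semilinear_def
  proof (intro conjI ballI allI)
    fix x y assume "x \<in> carrier W" "y \<in> carrier W"
    with surj obtain v w where "v \<in> carrier V" "x = f v" "w \<in> carrier V" "y = f w" by metis
    then show "g (x \<oplus>\<^bsub>W\<^esub> y) = g x \<oplus>\<^bsub>V\<^esub> g y"
      using V gf by (simp add: semilinear_add[OF yd_mapD(1)[OF f], symmetric])
  next
    fix c x assume "x \<in> carrier W"
    with surj obtain v where "v \<in> carrier V" "x = f v" by metis
    then show "g (c \<odot>\<^bsub>W\<^esub> x) = (if False then cnj c else c) \<odot>\<^bsub>V\<^esub> g x"
      using V gf semilinear_smult[OF yd_mapD(1)[OF f], of v c] by (simp, metis vs_smult_closed yd_vector_space)
  qed (use g in auto)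
  moreover have "g (act W a w) = act V a (g w)" if a: "a \<in> carrier A" and w: "w \<in> carrier W" for a w
  proof -
    obtain v where v: "v \<in> carrier V" "w = f v" using surj[OF w] by blast
    have "g (act W a w) = g (f (act V a v))"
      using yd_mapD(3)[OF f a v(1)] v(2) by simp
    also have "\<dots> = act V a v" using V gf a v by simp
    finally show ?thesis using gf v by simp
  qed
  moreover have "coaction V (g w) = tsum A W (tensor A V) (\<lambda>a u. pure A V a (g u)) (coaction W w)"
    if w: "w \<in> carrier W" for w
  proof -
    obtain v where v: "v \<in> carrier V" "w = f v" using surj[OF w] by blast
    have "tsum A W (tensor A V) (\<lambda>a u. pure A V a (g u)) (coaction W (f v))
      = tsum A V (tensor A V) (\<lambda>a u. pure A V a (g (f u))) (coaction V v)"
      using V W v g_lin semilinear_closed_all[OF g_lin] yd_mapD[OF f] by simp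
    also have "\<dots> = tsum A V (tensor A V) (pure A V) (coaction V v)"
      using gf by (intro tsum_cong) auto
    finally show ?thesis using V v gf by (simp add: tsum_ident)
  qed
  ultimately show ?thesis using f by (simp add: yd_map_def)
qed

lemma inverse_arrows_mk_arrow:
  assumes V: "V \<in> yd_obj A" and W: "W \<in> yd_obj A" and f: "yd_map V W f"
    and g: "\<forall>w \<in> carrier W. g w \<in> carrier V \<and> f (g w) = w" and gf: "\<forall>v \<in> carrier V. g (f v) = v"
  shows "inverse_arrows (yd_category A) V W (mk_arrow V W f) (mk_arrow W V g)"
  using yd_map_inverse[OF assms] V W g gf yd_mapD(2)[OF f]
  by (auto simp: inverse_arrows_def yd_hom_iff)

lemma yd_map_tensor_map:
  assumes obj: "V \<in> yd_obj A" "W \<in> yd_obj A" "V' \<in> yd_obj A" "W' \<in> yd_obj A"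
    and f: "yd_map V V' f" and g: "yd_map W W' g"
  shows "yd_map (yd_tensor A V W) (yd_tensor A V' W') (tensor_map V' W' f g)"
proof -
  have closed: "\<forall>t \<in> carrier (tensor V W). tensor_map V' W' f g t \<in> carrier (tensor V' W')"
    using obj yd_mapD(1)[OF f] yd_mapD(1)[OF g] by (intro semilinear_closed_all[where b = False]) simp
  have act: "tensor_map V' W' f g (act (yd_tensor A V W) a t)
      = act (yd_tensor A V' W') a (tensor_map V' W' f g t)"
    if "a \<in> carrier A" "t \<in> carrier (tensor V W)" for a t
  proof -
    from that(2) obtain s where "t = tsum V W (tensor V W) (pure V W) s"
      using obj by (auto elim: tensor_expand)
    then show ?thesis
      using obj that(1) yd_mapD[OF f] yd_mapD[OF g] by simp
  qed
  have "coaction (yd_tensor A V' W') (tensor_map V' W' f g t)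
      = tsum A (tensor V W) (tensor A (tensor V' W'))
          (\<lambda>a u. pure A (tensor V' W') a (tensor_map V' W' f g u)) (coaction (yd_tensor A V W) t)"
    if "t \<in> carrier (tensor V W)" for t
  proof -
    from that obtain s where "t = tsum V W (tensor V W) (pure V W) s"
      using obj by (auto elim: tensor_expand)
    then show ?thesis
      using obj closed yd_mapD[OF f] yd_mapD[OF g] by simp
  qed
  moreover have "semilinear False (tensor V W) (tensor V' W') (tensor_map V' W' f g)"
    using obj yd_mapD(1)[OF f] yd_mapD(1)[OF g] by simp
  ultimately show ?thesis
    using act unfolding yd_map_def carrier_yd_tensor tsum_yd tensor_yd pure_yd semilinear_yd
    by blast
qed

lemma yd_map_braid:
  assumes V: "V \<in> yd_obj A" and W: "W \<in> yd_obj A"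
  shows "yd_map (yd_tensor A V W) (yd_tensor A W V) (yd_braid A V W)"
  using braid_act[OF V W] braid_coaction[OF V W]
    semilinear_braid[OF yd_linear_structure[OF V] yd_linear_structure[OF W]]
  unfolding yd_map_def carrier_yd_tensor tsum_yd tensor_yd pure_yd semilinear_yd
  by blast

end

text \<open>Uniqueness of inverses, h = h (f g) = (h f) g = g, which evaluates the definite
  description occurring in the second hexagon.\<close>

lemma (in category) inv_arrow_eq:
  assumes "X \<in> obj C" "Y \<in> obj C" "inverse_arrows C X Y f g"
  shows "inv_arrow C X Y f = g"
  unfolding inv_arrow_def
proof (rule the_equality[where P = "inverse_arrows C X Y f", OF assms(3)])
  fix h assume h: "inverse_arrows C X Y f h"
  then have "h = h \<bullet> (f \<bullet> g)"
    using assms comp_ident_right[of Y X h] by (simp add: inverse_arrows_def)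
  also have "\<dots> = (h \<bullet> f) \<bullet> g"
    using assms h comp_assoc[of Y X Y X g f h] by (simp add: inverse_arrows_def)
  also have "\<dots> = g"
    using assms h comp_ident_left[of Y X g] by (simp add: inverse_arrows_def)
  finally show "h = g" .
qed

context involutive_hopf_algebra
begin


section \<open>Associators and unitors\<close>

lemma assoc_inv_assoc:
  assumes "vector_space_C U" "vector_space_C V" "vector_space_C W"
    and t: "t \<in> carrier (tensor (tensor U V) W)"
  shows "assoc_inv U V W (assoc U V W t) = t"
proof -
  obtain r where r: "t = tsum (tensor U V) W (tensor (tensor U V) W) (\<lambda>s w.
    tsum U V (tensor (tensor U V) W) (\<lambda>u v. pure (tensor U V) W (pure U V u v) w) s) r"
    using tensor_expand3[OF t assms(1-3)] by blast
  show ?thesis unfolding r using assms(1-3) by simp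
qed

lemma assoc_assoc_inv:
  assumes "vector_space_C U" "vector_space_C V" "vector_space_C W"
    and t: "t \<in> carrier (tensor U (tensor V W))"
  shows "assoc U V W (assoc_inv U V W t) = t"
proof -
  have "assoc U V W (assoc_inv U V W t) = tsum U (tensor V W) (tensor U (tensor V W))
      (\<lambda>u s. pure U (tensor V W) u (tsum V W (tensor V W) (pure V W) s)) t"
    using assms by (subst assoc_inv_eq_tsum) simp_all
  \<comment> \<open>Again the inner sum is kept within \<open>pure\<close>, so that it can be
    identified with the tensor \<open>s\<close> it came from.\<close>
  also have "\<dots> = tsum U (tensor V W) (tensor U (tensor V W)) (pure U (tensor V W)) t"
    using assms by (intro tsum_cong) (simp_all add: tsum_ident del: pure_tsum_right)
  finally show ?thesis using assms by (simp add: tsum_ident)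
qed

text \<open>The two sides of each morphism condition are linear maps out of Y; when Y is a tensor
  product they can therefore be compared on pure tensors.\<close>

lemma yd_map_semilinear:
  assumes Y: "linear_structure Y" and Z: "linear_structure Z" and f: "semilinear False Y Z f"
  shows "a \<in> carrier A \<Longrightarrow> semilinear False Y Z (\<lambda>y. f (act Y a y))"
    and "a \<in> carrier A \<Longrightarrow> semilinear False Y Z (\<lambda>y. act Z a (f y))"
    and "semilinear False Y (tensor A Z) (\<lambda>y. coaction Z (f y))"
    and "semilinear False Y (tensor A Z)
      (\<lambda>y. tsum A Y (tensor A Z) (\<lambda>a u. pure A Z a (f u)) (coaction Y y))"
proof -
  show "a \<in> carrier A \<Longrightarrow> semilinear False Y Z (\<lambda>y. f (act Y a y))"
    using semilinear_comp[OF semilinear_act_right[OF Y semilinear_ident] f, of False a] by simp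
  show "a \<in> carrier A \<Longrightarrow> semilinear False Y Z (\<lambda>y. act Z a (f y))"
    using Z f by simp
  show "semilinear False Y (tensor A Z) (\<lambda>y. coaction Z (f y))"
    using Z f by simp
  show "semilinear False Y (tensor A Z)
      (\<lambda>y. tsum A Y (tensor A Z) (\<lambda>a u. pure A Z a (f u)) (coaction Y y))"
    using Y Z f semilinear_closed_all[OF f] by simp
qed

lemma yd_mapI2:
  assumes lin: "linear_structure V" "linear_structure W" and Z: "linear_structure Z"
    and f: "semilinear False (tensor V W) Z f"
    and act: "\<And>a v w. \<lbrakk>a \<in> carrier A; v \<in> carrier V; w \<in> carrier W\<rbrakk>
      \<Longrightarrow> f (act (yd_tensor A V W) a (pure V W v w)) = act Z a (f (pure V W v w))"
    and coaction: "\<And>v w. \<lbrakk>v \<in> carrier V; w \<in> carrier W\<rbrakk> \<Longrightarrow> coaction Z (f (pure V W v w))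
      = tsum A (tensor V W) (tensor A Z) (\<lambda>a u. pure A Z a (f u))
          (coaction (yd_tensor A V W) (pure V W v w))"
  shows "yd_map (yd_tensor A V W) Z f"
proof -
  have Y: "linear_structure (yd_tensor A V W)" and f': "semilinear False (yd_tensor A V W) Z f"
    using lin f by simp_all
  note sl = yd_map_semilinear[OF Y Z f', unfolded semilinear_yd tensor_yd tsum_yd]
  have vs: "vector_space_C V" "vector_space_C W" "vector_space_C Z" "vector_space_C (tensor A Z)"
    using lin Z by simp_all
  have "f (act (yd_tensor A V W) a t) = act Z a (f t)"
    if "a \<in> carrier A" "t \<in> carrier (tensor V W)" for a t
    by (rule semilinear_tensor_eqI[OF that(2) vs(1-3) sl(1)[OF that(1)] sl(2)[OF that(1)] act[OF that(1)]])
  moreover have "coaction Z (f t) = tsum A (tensor V W) (tensor A Z) (\<lambda>a u. pure A Z a (f u))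
      (coaction (yd_tensor A V W) t)" if "t \<in> carrier (tensor V W)" for t
    by (rule semilinear_tensor_eqI[OF that vs(1,2,4) sl(3,4) coaction])
  ultimately show ?thesis
    using f' unfolding yd_map_def carrier_yd_tensor tsum_yd tensor_yd by blast
qed

lemma semilinear_tensor_eqI3:
  assumes t: "t \<in> carrier (tensor (tensor U V) W)"
    and vs: "vector_space_C U" "vector_space_C V" "vector_space_C W" "vector_space_C X"
    and f: "semilinear b (tensor (tensor U V) W) X f" and g: "semilinear b' (tensor (tensor U V) W) X g"
    and eq: "\<And>u v w. \<lbrakk>u \<in> carrier U; v \<in> carrier V; w \<in> carrier W\<rbrakk>
      \<Longrightarrow> f (pure (tensor U V) W (pure U V u v) w) = g (pure (tensor U V) W (pure U V u v) w)"
  shows "f t = g t"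
proof (rule semilinear_tensor_eqI[OF t _ vs(3,4) f g])
  fix s w assume s: "s \<in> carrier (tensor U V)" and w: "w \<in> carrier W"
  have "semilinear False (tensor U V) (tensor (tensor U V) W) (\<lambda>s. pure (tensor U V) W s w)"
    using vs w by simp
  from semilinear_o(2)[OF this f] semilinear_o(2)[OF this g]
  have "(f \<circ> (\<lambda>s. pure (tensor U V) W s w)) s = (g \<circ> (\<lambda>s. pure (tensor U V) W s w)) s"
    by (rule semilinear_tensor_eqI[OF s vs(1,2,4)]) (use eq w in simp)
  then show "f (pure (tensor U V) W s w) = g (pure (tensor U V) W s w)" by simp
qed (use vs in simp)

lemma yd_mapI3:
  assumes lin: "linear_structure U" "linear_structure V" "linear_structure W"
    and Z: "linear_structure Z"
    and f: "semilinear False (tensor (tensor U V) W) Z f"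
    and act: "\<And>a u v w. \<lbrakk>a \<in> carrier A; u \<in> carrier U; v \<in> carrier V; w \<in> carrier W\<rbrakk>
      \<Longrightarrow> f (act (yd_tensor A (yd_tensor A U V) W) a (pure (tensor U V) W (pure U V u v) w))
        = act Z a (f (pure (tensor U V) W (pure U V u v) w))"
    and coaction: "\<And>u v w. \<lbrakk>u \<in> carrier U; v \<in> carrier V; w \<in> carrier W\<rbrakk>
      \<Longrightarrow> coaction Z (f (pure (tensor U V) W (pure U V u v) w))
        = tsum A (tensor (tensor U V) W) (tensor A Z) (\<lambda>a u. pure A Z a (f u))
          (coaction (yd_tensor A (yd_tensor A U V) W) (pure (tensor U V) W (pure U V u v) w))"
  shows "yd_map (yd_tensor A (yd_tensor A U V) W) Z f"
proof -
  let ?Y = "yd_tensor A (yd_tensor A U V) W"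
  have Y: "linear_structure ?Y" and f': "semilinear False ?Y Z f"
    using lin f by simp_all
  note sl = yd_map_semilinear[OF Y Z f', unfolded semilinear_yd tensor_yd tsum_yd]
  have vs: "vector_space_C U" "vector_space_C V" "vector_space_C W" "vector_space_C Z"
    "vector_space_C (tensor A Z)"
    using lin Z by simp_all
  have "f (act ?Y a t) = act Z a (f t)"
    if "a \<in> carrier A" "t \<in> carrier (tensor (tensor U V) W)" for a t
    by (rule semilinear_tensor_eqI3[OF that(2) vs(1-4) sl(1)[OF that(1)] sl(2)[OF that(1)] act[OF that(1)]])
  moreover have "coaction Z (f t) = tsum A (tensor (tensor U V) W) (tensor A Z)
      (\<lambda>a u. pure A Z a (f u)) (coaction ?Y t)" if "t \<in> carrier (tensor (tensor U V) W)" for t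
    by (rule semilinear_tensor_eqI3[OF that vs(1-3,5) sl(3,4) coaction])
  ultimately show ?thesis
    using f' unfolding yd_map_def carrier_yd_tensor tsum_yd tensor_yd by blast
qed

lemma assoc_closed:
  assumes "vector_space_C U" "vector_space_C V" "vector_space_C W"
  shows "\<forall>t \<in> carrier (tensor (tensor U V) W). assoc U V W t \<in> carrier (tensor U (tensor V W))"
    and "\<forall>t \<in> carrier (tensor U (tensor V W)). assoc_inv U V W t \<in> carrier (tensor (tensor U V) W)"
  using assms by (simp_all add: semilinear_closed_all[OF semilinear_assoc]
      semilinear_closed_all[OF semilinear_assoc_inv])

text \<open>Compatibility with the actions is coassociativity of \<Delta>; compatibility with the
  coactions is associativity of the product of A.\<close>

lemma yd_map_assoc:
  assumes U: "U \<in> yd_obj A" and V: "V \<in> yd_obj A" and W: "W \<in> yd_obj A"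
  shows "yd_map (yd_tensor A (yd_tensor A U V) W) (yd_tensor A U (yd_tensor A V W)) (assoc U V W)"
proof (rule yd_mapI3)
  fix a u v w assume a: "a \<in> carrier A" and "u \<in> carrier U" "v \<in> carrier V" "w \<in> carrier W"
  then show "assoc U V W (act (yd_tensor A (yd_tensor A U V) W) a (pure (tensor U V) W (pure U V u v) w))
      = act (yd_tensor A U (yd_tensor A V W)) a (assoc U V W (pure (tensor U V) W (pure U V u v) w))"
    using U V W coassoc_tsum[of a "tensor U (tensor V W)" False
          "\<lambda>x y z. pure U (tensor V W) (act U x u) (pure V W (act V y v) (act W z w))"]
    by simp
next
  fix u v w assume "u \<in> carrier U" "v \<in> carrier V" "w \<in> carrier W"
  then show "coaction (yd_tensor A U (yd_tensor A V W)) (assoc U V W (pure (tensor U V) W (pure U V u v) w))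
      = tsum A (tensor (tensor U V) W) (tensor A (yd_tensor A U (yd_tensor A V W)))
          (\<lambda>a t. pure A (yd_tensor A U (yd_tensor A V W)) a (assoc U V W t))
          (coaction (yd_tensor A (yd_tensor A U V) W) (pure (tensor U V) W (pure U V u v) w))"
    using U V W assoc_closed[of U V W] by (simp add: mult_assoc_A)
qed (use U V W in simp_all)

lemma left_unitor_eq_tsum:
  assumes "vector_space_C V" "t \<in> carrier (tensor complex_space V)"
  shows "lift V (\<lambda>z v. scalar_of z \<odot>\<^bsub>V\<^esub> v) t = tsum complex_space V V (\<lambda>z v. scalar_of z \<odot>\<^bsub>V\<^esub> v) t"
  using assms by (intro lift_eq_tsum) auto

lemma right_unitor_eq_tsum:
  assumes "vector_space_C V" "t \<in> carrier (tensor V complex_space)"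
  shows "lift V (\<lambda>v z. scalar_of z \<odot>\<^bsub>V\<^esub> v) t = tsum V complex_space V (\<lambda>v z. scalar_of z \<odot>\<^bsub>V\<^esub> v) t"
  using assms by (intro lift_eq_tsum) auto

lemma coaction_smult:
  assumes V: "V \<in> yd_obj A" and v: "v \<in> carrier V"
  shows "coaction V (c \<odot>\<^bsub>V\<^esub> v) = tsum A V (tensor A V) (\<lambda>a u. pure A V a (c \<odot>\<^bsub>V\<^esub> u)) (coaction V v)"
proof -
  have "coaction V (c \<odot>\<^bsub>V\<^esub> v) = c \<odot>\<^bsub>tensor A V\<^esub> tsum A V (tensor A V) (pure A V) (coaction V v)"
    using V v semilinear_smult[OF yd_semilinear_coaction] by (simp add: tsum_ident)
  with V show ?thesis by (simp add: smult_tsum pure_smult)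
qed

lemma act_smult_right:
  "\<lbrakk>V \<in> yd_obj A; a \<in> carrier A; v \<in> carrier V\<rbrakk> \<Longrightarrow> act V a (c \<odot>\<^bsub>V\<^esub> v) = c \<odot>\<^bsub>V\<^esub> act V a v"
  using semilinear_smult[of False V V "\<lambda>v. act V a v" v c] by simp

text \<open>The unit object acts through \<epsilon> and its coaction inserts 1, so the action
  condition is a counit axiom and the coaction condition is the unit law of A.\<close>

lemma yd_map_left_unitor:
  assumes V: "V \<in> yd_obj A"
  shows "yd_map (yd_tensor A (yd_unit A) V) V (tsum complex_space V V (\<lambda>z v. scalar_of z \<odot>\<^bsub>V\<^esub> v))"
proof (rule yd_mapI2)
  fix a z v assume a: "a \<in> carrier A" and "z \<in> carrier (yd_unit A)" "v \<in> carrier V"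
  then show "tsum complex_space V V (\<lambda>z v. scalar_of z \<odot>\<^bsub>V\<^esub> v)
      (act (yd_tensor A (yd_unit A) V) a (pure (yd_unit A) V z v))
    = act V a (tsum complex_space V V (\<lambda>z v. scalar_of z \<odot>\<^bsub>V\<^esub> v) (pure (yd_unit A) V z v))"
    using V counit_left_tsum[of a V False "\<lambda>a. act V a (scalar_of z \<odot>\<^bsub>V\<^esub> v)"]
    by (simp add: vs_smult_smult act_smult_right)
next
  fix z v assume "z \<in> carrier (yd_unit A)" "v \<in> carrier V"
  then show "coaction V (tsum complex_space V V (\<lambda>z v. scalar_of z \<odot>\<^bsub>V\<^esub> v) (pure (yd_unit A) V z v))
    = tsum A (tensor (yd_unit A) V) (tensor A V)
      (\<lambda>a u. pure A V a (tsum complex_space V V (\<lambda>z v. scalar_of z \<odot>\<^bsub>V\<^esub> v) u))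
      (coaction (yd_tensor A (yd_unit A) V) (pure (yd_unit A) V z v))"
    using V by (simp add: coaction_smult)
qed (use V in simp_all)

lemma yd_map_right_unitor:
  assumes V: "V \<in> yd_obj A"
  shows "yd_map (yd_tensor A V (yd_unit A)) V (tsum V complex_space V (\<lambda>v z. scalar_of z \<odot>\<^bsub>V\<^esub> v))"
proof (rule yd_mapI2)
  fix a z v assume a: "a \<in> carrier A" and "z \<in> carrier (yd_unit A)" "v \<in> carrier V"
  then show "tsum V complex_space V (\<lambda>v z. scalar_of z \<odot>\<^bsub>V\<^esub> v)
      (act (yd_tensor A V (yd_unit A)) a (pure V (yd_unit A) v z))
    = act V a (tsum V complex_space V (\<lambda>v z. scalar_of z \<odot>\<^bsub>V\<^esub> v) (pure V (yd_unit A) v z))"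
    using V counit_right_tsum[of a V False "\<lambda>a. act V a (scalar_of z \<odot>\<^bsub>V\<^esub> v)"]
    by (simp add: vs_smult_smult act_smult_right)
next
  fix z v assume "z \<in> carrier (yd_unit A)" "v \<in> carrier V"
  then show "coaction V (tsum V complex_space V (\<lambda>v z. scalar_of z \<odot>\<^bsub>V\<^esub> v) (pure V (yd_unit A) v z))
    = tsum A (tensor V (yd_unit A)) (tensor A V)
      (\<lambda>a u. pure A V a (tsum V complex_space V (\<lambda>v z. scalar_of z \<odot>\<^bsub>V\<^esub> v) u))
      (coaction (yd_tensor A V (yd_unit A)) (pure V (yd_unit A) v z))"
    using V by (simp add: coaction_smult)
qed (use V in simp_all)

text \<open>Simplification replaces the underlying space of \<open>yd_tensor A V W\<close> by
  \<open>tensor V W\<close>, after which the general braiding rules no longer match; these are the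
  same rules in simplified form.\<close>

lemma
  assumes "linear_structure U" "linear_structure V" "linear_structure W"
  shows braid_pure_yd_right: "\<lbrakk>u \<in> carrier U; t \<in> carrier (tensor V W)\<rbrakk>
      \<Longrightarrow> yd_braid A U (yd_tensor A V W) (pure U (tensor V W) u t)
        = tsum A U (tensor (tensor V W) U)
            (\<lambda>a u0. pure (tensor V W) U (act (yd_tensor A V W) a t) u0) (coaction U u)"
    and braid_pure_yd_left: "\<lbrakk>t \<in> carrier (tensor U V); w \<in> carrier W\<rbrakk>
      \<Longrightarrow> yd_braid A (yd_tensor A U V) W (pure (tensor U V) W t w)
        = tsum A (tensor U V) (tensor W (tensor U V))
            (\<lambda>a t0. pure W (tensor U V) (act W a w) t0) (coaction (yd_tensor A U V) t)"
    and braid_tsum_yd_right: "\<forall>y \<in> carrier Y. \<forall>z \<in> carrier Z. B y z \<in> carrier (tensor U (tensor V W))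
      \<Longrightarrow> yd_braid A U (yd_tensor A V W) (tsum Y Z (tensor U (tensor V W)) B t)
        = tsum Y Z (tensor (tensor V W) U) (\<lambda>y z. yd_braid A U (yd_tensor A V W) (B y z)) t"
    and braid_tsum_yd_left: "\<forall>y \<in> carrier Y. \<forall>z \<in> carrier Z. B y z \<in> carrier (tensor (tensor U V) W)
      \<Longrightarrow> yd_braid A (yd_tensor A U V) W (tsum Y Z (tensor (tensor U V) W) B t)
        = tsum Y Z (tensor W (tensor U V)) (\<lambda>y z. yd_braid A (yd_tensor A U V) W (B y z)) t"
    and braid_closed_yd_right: "t \<in> carrier (tensor U (tensor V W))
      \<Longrightarrow> yd_braid A U (yd_tensor A V W) t \<in> carrier (tensor (tensor V W) U)"
    and braid_closed_yd_left: "t \<in> carrier (tensor (tensor U V) W)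
      \<Longrightarrow> yd_braid A (yd_tensor A U V) W t \<in> carrier (tensor W (tensor U V))"
proof -
  note lin = linear_structure_yd_tensor[OF assms(1,2)] linear_structure_yd_tensor[OF assms(2,3)]
  note norm = carrier_yd_tensor tensor_yd pure_yd tsum_yd
  show "\<lbrakk>u \<in> carrier U; t \<in> carrier (tensor V W)\<rbrakk>
      \<Longrightarrow> yd_braid A U (yd_tensor A V W) (pure U (tensor V W) u t)
        = tsum A U (tensor (tensor V W) U)
            (\<lambda>a u0. pure (tensor V W) U (act (yd_tensor A V W) a t) u0) (coaction U u)"
    using braid_pure[OF assms(1) lin(2), of u t] unfolding norm by blast
  show "\<lbrakk>t \<in> carrier (tensor U V); w \<in> carrier W\<rbrakk>
      \<Longrightarrow> yd_braid A (yd_tensor A U V) W (pure (tensor U V) W t w)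
        = tsum A (tensor U V) (tensor W (tensor U V))
            (\<lambda>a t0. pure W (tensor U V) (act W a w) t0) (coaction (yd_tensor A U V) t)"
    using braid_pure[OF lin(1) assms(3), of t w] unfolding norm by blast
  show "\<forall>y \<in> carrier Y. \<forall>z \<in> carrier Z. B y z \<in> carrier (tensor U (tensor V W))
      \<Longrightarrow> yd_braid A U (yd_tensor A V W) (tsum Y Z (tensor U (tensor V W)) B t)
        = tsum Y Z (tensor (tensor V W) U) (\<lambda>y z. yd_braid A U (yd_tensor A V W) (B y z)) t"
    using braid_tsum[OF assms(1) lin(2), of Y Z B t] unfolding norm by blast
  show "\<forall>y \<in> carrier Y. \<forall>z \<in> carrier Z. B y z \<in> carrier (tensor (tensor U V) W)
      \<Longrightarrow> yd_braid A (yd_tensor A U V) W (tsum Y Z (tensor (tensor U V) W) B t)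
        = tsum Y Z (tensor W (tensor U V)) (\<lambda>y z. yd_braid A (yd_tensor A U V) W (B y z)) t"
    using braid_tsum[OF lin(1) assms(3), of Y Z B t] unfolding norm by blast
  show "t \<in> carrier (tensor U (tensor V W))
      \<Longrightarrow> yd_braid A U (yd_tensor A V W) t \<in> carrier (tensor (tensor V W) U)"
    using braid_closed[OF assms(1) lin(2), of t] unfolding norm by blast
  show "t \<in> carrier (tensor (tensor U V) W)
      \<Longrightarrow> yd_braid A (yd_tensor A U V) W t \<in> carrier (tensor W (tensor U V))"
    using braid_closed[OF lin(1) assms(3), of t] unfolding norm by blast
qed

lemmas braid_yd_rules [simp] = braid_pure_yd_right braid_pure_yd_left braid_tsum_yd_right
  braid_tsum_yd_left braid_closed_yd_right braid_closed_yd_left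

lemma assoc_closed' [simp]:
  assumes "vector_space_C U" "vector_space_C V" "vector_space_C W"
  shows "t \<in> carrier (tensor (tensor U V) W) \<Longrightarrow> assoc U V W t \<in> carrier (tensor U (tensor V W))"
    and "t \<in> carrier (tensor U (tensor V W)) \<Longrightarrow> assoc_inv U V W t \<in> carrier (tensor (tensor U V) W)"
  using assoc_closed[OF assms] by blast+

lemma tensor_map_closed:
  assumes "vector_space_C V" "vector_space_C W" "vector_space_C V'" "vector_space_C W'"
    "semilinear b V V' f" "semilinear b W W' g"
  shows "\<forall>t \<in> carrier (tensor V W). tensor_map V' W' f g t \<in> carrier (tensor V' W')"
  using assms by (intro semilinear_closed_all[of b]) simp


section \<open>The axioms of a braided tensor category\<close>

lemma left_unitor_yd:
  "vector_space_C V \<Longrightarrow> left_unitor (yd_category A) V = mk_arrow (yd_tensor A (yd_unit A) V) V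
    (tsum complex_space V V (\<lambda>z v. scalar_of z \<odot>\<^bsub>V\<^esub> v))"
  by (simp add: yd_category_def left_unitor_eq_tsum)

lemma right_unitor_yd:
  "vector_space_C V \<Longrightarrow> right_unitor (yd_category A) V = mk_arrow (yd_tensor A V (yd_unit A)) V
    (tsum V complex_space V (\<lambda>v z. scalar_of z \<odot>\<^bsub>V\<^esub> v))"
  by (simp add: yd_category_def right_unitor_eq_tsum)

lemma yd_homI:
  assumes "V \<in> yd_obj A" "W \<in> yd_obj A" "yd_map V W f"
  shows "mk_arrow V W f \<in> yd_hom A V W"
  using yd_hom_iff[OF assms(1,2)] assms(3) by blast

lemma yd_hom_source_target: "h \<in> yd_hom A V W \<Longrightarrow> source h = V \<and> target h = W"
  by (auto simp: yd_hom_def mk_arrow_def)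

lemma category_yd: "category (yd_category A)"
proof (unfold_locales, goal_cases)
  case (1 X Y X' Y' f)
  then show ?case using yd_hom_source_target by (metis yd_category_simps(2))
next
  case (2 X) then show ?case using yd_map_id by (auto intro: yd_homI)
next
  case (3 X Y Z f g)
  then obtain f' g' where "f = mk_arrow X Y f'" "g = mk_arrow Y Z g'" "yd_map X Y f'" "yd_map Y Z g'"
    by (auto simp: yd_hom_iff)
  with 3 yd_map_comp[of X Y Z f' g'] yd_mapD(2)[of X Y f'] show ?case
    by (auto intro: yd_homI)
next
  case (4 X Y f)
  then obtain f' where "f = mk_arrow X Y f'" "yd_map X Y f'" by (auto simp: yd_hom_iff)
  with yd_mapD(2)[of X Y f'] show ?case by simp
next
  case (5 X Y f)
  then obtain f' where "f = mk_arrow X Y f'" "yd_map X Y f'" by (auto simp: yd_hom_iff)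
  then show ?case by simp
next
  case (6 W X Y Z f g h)
  then obtain f' g' h' where "f = mk_arrow W X f'" "g = mk_arrow X Y g'" "h = mk_arrow Y Z h'"
    "yd_map W X f'" "yd_map X Y g'" by (auto simp: yd_hom_iff)
  with yd_mapD(2)[of W X f'] yd_mapD(2)[of X Y g'] show ?case by simp
qed

section \<open>Invertibility of associators, unitors and braidings\<close>

lemma inverse_arrows_associator:
  assumes "X \<in> yd_obj A" "Y \<in> yd_obj A" "Z \<in> yd_obj A"
  shows "inverse_arrows (yd_category A) (yd_tensor A (yd_tensor A X Y) Z) (yd_tensor A X (yd_tensor A Y Z))
    (mk_arrow (yd_tensor A (yd_tensor A X Y) Z) (yd_tensor A X (yd_tensor A Y Z)) (assoc X Y Z))
    (mk_arrow (yd_tensor A X (yd_tensor A Y Z)) (yd_tensor A (yd_tensor A X Y) Z) (assoc_inv X Y Z))"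
  using assms by (intro inverse_arrows_mk_arrow yd_map_assoc)
    (simp_all add: assoc_assoc_inv assoc_inv_assoc)

lemma inverse_arrows_left_unitor:
  assumes V: "V \<in> yd_obj A"
  shows "inverse_arrows (yd_category A) (yd_tensor A (yd_unit A) V) V
    (mk_arrow (yd_tensor A (yd_unit A) V) V (tsum complex_space V V (\<lambda>z v. scalar_of z \<odot>\<^bsub>V\<^esub> v)))
    (mk_arrow V (yd_tensor A (yd_unit A) V) (pure complex_space V (Scalar 1)))"
proof (rule inverse_arrows_mk_arrow[OF _ _ yd_map_left_unitor[OF V]])
  show "\<forall>t \<in> carrier (yd_tensor A (yd_unit A) V). pure complex_space V (Scalar 1)
      (tsum complex_space V V (\<lambda>z v. scalar_of z \<odot>\<^bsub>V\<^esub> v) t) = t"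
  proof
    fix t assume "t \<in> carrier (yd_tensor A (yd_unit A) V)"
    then obtain s where s: "t = tsum complex_space V (tensor complex_space V) (pure complex_space V) s"
      using V by (auto elim: tensor_expand)
    \<comment> \<open>The scalar crosses the tensor sign: 1 \<otimes> z v = z \<otimes> v, so v
      \<mapsto> 1 \<otimes> v inverts the unitor.\<close>
    have "pure complex_space V (Scalar 1) (scalar_of z \<odot>\<^bsub>V\<^esub> v) = pure complex_space V z v"
      if "z \<in> carrier complex_space" "v \<in> carrier V" for z v
      using V that by (simp add: pure_smult(2)) (simp add: pure_smult(1)[symmetric])
    then show "pure complex_space V (Scalar 1)
        (tsum complex_space V V (\<lambda>z v. scalar_of z \<odot>\<^bsub>V\<^esub> v) t) = t"
      unfolding s using V by simp
  qed
qed (use V in simp_all)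

lemma inverse_arrows_right_unitor:
  assumes V: "V \<in> yd_obj A"
  shows "inverse_arrows (yd_category A) (yd_tensor A V (yd_unit A)) V
    (mk_arrow (yd_tensor A V (yd_unit A)) V (tsum V complex_space V (\<lambda>v z. scalar_of z \<odot>\<^bsub>V\<^esub> v)))
    (mk_arrow V (yd_tensor A V (yd_unit A)) (\<lambda>v. pure V complex_space v (Scalar 1)))"
proof (rule inverse_arrows_mk_arrow[OF _ _ yd_map_right_unitor[OF V]])
  show "\<forall>t \<in> carrier (yd_tensor A V (yd_unit A)). pure V complex_space
      (tsum V complex_space V (\<lambda>v z. scalar_of z \<odot>\<^bsub>V\<^esub> v) t) (Scalar 1) = t"
  proof
    fix t assume "t \<in> carrier (yd_tensor A V (yd_unit A))"
    then obtain s where s: "t = tsum V complex_space (tensor V complex_space) (pure V complex_space) s"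
      using V by (auto elim: tensor_expand)
    have "pure V complex_space (scalar_of z \<odot>\<^bsub>V\<^esub> v) (Scalar 1) = pure V complex_space v z"
      if "z \<in> carrier complex_space" "v \<in> carrier V" for z v
      using V that by (simp add: pure_smult(1)) (simp add: pure_smult(2)[symmetric])
    then show "pure V complex_space
        (tsum V complex_space V (\<lambda>v z. scalar_of z \<odot>\<^bsub>V\<^esub> v) t) (Scalar 1) = t"
      unfolding s using V by simp
  qed
qed (use V in simp_all)

text \<open>
  With \<open>J = (* \<otimes> *) \<circ> \<tau>\<close> the involution of a tensor product is \<open>\<Psi> \<circ> J\<close>; since it squares
  to the identity, \<open>J \<circ> \<Psi> \<circ> J\<close> inverts the braiding.
\<close>

lemma iso_arrow_braiding:
  assumes V: "V \<in> yd_obj A" and W: "W \<in> yd_obj A"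
  shows "iso_arrow (yd_category A) (yd_tensor A V W) (yd_tensor A W V)
    (mk_arrow (yd_tensor A V W) (yd_tensor A W V) (yd_braid A V W))"
proof -
  define J :: "'a univ star_bimodule \<Rightarrow> 'a univ star_bimodule \<Rightarrow> 'a univ \<Rightarrow> 'a univ"
    where "J = (\<lambda>X Y. tsum X Y (tensor Y X) (\<lambda>x y. pure Y X (involution Y y) (involution X x)))"
  have J_semilinear: "semilinear True (tensor X Y) (tensor Y X) (J X Y)"
    and JJ: "\<And>t. t \<in> carrier (tensor X Y) \<Longrightarrow> J Y X (J X Y t) = t"
    and involution_eq: "\<And>t. t \<in> carrier (tensor X Y)
      \<Longrightarrow> involution (yd_tensor A X Y) t = yd_braid A Y X (J X Y t)"
    if X: "X \<in> yd_obj A" and Y: "Y \<in> yd_obj A" for X Y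
  proof -
    show lin: "semilinear True (tensor X Y) (tensor Y X) (J X Y)"
      unfolding J_def using X Y by (intro semilinear_tsum) simp_all
    fix t assume "t \<in> carrier (tensor X Y)"
    then obtain s where s: "t = tsum X Y (tensor X Y) (pure X Y) s"
      using X Y by (auto elim: tensor_expand)
    show "J Y X (J X Y t) = t"
      unfolding J_def s using X Y by simp
    show "involution (yd_tensor A X Y) t = yd_braid A Y X (J X Y t)"
      unfolding J_def s using X Y by (simp add: involution_yd_tensor)
  qed
  let ?g = "\<lambda>t. J W V (yd_braid A V W (J W V t))"
  note J_closed = semilinear_closed[OF J_semilinear]
  have right: "yd_braid A V W (?g t) = t" if t: "t \<in> carrier (tensor W V)" for t
  proof -
    have "yd_braid A V W (J W V t) \<in> carrier (tensor W V)"
      using V W t J_closed by simp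
    then show ?thesis
      using involution_yd_tensor_involution[OF W V t] involution_eq[OF W V] t by simp
  qed
  have left: "?g (yd_braid A V W t) = t" if t: "t \<in> carrier (tensor V W)" for t
  proof -
    \<comment> \<open>Both sides of invertibility rest on the single identity \<Psi> J \<Psi> J =
      id: writing t as J u, the left inverse property for t is J applied to the right inverse
      property for u.\<close>
    have u: "J V W t \<in> carrier (tensor W V)" and t_eq: "t = J W V (J V W t)"
      using V W t J_closed JJ by simp_all
    have "?g (yd_braid A V W (J W V (J V W t))) = J W V (J V W t)"
      using right[OF u] by simp
    then show ?thesis by (simp only: t_eq[symmetric])
  qed
  have "inverse_arrows (yd_category A) (yd_tensor A V W) (yd_tensor A W V)
      (mk_arrow (yd_tensor A V W) (yd_tensor A W V) (yd_braid A V W))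
      (mk_arrow (yd_tensor A W V) (yd_tensor A V W) ?g)"
    using V W left right J_closed by (intro inverse_arrows_mk_arrow yd_map_braid) simp_all
  then show ?thesis unfolding iso_arrow_def by blast
qed

lemma tensor_category_yd: "tensor_category (yd_category A)"
proof (intro tensor_category.intro category_yd tensor_category_axioms.intro, goal_cases)
  case (1 X Y) then show ?case by simp
next
  case (2 X X' Y Y' f g)
  then obtain f' g' where "f = mk_arrow X X' f'" "g = mk_arrow Y Y' g'" "yd_map X X' f'" "yd_map Y Y' g'"
    by (auto simp: yd_hom_iff)
  with 2 yd_map_tensor_map[of X Y X' Y' f' g'] show ?case by (auto intro: yd_homI)
next
  case (3 X Y)
  have "tensor_map X Y id id t = t" if "t \<in> carrier (tensor X Y)" for t
    using 3 that by (simp add: tensor_map_eq_tsum[where V = X and W = Y] tsum_ident)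
  with 3 show ?case by simp
next
  case (4 X X' X'' Y Y' Y'' f f' g g')
  then obtain p p' q q' where eq: "f = mk_arrow X X' p" "f' = mk_arrow X' X'' p'"
      "g = mk_arrow Y Y' q" "g' = mk_arrow Y' Y'' q'"
    and p: "yd_map X X' p" and p': "yd_map X' X'' p'" and q: "yd_map Y Y' q" and q': "yd_map Y' Y'' q'"
    by (auto simp: yd_hom_iff)
  have "tensor_map X'' Y'' (\<lambda>x. p' (p x)) (\<lambda>y. q' (q y)) t
    = tensor_map X'' Y'' p' q' (tensor_map X' Y' p q t)" if "t \<in> carrier (tensor X Y)" for t
  proof -
    from that obtain s where s: "t = tsum X Y (tensor X Y) (pure X Y) s"
      using 4 by (auto elim: tensor_expand)
    show ?thesis unfolding s
      using 4(1-6) yd_mapD(1,2)[OF p] yd_mapD(1,2)[OF p'] yd_mapD(1,2)[OF q] yd_mapD(1,2)[OF q']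
        semilinear_comp[OF yd_mapD(1)[OF p] yd_mapD(1)[OF p']]
        semilinear_comp[OF yd_mapD(1)[OF q] yd_mapD(1)[OF q']]
      by simp
  qed
  moreover have "\<forall>t \<in> carrier (tensor X Y). tensor_map X' Y' p q t \<in> carrier (tensor X' Y')"
    using 4(1-6) yd_mapD(1)[OF p] yd_mapD(1)[OF q] by (intro tensor_map_closed[where b = False]) simp_all
  ultimately show ?case
    unfolding eq using 4(1-6) yd_mapD(2)[OF p] yd_mapD(2)[OF q] by simp
next
  case 5 then show ?case by simp
next
  case (6 X Y Z)
  then show ?case using inverse_arrows_associator[of X Y Z] by (auto simp: iso_arrow_def)
next
  case (7 X X' Y Y' Z Z' f g h)
  then obtain p q r where eq: "f = mk_arrow X X' p" "g = mk_arrow Y Y' q" "h = mk_arrow Z Z' r"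
    and p: "yd_map X X' p" and q: "yd_map Y Y' q" and r: "yd_map Z Z' r"
    by (auto simp: yd_hom_iff)
  note pqr = yd_mapD(1,2)[OF p] yd_mapD(1,2)[OF q] yd_mapD(1,2)[OF r]
  have closed: "\<forall>t \<in> carrier (tensor (tensor X Y) Z). tensor_map (tensor X' Y') Z' (tensor_map X' Y' p q) r t
      \<in> carrier (tensor (tensor X' Y') Z')"
    using 7(1-6) pqr by (intro tensor_map_closed[where b = False]) simp_all
  have "assoc X' Y' Z' (tensor_map (tensor X' Y') Z' (tensor_map X' Y' p q) r t)
    = tensor_map X' (tensor Y' Z') p (tensor_map Y' Z' q r) (assoc X Y Z t)"
    if t: "t \<in> carrier (tensor (tensor X Y) Z)" for t
  proof -
    obtain s where s: "t = tsum (tensor X Y) Z (tensor (tensor X Y) Z) (\<lambda>s w.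
      tsum X Y (tensor (tensor X Y) Z) (\<lambda>u v. pure (tensor X Y) Z (pure X Y u v) w) s) s"
      using tensor_expand3[OF t] 7(1-6) by auto
    show ?thesis unfolding s using 7(1-6) pqr by simp
  qed
  then show ?case unfolding eq using 7(1-6) closed by simp
next
  case (8 X)
  then show ?case using inverse_arrows_left_unitor[of X]
    by (auto simp: iso_arrow_def left_unitor_yd)
next
  case (9 X Y f)
  then obtain p where eq: "f = mk_arrow X Y p" and p: "yd_map X Y p" by (auto simp: yd_hom_iff)
  have closed: "\<forall>t \<in> carrier (tensor complex_space X). tensor_map complex_space Y id p t
      \<in> carrier (tensor complex_space Y)"
    using 9(1,2) yd_mapD(1)[OF p] by (intro tensor_map_closed[where b = False]) simp_all
  have "tsum complex_space Y Y (\<lambda>z v. scalar_of z \<odot>\<^bsub>Y\<^esub> v) (tensor_map complex_space Y id p t)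
    = p (tsum complex_space X X (\<lambda>z v. scalar_of z \<odot>\<^bsub>X\<^esub> v) t)"
    if t: "t \<in> carrier (tensor complex_space X)" for t
  proof -
    obtain s where s: "t = tsum complex_space X (tensor complex_space X) (pure complex_space X) s"
      using 9(1) t by (auto elim: tensor_expand)
    have "p (tsum complex_space X X (\<lambda>z v. scalar_of z \<odot>\<^bsub>X\<^esub> v) s)
      = tsum complex_space X Y (\<lambda>z v. p (scalar_of z \<odot>\<^bsub>X\<^esub> v)) s"
      using 9(1,2) by (intro tsum_map[OF yd_mapD(1)[OF p]]) simp_all
    then show ?thesis
      unfolding s using 9(1,2) yd_mapD(1,2)[OF p] semilinear_smult[OF yd_mapD(1)[OF p]] by simp
  qed
  then show ?case unfolding eq using 9(1,2) closed by (simp add: left_unitor_yd)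
next
  case (10 X)
  then show ?case using inverse_arrows_right_unitor[of X]
    by (auto simp: iso_arrow_def right_unitor_yd)
next
  case (11 X Y f)
  then obtain p where eq: "f = mk_arrow X Y p" and p: "yd_map X Y p" by (auto simp: yd_hom_iff)
  have closed: "\<forall>t \<in> carrier (tensor X complex_space). tensor_map Y complex_space p id t
      \<in> carrier (tensor Y complex_space)"
    using 11(1,2) yd_mapD(1)[OF p] by (intro tensor_map_closed[where b = False]) simp_all
  have "tsum Y complex_space Y (\<lambda>v z. scalar_of z \<odot>\<^bsub>Y\<^esub> v) (tensor_map Y complex_space p id t)
    = p (tsum X complex_space X (\<lambda>v z. scalar_of z \<odot>\<^bsub>X\<^esub> v) t)"
    if t: "t \<in> carrier (tensor X complex_space)" for t
  proof -
    obtain s where s: "t = tsum X complex_space (tensor X complex_space) (pure X complex_space) s"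
      using 11(1) t by (auto elim: tensor_expand)
    have "p (tsum X complex_space X (\<lambda>v z. scalar_of z \<odot>\<^bsub>X\<^esub> v) s)
      = tsum X complex_space Y (\<lambda>v z. p (scalar_of z \<odot>\<^bsub>X\<^esub> v)) s"
      using 11(1,2) by (intro tsum_map[OF yd_mapD(1)[OF p]]) simp_all
    then show ?thesis
      unfolding s using 11(1,2) yd_mapD(1,2)[OF p] semilinear_smult[OF yd_mapD(1)[OF p]] by simp
  qed
  then show ?case unfolding eq using 11(1,2) closed by (simp add: right_unitor_yd)
next
  case (12 W X Y Z)
  have closed:
    "\<forall>t \<in> carrier (tensor (tensor (tensor W X) Y) Z).
      tensor_map (tensor W (tensor X Y)) Z (assoc W X Y) id t
        \<in> carrier (tensor (tensor W (tensor X Y)) Z)"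
    "\<forall>t \<in> carrier (tensor W (tensor (tensor X Y) Z)).
      tensor_map W (tensor X (tensor Y Z)) id (assoc X Y Z) t
        \<in> carrier (tensor W (tensor X (tensor Y Z)))"
    using 12 by (intro tensor_map_closed[where b = False]; simp)+
  have "tensor_map W (tensor X (tensor Y Z)) id (assoc X Y Z)
      (assoc W (tensor X Y) Z (tensor_map (tensor W (tensor X Y)) Z (assoc W X Y) id t))
    = assoc W X (tensor Y Z) (assoc (tensor W X) Y Z t)"
    if t: "t \<in> carrier (tensor (tensor (tensor W X) Y) Z)" for t
  proof -
    \<comment> \<open>Expanding the two outer layers suffices: the element of W \<otimes> X may
      remain arbitrary, since \<open>assoc_pure\<close> accepts a general left factor.\<close>
    obtain s where s: "t = tsum (tensor (tensor W X) Y) Z (tensor (tensor (tensor W X) Y) Z) (\<lambda>s w.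
      tsum (tensor W X) Y (tensor (tensor (tensor W X) Y) Z)
        (\<lambda>u v. pure (tensor (tensor W X) Y) Z (pure (tensor W X) Y u v) w) s) s"
      using tensor_expand3[OF t] 12 by auto
    show ?thesis unfolding s using 12 by simp
  qed
  then show ?case using 12 closed by simp
next
  case (13 X Y)
  have closed:
    "\<forall>t \<in> carrier (tensor (tensor X complex_space) Y). assoc X complex_space Y t
        \<in> carrier (tensor X (tensor complex_space Y))"
    using 13 by (intro assoc_closed) simp_all
  have "tensor_map X Y id (tsum complex_space Y Y (\<lambda>z v. scalar_of z \<odot>\<^bsub>Y\<^esub> v)) (assoc X complex_space Y t)
    = tensor_map X Y (tsum X complex_space X (\<lambda>v z. scalar_of z \<odot>\<^bsub>X\<^esub> v)) id t"
    if t: "t \<in> carrier (tensor (tensor X complex_space) Y)" for t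
  proof -
    obtain s where s: "t = tsum (tensor X complex_space) Y (tensor (tensor X complex_space) Y) (\<lambda>s w.
      tsum X complex_space (tensor (tensor X complex_space) Y)
        (\<lambda>u v. pure (tensor X complex_space) Y (pure X complex_space u v) w) s) s"
      using tensor_expand3[OF t] 13 by auto
    show ?thesis unfolding s using 13 by (simp add: pure_smult)
  qed
  then show ?case using 13 closed by (simp add: left_unitor_yd right_unitor_yd)
qed

lemma inv_arrow_associator:
  assumes "X \<in> yd_obj A" "Y \<in> yd_obj A" "Z \<in> yd_obj A"
  shows "inv_arrow (yd_category A) (yd_tensor A (yd_tensor A X Y) Z) (yd_tensor A X (yd_tensor A Y Z))
    (mk_arrow (yd_tensor A (yd_tensor A X Y) Z) (yd_tensor A X (yd_tensor A Y Z)) (assoc X Y Z))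
    = mk_arrow (yd_tensor A X (yd_tensor A Y Z)) (yd_tensor A (yd_tensor A X Y) Z) (assoc_inv X Y Z)"
  using assms
  by (intro category.inv_arrow_eq[OF category_yd] inverse_arrows_associator) simp_all

lemma braided_tensor_category_yd: "braided_tensor_category (yd_category A)"
proof (intro braided_tensor_category.intro tensor_category_yd braided_tensor_category_axioms.intro,
    goal_cases)
  case (1 X Y) then show ?case using iso_arrow_braiding by simp
next
  case (2 X X' Y Y' f g)
  then obtain p q where eq: "f = mk_arrow X X' p" "g = mk_arrow Y Y' q"
    and p: "yd_map X X' p" and q: "yd_map Y Y' q"
    by (auto simp: yd_hom_iff)
  have closed: "\<forall>t \<in> carrier (tensor X Y). tensor_map X' Y' p q t \<in> carrier (tensor X' Y')"
    using 2(1-4) yd_mapD(1)[OF p] yd_mapD(1)[OF q] by (intro tensor_map_closed[where b = False]) simp_all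
  have "yd_braid A X' Y' (tensor_map X' Y' p q t) = tensor_map Y' X' q p (yd_braid A X Y t)"
    if t: "t \<in> carrier (tensor X Y)" for t
  proof -
    obtain s where s: "t = tsum X Y (tensor X Y) (pure X Y) s"
      using 2(1-4) t by (auto elim: tensor_expand)
    show ?thesis unfolding s using 2(1-4) yd_mapD[OF p] yd_mapD[OF q] by simp
  qed
  then show ?case unfolding eq using 2(1-4) closed by simp
next
  case (3 X Y Z)
  have closed:
    "\<forall>t \<in> carrier (tensor (tensor X Y) Z). tensor_map (tensor Y X) Z (yd_braid A X Y) id t
        \<in> carrier (tensor (tensor Y X) Z)"
    "\<forall>t \<in> carrier (tensor Y (tensor X Z)). tensor_map Y (tensor Z X) id (yd_braid A X Z) t
        \<in> carrier (tensor Y (tensor Z X))"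
    using 3 by (intro tensor_map_closed[where b = False]; simp)+
  have "assoc Y Z X (yd_braid A X (yd_tensor A Y Z) (assoc X Y Z t))
    = tensor_map Y (tensor Z X) id (yd_braid A X Z)
        (assoc Y X Z (tensor_map (tensor Y X) Z (yd_braid A X Y) id t))"
    if t: "t \<in> carrier (tensor (tensor X Y) Z)" for t
  proof -
    obtain s where s: "t = tsum (tensor X Y) Z (tensor (tensor X Y) Z) (\<lambda>s w.
      tsum X Y (tensor (tensor X Y) Z) (\<lambda>u v. pure (tensor X Y) Z (pure X Y u v) w) s) s"
      using tensor_expand3[OF t] 3 by auto
    \<comment> \<open>First hexagon: braiding past Y and then past Z takes two coactions of x,
      whereas braiding past Y \<otimes> Z uses the coproduct of x_(-1).\<close>
    have coassoc: "tsum A X (tensor Y (tensor Z X)) (\<lambda>a x0. tsum A X (tensor Y (tensor Z X))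
        (\<lambda>b x1. pure Y (tensor Z X) (act Y a y) (pure Z X (act Z b z) x1)) (coaction X x0)) (coaction X x)
      = tsum A X (tensor Y (tensor Z X)) (\<lambda>a x0. tsum A A (tensor Y (tensor Z X))
        (\<lambda>a1 a2. pure Y (tensor Z X) (act Y a1 y) (pure Z X (act Z a2 z) x0)) (coprod A a)) (coaction X x)"
      if "x \<in> carrier X" "y \<in> carrier Y" "z \<in> carrier Z" for x y z
      using 3 that by (intro coaction_coassoc_tsum[where b = False]) simp_all
    show ?thesis unfolding s using 3 by (simp add: coassoc)
  qed
  then show ?case using 3 closed by simp
next
  case (4 X Y Z)
  have closed:
    "\<forall>t \<in> carrier (tensor X (tensor Y Z)). tensor_map X (tensor Z Y) id (yd_braid A Y Z) t
        \<in> carrier (tensor X (tensor Z Y))"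
    "\<forall>t \<in> carrier (tensor (tensor X Z) Y). tensor_map (tensor Z X) Y (yd_braid A X Z) id t
        \<in> carrier (tensor (tensor Z X) Y)"
    using 4 by (intro tensor_map_closed[where b = False]; simp)+
  have "assoc_inv Z X Y (yd_braid A (yd_tensor A X Y) Z (assoc_inv X Y Z t))
    = tensor_map (tensor Z X) Y (yd_braid A X Z) id
        (assoc_inv X Z Y (tensor_map X (tensor Z Y) id (yd_braid A Y Z) t))"
    if t: "t \<in> carrier (tensor X (tensor Y Z))" for t
  proof -
    \<comment> \<open>An expansion over X \<otimes> (Y \<otimes> Z) is obtained by expanding the
      image under the inverse associator and mapping back.\<close>
    have "assoc_inv X Y Z t \<in> carrier (tensor (tensor X Y) Z)" using t 4 by simp
    from tensor_expand3[OF this] 4 obtain s where "assoc_inv X Y Z t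
      = tsum (tensor X Y) Z (tensor (tensor X Y) Z) (\<lambda>s w.
      tsum X Y (tensor (tensor X Y) Z) (\<lambda>u v. pure (tensor X Y) Z (pure X Y u v) w) s) s"
      by auto
    then have "assoc X Y Z (assoc_inv X Y Z t) = assoc X Y Z
      (tsum (tensor X Y) Z (tensor (tensor X Y) Z) (\<lambda>s w.
      tsum X Y (tensor (tensor X Y) Z) (\<lambda>u v. pure (tensor X Y) Z (pure X Y u v) w) s) s)"
      by simp
    then have s: "t = tsum (tensor X Y) Z (tensor X (tensor Y Z)) (\<lambda>s w.
      tsum X Y (tensor X (tensor Y Z)) (\<lambda>u v. pure X (tensor Y Z) u (pure Y Z v w)) s) s"
      using t 4 by (simp add: assoc_assoc_inv)
    \<comment> \<open>Second hexagon: on the left x_(-1) y_(-1) acts on z as a product, on the right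
      the two factors act one after the other; after \<open>act_mult\<close> only the order of the
      sums differs.\<close>
    have commute: "tsum A X (tensor (tensor Z X) Y) (\<lambda>a x0. tsum A Y (tensor (tensor Z X) Y)
        (\<lambda>b y0. pure (tensor Z X) Y (pure Z X (act Z a (act Z b z)) x0) y0) (coaction Y y)) (coaction X x)
      = tsum A Y (tensor (tensor Z X) Y) (\<lambda>b y0. tsum A X (tensor (tensor Z X) Y)
        (\<lambda>a x0. pure (tensor Z X) Y (pure Z X (act Z a (act Z b z)) x0) y0) (coaction X x)) (coaction Y y)"
      if "x \<in> carrier X" "y \<in> carrier Y" "z \<in> carrier Z" for x y z
      using 4 that by (intro tsum_commute) simp_all
    show ?thesis unfolding s using 4 by (simp add: commute)
  qed
  then show ?case using 4 closed by (simp add: inv_arrow_associator)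
qed

end

theorem theorem5p3p9:
  fixes A :: "'a univ hopf"
  assumes "involutive_hopf_algebra A"
  shows "braided_tensor_category (yd_category A)"
  using assms by (rule involutive_hopf_algebra.braided_tensor_category_yd)

end
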